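(* Let $\mathcal{I}$ be an invariant locus (closed and $\mathrm{SL}(2,\mathbb{R})$-invariant subset) contained in the stratum $\mathcal{H}(k_1,\dots,k_r)$ of translation surfaces of genus $g$, where $2g-2=k_1+\dots+k_r$. Then its Lagrange spectrum $\mathcal{L}(\mathcal{I})=\{1/a(X):X\in\mathcal{I}\}$ satisfies $$\mathcal{L}(\mathcal{I})\subset\left[\pi\cdot\frac{2g+r-2}{2},\,+\infty\right].$$
   Context: A translation surface $X=(S,w)$ is a compact Riemann surface $S$ of genus $g$ with a nonzero holomorphic 1-form $w$ with zeros $p_1,\dots,p_r$ (conical singularities) of orders $k_1,\dots,k_r$ (a marked point counts as a zero of order $0$, e.g. for flat tori). The stratum $\mathcal{H}(k_1,\dots,k_r)$ is the moduli space of such surfaces; $\mathrm{SL}(2,\mathbb{R})$ acts by post-composing charts with linear maps. A saddle connection is a flat geodesic segment joining two conical singularities with none in its interior; $\mathrm{Hol}(X)\subset\mathbb{C}$ is the set of periods $v=\int_\gamma w$ of saddle connections; $\mathrm{Area}(v)=|\Re v|\cdot|\Im v|$ and $$a(X)=\liminf_{|\Im v|\to\infty,\ v\in\mathrm{Hol}(X)}\frac{\mathrm{Area}(v)}{\mathrm{Area}(X)},$$ with the convention $a(X)=0$ if $X$ has a vertical saddle connection, and $1/0=+\infty$. *)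

theory Defs
  imports
    "HOL-Complex_Analysis.Complex_Analysis"
    "HOL-Homology.Homology"
    "HOL-Library.Multiset"
begin

section \<open>Compact Riemann surfaces with a holomorphic 1-form\<close>

type_synonym 'a chart = "'a set \<times> ('a \<Rightarrow> complex)"

record 'a riemann_surface =
  rs_top :: "'a topology"
  rs_atlas :: "'a chart set"

definition riemann_surface :: "('a, 'b) riemann_surface_scheme \<Rightarrow> bool" where
  "riemann_surface S \<longleftrightarrow>
     Hausdorff_space (rs_top S) \<and>
     (\<Union>(U, \<phi>) \<in> rs_atlas S. U) = topspace (rs_top S) \<and>
     (\<forall>(U, \<phi>) \<in> rs_atlas S. openin (rs_top S) U \<and> open (\<phi> ` U) \<and>
        homeomorphic_map (subtopology (rs_top S) U) (top_of_set (\<phi> ` U)) \<phi>) \<and>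
     (\<forall>(U, \<phi>) \<in> rs_atlas S. \<forall>(V, \<psi>) \<in> rs_atlas S.
        (\<psi> \<circ> inv_into U \<phi>) holomorphic_on \<phi> ` (U \<inter> V))"

text \<open>
  Second countability is omitted: all surfaces below are compact.
\<close>

definition compact_riemann_surface :: "('a, 'b) riemann_surface_scheme \<Rightarrow> bool" where
  "compact_riemann_surface S \<longleftrightarrow>
     riemann_surface S \<and> compact_space (rs_top S) \<and> connected_space (rs_top S) \<and>
     topspace (rs_top S) \<noteq> {}"

definition has_genus :: "('a, 'b) riemann_surface_scheme \<Rightarrow> nat \<Rightarrow> bool" where
  "has_genus S g \<longleftrightarrow> homology_group 1 (rs_top S) \<cong> free_Abelian_group {..<2 * g}"

text \<open>
  A 1-form is given by its local coefficients: in the chart \<open>c = (U, \<phi>)\<close> of the atlas, with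
  coordinate \<open>z\<close>, it is \<open>w c z dz\<close> on \<open>\<phi> ` U\<close>.  Values elsewhere are irrelevant.
\<close>

definition holomorphic_one_form ::
    "('a, 'b) riemann_surface_scheme \<Rightarrow> ('a chart \<Rightarrow> complex \<Rightarrow> complex) \<Rightarrow> bool" where
  "holomorphic_one_form S w \<longleftrightarrow>
     (\<forall>(U, \<phi>) \<in> rs_atlas S. w (U, \<phi>) holomorphic_on \<phi> ` U) \<and>
     (\<forall>(U, \<phi>) \<in> rs_atlas S. \<forall>(V, \<psi>) \<in> rs_atlas S. \<forall>p \<in> U \<inter> V.
        w (U, \<phi>) (\<phi> p) = w (V, \<psi>) (\<psi> p) * deriv (\<psi> \<circ> inv_into U \<phi>) (\<phi> p))"

definition chart_at :: "('a, 'b) riemann_surface_scheme \<Rightarrow> 'a \<Rightarrow> 'a chart" where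
  "chart_at S p = (SOME c. c \<in> rs_atlas S \<and> p \<in> fst c)"


section \<open>Translation surfaces\<close>

text \<open>
  \<open>ts_sing\<close> is the finite set of conical singularities \<open>p\<^sub>1, \<dots>, p\<^sub>r\<close>: all zeros of the form,
  and possibly some marked points, which are zeros of order 0.  Since a chart has infinite image,
  finiteness of \<open>ts_sing\<close> forces the form to be nonzero.
\<close>

record 'a translation_surface = "'a riemann_surface" +
  ts_form :: "'a chart \<Rightarrow> complex \<Rightarrow> complex"
  ts_sing :: "'a set"

definition translation_surface :: "'a translation_surface \<Rightarrow> bool" where
  "translation_surface X \<longleftrightarrow>
     compact_riemann_surface X \<and>
     holomorphic_one_form X (ts_form X) \<and>
     finite (ts_sing X) \<and> ts_sing X \<subseteq> topspace (rs_top X) \<and>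
     (\<forall>(U, \<phi>) \<in> rs_atlas X. \<forall>p \<in> U. ts_form X (U, \<phi>) (\<phi> p) = 0 \<longrightarrow> p \<in> ts_sing X)"

definition zero_order :: "'a translation_surface \<Rightarrow> 'a \<Rightarrow> int" where
  "zero_order X p = (let c = chart_at X p in zorder (ts_form X c) (snd c p))"

text \<open>
  Injective local primitives of the form, i.e. coordinates \<open>z\<close> in which the form is \<open>dz\<close>.
\<close>

definition translation_chart ::
    "'a translation_surface \<Rightarrow> 'a set \<Rightarrow> ('a \<Rightarrow> complex) \<Rightarrow> bool" where
  "translation_chart X U z \<longleftrightarrow>
     openin (rs_top X) U \<and> U \<inter> ts_sing X = {} \<and> inj_on z U \<and>
     (\<forall>(V, \<phi>) \<in> rs_atlas X. \<forall>p \<in> U \<inter> V.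
        ((z \<circ> inv_into V \<phi>) has_field_derivative ts_form X (V, \<phi>) (\<phi> p)) (at (\<phi> p)))"

text \<open>
  The total area of \<open>|w|\<^sup>2\<close>: the supremum over finite families of disjoint Borel pieces, each
  contained in a chart.  By compactness it is attained at a Borel partition subordinate to finitely
  many charts.
\<close>

definition surface_area :: "'a translation_surface \<Rightarrow> ennreal" where
  "surface_area X =
     (SUP F \<in> {F. finite F \<and> disjoint_family_on snd F \<and>
                  (\<forall>((U, \<phi>), B) \<in> F. (U, \<phi>) \<in> rs_atlas X \<and> B \<subseteq> U \<and> \<phi> ` B \<in> sets borel)}.
        \<Sum>(c, B) \<in> F. \<integral>\<^sup>+ z \<in> snd c ` B. ennreal ((cmod (ts_form X c z))\<^sup>2) \<partial>lborel)"


section \<open>Strata as moduli spaces\<close>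

text \<open>
  A point of moduli space is represented by the translation surfaces in its isomorphism class, and
  a subset of moduli space by an isomorphism-invariant set of translation surfaces.  A compact
  Riemann surface has continuum many points, so every isomorphism class is represented on any type
  \<open>'a\<close> with at least that many elements; on smaller types there are no translation surfaces.
\<close>

definition stratum :: "nat \<Rightarrow> nat list \<Rightarrow> 'a translation_surface set" where
  "stratum g ks = {X. translation_surface X \<and> has_genus X g \<and>
     image_mset (zero_order X) (mset_set (ts_sing X)) = image_mset int (mset ks)}"

definition linear_act :: "real^2^2 \<Rightarrow> complex \<Rightarrow> complex" where
  "linear_act A z = (let u = A *v vector [Re z, Im z] in Complex (u $ 1) (u $ 2))"

text \<open>
  \<open>Y\<close> represents \<open>A \<cdot> X\<close>: up to an identification \<open>h\<close> of the underlying spaces, its translation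
  charts are those of \<open>X\<close> post-composed with \<open>A\<close>.  For \<open>A = mat 1\<close> this is isomorphism of
  translation surfaces, since a homeomorphism that is holomorphic off a finite set is holomorphic.
\<close>

definition represents_act ::
    "real^2^2 \<Rightarrow> 'a translation_surface \<Rightarrow> 'a translation_surface \<Rightarrow> bool" where
  "represents_act A X Y \<longleftrightarrow>
     (\<exists>h. homeomorphic_map (rs_top X) (rs_top Y) h \<and> h ` ts_sing X = ts_sing Y \<and>
        (\<forall>U z. translation_chart X U z \<longrightarrow>
           translation_chart Y (h ` U) (linear_act A \<circ> z \<circ> inv_into U h)))"

abbreviation isomorphic ::
    "'a translation_surface \<Rightarrow> 'a translation_surface \<Rightarrow> bool" where
  "isomorphic \<equiv> represents_act (mat 1)"

text \<open>
  The topology of the stratum (that of period coordinates).  \<open>Y\<close> is \<open>\<epsilon>\<close>-close to \<open>X\<close> if some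
  homeomorphism matching the singularities is, in translation charts, a translation up to a map
  with Lipschitz constant \<open>\<epsilon>\<close>; this is the integrated form of \<open>|h\<^sup>* w\<^sub>Y - w\<^sub>X| \<le> \<epsilon> |w\<^sub>X|\<close>.  If the
  periods of the edges of a geodesic triangulation of \<open>X\<close> with vertices in the singular set are
  changed slightly, the piecewise affine map is such an \<open>h\<close>; conversely such an \<open>h\<close> moves the
  period of a path \<open>\<gamma>\<close> by at most \<open>\<epsilon>\<close> times the length of \<open>\<gamma>\<close>, and for small \<open>\<epsilon>\<close> the triangulation
  persists on \<open>Y\<close>.
\<close>

definition close_surfaces ::
    "real \<Rightarrow> 'a translation_surface \<Rightarrow> 'a translation_surface \<Rightarrow> bool" where
  "close_surfaces \<epsilon> X Y \<longleftrightarrow>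
     (\<exists>h. homeomorphic_map (rs_top X) (rs_top Y) h \<and> h ` ts_sing X = ts_sing Y \<and>
        (\<forall>p \<in> topspace (rs_top X) - ts_sing X. \<exists>U z V \<zeta>.
           p \<in> U \<and> translation_chart X U z \<and> translation_chart Y V \<zeta> \<and> h ` U \<subseteq> V \<and>
           (\<forall>q \<in> U. \<forall>q' \<in> U.
              cmod ((\<zeta> (h q) - \<zeta> (h q')) - (z q - z q')) \<le> \<epsilon> * cmod (z q - z q'))))"

definition stratum_topology :: "nat \<Rightarrow> nat list \<Rightarrow> 'a translation_surface topology" where
  "stratum_topology g ks = topology (\<lambda>\<O>. \<O> \<subseteq> stratum g ks \<and>
     (\<forall>X \<in> \<O>. \<exists>\<epsilon>>0. \<forall>Y \<in> stratum g ks. close_surfaces \<epsilon> X Y \<longrightarrow> Y \<in> \<O>))"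

lemma close_surfaces_mono:
  assumes "close_surfaces \<delta> X Y" "\<delta> \<le> \<epsilon>"
  shows "close_surfaces \<epsilon> X Y"
proof -
  have le: "a \<le> \<epsilon> * cmod b" if "a \<le> \<delta> * cmod b" for a b
    using that mult_right_mono[OF assms(2) norm_ge_zero[of b]] by linarith
  from assms(1) obtain h where
    h: "homeomorphic_map (rs_top X) (rs_top Y) h" "h ` ts_sing X = ts_sing Y" and
    loc: "\<And>p. p \<in> topspace (rs_top X) - ts_sing X \<Longrightarrow> \<exists>U z V \<zeta>.
           p \<in> U \<and> translation_chart X U z \<and> translation_chart Y V \<zeta> \<and> h ` U \<subseteq> V \<and>
           (\<forall>q \<in> U. \<forall>q' \<in> U.
              cmod ((\<zeta> (h q) - \<zeta> (h q')) - (z q - z q')) \<le> \<delta> * cmod (z q - z q'))"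
    unfolding close_surfaces_def by (elim exE conjE) (rule that, assumption+, erule (1) bspec)
  show ?thesis
    unfolding close_surfaces_def
  proof (intro exI[of _ h] conjI h ballI)
    fix p assume "p \<in> topspace (rs_top X) - ts_sing X"
    from loc[OF this] obtain U z V \<zeta> where
      c: "p \<in> U" "translation_chart X U z" "translation_chart Y V \<zeta>" "h ` U \<subseteq> V" and
      e: "\<forall>q \<in> U. \<forall>q' \<in> U.
            cmod ((\<zeta> (h q) - \<zeta> (h q')) - (z q - z q')) \<le> \<delta> * cmod (z q - z q')"
      by (elim exE conjE)
    show "\<exists>U z V \<zeta>.
           p \<in> U \<and> translation_chart X U z \<and> translation_chart Y V \<zeta> \<and> h ` U \<subseteq> V \<and>
           (\<forall>q \<in> U. \<forall>q' \<in> U.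
              cmod ((\<zeta> (h q) - \<zeta> (h q')) - (z q - z q')) \<le> \<epsilon> * cmod (z q - z q'))"
      by (rule exI[of _ U], rule exI[of _ z], rule exI[of _ V], rule exI[of _ \<zeta>])
        (intro conjI c ballI le, rule e[rule_format])
  qed
qed

lemma openin_stratum_topology:
  fixes \<O> :: "'a translation_surface set"
  shows "openin (stratum_topology g ks) \<O> \<longleftrightarrow> \<O> \<subseteq> stratum g ks \<and>
     (\<forall>X \<in> \<O>. \<exists>\<epsilon>>0. \<forall>Y \<in> stratum g ks. close_surfaces \<epsilon> X Y \<longrightarrow> Y \<in> \<O>)"
proof -
  let ?open = "\<lambda>\<O> :: 'a translation_surface set. \<O> \<subseteq> stratum g ks \<and>
     (\<forall>X \<in> \<O>. \<exists>\<epsilon>>0. \<forall>Y \<in> stratum g ks. close_surfaces \<epsilon> X Y \<longrightarrow> Y \<in> \<O>)"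
  have "istopology ?open"
    unfolding istopology_def
  proof (intro conjI allI impI)
    fix A B :: "'a translation_surface set" assume A: "?open A" and B: "?open B"
    show "A \<inter> B \<subseteq> stratum g ks" using A by blast
    show "\<forall>X \<in> A \<inter> B. \<exists>\<epsilon>>0. \<forall>Y \<in> stratum g ks. close_surfaces \<epsilon> X Y \<longrightarrow> Y \<in> A \<inter> B"
    proof
      fix X assume "X \<in> A \<inter> B"
      then obtain \<delta> \<epsilon> where "\<delta> > 0" "\<forall>Y \<in> stratum g ks. close_surfaces \<delta> X Y \<longrightarrow> Y \<in> A"
        and "\<epsilon> > 0" "\<forall>Y \<in> stratum g ks. close_surfaces \<epsilon> X Y \<longrightarrow> Y \<in> B"
        using A B by blast
      moreover have "close_surfaces \<delta> X Y" "close_surfaces \<epsilon> X Y"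
        if "close_surfaces (min \<delta> \<epsilon>) X Y" for Y
        using that by (rule close_surfaces_mono; simp)+
      ultimately show "\<exists>\<epsilon>>0. \<forall>Y \<in> stratum g ks. close_surfaces \<epsilon> X Y \<longrightarrow> Y \<in> A \<inter> B"
        by (intro exI[of _ "min \<delta> \<epsilon>"]) simp
    qed
  next
    fix \<K> :: "'a translation_surface set set" assume K: "\<forall>K \<in> \<K>. ?open K"
    then show "\<Union>\<K> \<subseteq> stratum g ks" by blast
    show "\<forall>X \<in> \<Union>\<K>. \<exists>\<epsilon>>0. \<forall>Y \<in> stratum g ks. close_surfaces \<epsilon> X Y \<longrightarrow> Y \<in> \<Union>\<K>"
    proof
      fix X assume "X \<in> \<Union>\<K>"
      then obtain K where "K \<in> \<K>" "X \<in> K" by blast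
      with K obtain \<epsilon> where "\<epsilon> > 0" "\<forall>Y \<in> stratum g ks. close_surfaces \<epsilon> X Y \<longrightarrow> Y \<in> K"
        by blast
      with \<open>K \<in> \<K>\<close> show "\<exists>\<epsilon>>0. \<forall>Y \<in> stratum g ks. close_surfaces \<epsilon> X Y \<longrightarrow> Y \<in> \<Union>\<K>"
        by blast
    qed
  qed
  then show ?thesis
    unfolding stratum_topology_def by (simp only: topology_inverse')
qed

lemma topspace_stratum_topology [simp]: "topspace (stratum_topology g ks) = stratum g ks"
proof
  show "topspace (stratum_topology g ks) \<subseteq> stratum g ks"
    using openin_topspace[of "stratum_topology g ks"] unfolding openin_stratum_topology by blast
  have "openin (stratum_topology g ks) (stratum g ks)"
    unfolding openin_stratum_topology using zero_less_one by blast
  then show "stratum g ks \<subseteq> topspace (stratum_topology g ks)"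
    by (rule openin_subset)
qed

definition invariant_locus :: "nat \<Rightarrow> nat list \<Rightarrow> 'a translation_surface set \<Rightarrow> bool" where
  "invariant_locus g ks I \<longleftrightarrow>
     I \<subseteq> stratum g ks \<and>
     (\<forall>X \<in> I. \<forall>Y. translation_surface Y \<and> isomorphic X Y \<longrightarrow> Y \<in> I) \<and>
     closedin (stratum_topology g ks) I \<and>
     (\<forall>A. det A = 1 \<longrightarrow>
        (\<forall>X \<in> I. \<forall>Y. translation_surface Y \<and> represents_act A X Y \<longrightarrow> Y \<in> I))"


section \<open>Saddle connections and the Lagrange spectrum\<close>

text \<open>
  Saddle connections are parametrised on \<open>[0, 1]\<close> with constant nonzero velocity in translation
  charts.
\<close>

definition saddle_connection :: "'a translation_surface \<Rightarrow> (real \<Rightarrow> 'a) \<Rightarrow> bool" where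
  "saddle_connection X \<gamma> \<longleftrightarrow>
     pathin (rs_top X) \<gamma> \<and> \<gamma> 0 \<in> ts_sing X \<and> \<gamma> 1 \<in> ts_sing X \<and>
     (\<forall>t \<in> {0<..<1}. \<gamma> t \<notin> ts_sing X) \<and>
     (\<exists>c. c \<noteq> 0 \<and> (\<forall>t \<in> {0<..<1}. \<forall>U z. translation_chart X U z \<and> \<gamma> t \<in> U \<longrightarrow>
        ((z \<circ> \<gamma>) has_vector_derivative c) (at t)))"

definition path_period :: "'a translation_surface \<Rightarrow> (real \<Rightarrow> 'a) \<Rightarrow> complex" where
  "path_period X \<gamma> = integral {0..1} (\<lambda>t. let c = chart_at X (\<gamma> t) in
     ts_form X c (snd c (\<gamma> t)) * vector_derivative (snd c \<circ> \<gamma>) (at t))"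

definition Hol :: "'a translation_surface \<Rightarrow> complex set" where
  "Hol X = {path_period X \<gamma> | \<gamma>. saddle_connection X \<gamma>}"

definition period_area :: "complex \<Rightarrow> real" where
  "period_area v = \<bar>Re v\<bar> * \<bar>Im v\<bar>"

definition lagrange_constant :: "'a translation_surface \<Rightarrow> ereal" where
  "lagrange_constant X =
     (if \<exists>v \<in> Hol X. Re v = 0 then 0
      else Liminf (inf (filtercomap (\<lambda>v. \<bar>Im v\<bar>) at_top) (principal (Hol X)))
             (\<lambda>v. ereal (period_area v) / enn2ereal (surface_area X)))"

text \<open>
  In \<open>ereal\<close>, \<open>1 / 0 = \<infinity>\<close>.
\<close>

definition lagrange_spectrum :: "'a translation_surface set \<Rightarrow> ereal set" where
  "lagrange_spectrum I = {1 / lagrange_constant X | X. X \<in> I}"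

end

theory Submission imports Defs begin

text \<open>
  For a real number \<open>t\<close> measure periods in the norm \<open>cmod (stretch t v)\<close>, which amounts to replacing
  \<open>X\<close> by its image under the Teichmueller flow.  If every saddle connection has norm at least \<open>s\<close>, all
  geodesics from a singularity \<open>p\<close> of order \<open>k\<close> extend to norm \<open>s\<close> and so sweep out a cone which is a
  \<open>(k+1)\<close>-fold cover of an ellipse; the parts of norm less than \<open>s / 2\<close> of these cones are
  embedded and disjoint.  Comparing areas, \<open>N * pi * (s / 2)\<^sup>2 \<le> Area X\<close> with
  \<open>N = (\<Sum>p. k p + 1) = 2 * g - 2 + r\<close>.  Hence for every \<open>t\<close> and every \<open>s\<close> violating this bound there is a
  period \<open>v\<close> of norm less than \<open>s\<close>, so \<open>\<bar>Re v\<bar> * \<bar>Im v\<bar> < s\<^sup>2 / 2\<close> and \<open>\<bar>Re v\<bar> < s * exp (- t)\<close>.  In the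
  absence of vertical saddle connections the latter forces \<open>\<bar>Im v\<bar>\<close> to infinity with \<open>t\<close>, and so
  \<open>a X \<le> 2 / (pi * N)\<close>.
\<close>

section \<open>Area and holomorphic maps\<close>

text \<open>The surface itself is never deformed: only the norm on periods depends on
  \<open>t\<close>, so the cone coordinates and exponential maps are the same for all
  \<open>t\<close>. The obstacle is that no metric on \<open>X\<close> is at hand; lengths are
  measured in the plane and transported by developing maps. Completeness is replaced by compactness:
  a geodesic of finite length converges, and if its limit is regular it can be continued. Hence a
  ray from a singularity can be stopped only by a singularity, and then a saddle connection has been
  found. The radius is \<open>s / 2\<close> because two overlapping cones join two singularities by
  a path of norm less than \<open>s\<close>. The constant comes from the threshold
  \<open>s\<^sup>2 = 4 * Area / (pi * N)\<close>, half of which is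
  \<open>2 * Area / (pi * N)\<close>; the half is due to
  \<open>2 * x * y \<le> x\<^sup>2 + y\<^sup>2\<close>. At a zero of order \<open>k\<close> a
  coordinate in which the form is \<open>d(\<zeta> ^ (k + 1))\<close> turns the branched cover of
  the ellipse into a star-shaped plane domain, at the price that straight rays have to be
  reparametrised by roots in order to have constant velocity.\<close>

definition plane_to_complex :: "real^2 \<Rightarrow> complex" where
  "plane_to_complex v = Complex (v $ 1) (v $ 2)"

definition complex_to_plane :: "complex \<Rightarrow> real^2" where
  "complex_to_plane z = vector [Re z, Im z]"

lemma plane_complex_inverse [simp]:
  "plane_to_complex (complex_to_plane z) = z" "complex_to_plane (plane_to_complex v) = v"
  unfolding plane_to_complex_def complex_to_plane_def by (auto simp: vec_eq_iff forall_2)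

lemma bounded_linear_plane_to_complex: "bounded_linear plane_to_complex"
  unfolding plane_to_complex_def linear_conv_bounded_linear[symmetric]
  by (intro linearI) (auto simp: complex_eq_iff)

lemma bounded_linear_complex_to_plane: "bounded_linear complex_to_plane"
  unfolding complex_to_plane_def linear_conv_bounded_linear[symmetric]
  by (intro linearI) (auto simp: vec_eq_iff forall_2)

lemma plane_to_complex_measurable [measurable]: "plane_to_complex \<in> borel_measurable borel"
  by (intro borel_measurable_continuous_onI bounded_linear.continuous_on[OF bounded_linear_plane_to_complex] continuous_on_id)

lemma vimage_plane_to_complex: "plane_to_complex -` A = complex_to_plane ` A"
  by (auto simp: image_iff) (metis plane_complex_inverse(2))

text \<open>Change of variables is carried out on \<open>real^2\<close>, where the Jacobian is a
  matrix determinant; this carries the result over to \<open>complex\<close>.\<close>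

lemma lborel_complex: "(lborel :: complex measure) = distr lborel borel plane_to_complex"
proof (rule lborel_eqI)
  fix l u :: complex assume le: "\<And>b. b \<in> Basis \<Longrightarrow> l \<bullet> b \<le> u \<bullet> b"
  have le': "Re l \<le> Re u" "Im l \<le> Im u" using le[of 1] le[of \<i>] by (auto simp: Basis_complex_def)
  define l' where "l' = complex_to_plane l"
  define u' where "u' = complex_to_plane u"
  have c: "l' $ 1 = Re l" "l' $ 2 = Im l" "u' $ 1 = Re u" "u' $ 2 = Im u"
    unfolding l'_def u'_def complex_to_plane_def by simp_all
  have "plane_to_complex -` box l u = box l' u'"
    by (auto simp: mem_box_cart forall_2 c in_box_complex_iff plane_to_complex_def)
  then have "emeasure (distr lborel borel plane_to_complex) (box l u) = emeasure lborel (box l' u')"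
    by (simp add: emeasure_distr)
  also have "\<dots> = emeasure lborel (cbox l' u')"
    by (simp add: emeasure_lborel_box_eq emeasure_lborel_cbox_eq)
  also have "\<dots> = ennreal (measure lborel (cbox l' u'))"
    by (rule emeasure_eq_ennreal_measure) (simp add: emeasure_lborel_cbox_eq)
  also have "cbox l' u' \<noteq> {}" using le' by (simp add: interval_ne_empty_cart forall_2 c)
  then have "measure lborel (cbox l' u') = (\<Prod>i\<in>UNIV. u' $ i - l' $ i)"
    by (rule content_cbox_cart)
  also have "\<dots> = (\<Prod>b\<in>Basis. (u - l) \<bullet> b)"
    by (simp add: UNIV_2 c Basis_complex_def)
  finally show "emeasure (distr lborel borel plane_to_complex) (box l u) = ennreal (\<Prod>b\<in>Basis. (u - l) \<bullet> b)" .
qed simp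

lemma emeasure_complex_to_plane:
  assumes "A \<in> sets borel"
  shows "complex_to_plane ` A \<in> sets borel" "emeasure lborel (complex_to_plane ` A) = emeasure lborel A"
proof -
  have "plane_to_complex -` A \<inter> space borel \<in> sets borel"
    by (rule measurable_sets[OF plane_to_complex_measurable assms])
  then show "complex_to_plane ` A \<in> sets borel" by (simp add: vimage_plane_to_complex)
  have "emeasure lborel A = emeasure (distr lborel borel plane_to_complex) A" by (subst lborel_complex) simp
  also have "\<dots> = emeasure lborel (plane_to_complex -` A \<inter> space lborel)"
    by (rule emeasure_distr) (use assms in auto)
  finally show "emeasure lborel (complex_to_plane ` A) = emeasure lborel A" by (simp add: vimage_plane_to_complex)
qed

lemma borel_holomorphic_image:
  assumes "open \<Omega>" "\<psi> holomorphic_on \<Omega>" "inj_on \<psi> \<Omega>" "S \<subseteq> \<Omega>" "S \<in> sets borel"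
  shows "\<psi> ` S \<in> sets borel"
proof -
  obtain k where k: "k holomorphic_on \<psi> ` \<Omega>" "\<And>z. z \<in> \<Omega> \<Longrightarrow> deriv \<psi> z * deriv k (\<psi> z) = 1" "\<And>z. z \<in> \<Omega> \<Longrightarrow> k (\<psi> z) = z"
    by (rule holomorphic_has_inverse[OF assms(2,1,3)]) (rule that; simp)
  have o: "open (\<psi> ` \<Omega>)" by (rule open_mapping_thm3[OF assms(2,1,3)])
  have "k \<in> borel_measurable (restrict_space borel (\<psi> ` \<Omega>))"
    by (intro borel_measurable_continuous_on_restrict holomorphic_on_imp_continuous_on k)
  from measurable_sets[OF this assms(5)]
  have "k -` S \<inter> \<psi> ` \<Omega> \<in> sets (restrict_space borel (\<psi> ` \<Omega>))" by (simp add: space_restrict_space)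
  then have "k -` S \<inter> \<psi> ` \<Omega> \<in> sets borel"
    using o by (subst (asm) sets_restrict_space_iff) auto
  moreover have "k -` S \<inter> \<psi> ` \<Omega> = \<psi> ` S" using k(3) assms(4) by force
  ultimately show ?thesis by simp
qed

lemma holomorphic_indicator_measurable:
  assumes "open \<Omega>" "f holomorphic_on \<Omega>" "S \<subseteq> \<Omega>" "S \<in> sets borel"
  shows "(\<lambda>z. ennreal ((cmod (f z))\<^sup>2) * indicator S z) \<in> borel_measurable borel"
proof -
  have "continuous_on \<Omega> (\<lambda>z. (cmod (f z))\<^sup>2)"
    by (intro continuous_intros holomorphic_on_imp_continuous_on assms)
  then have "(\<lambda>z. indicator \<Omega> z *\<^sub>R (cmod (f z))\<^sup>2) \<in> borel_measurable borel"
    using assms(1) by (intro borel_measurable_continuous_on_indicator) auto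
  then have "(\<lambda>z. ennreal (indicator \<Omega> z *\<^sub>R (cmod (f z))\<^sup>2) * indicator S z) \<in> borel_measurable borel"
    using assms(4) by measurable
  moreover have "(\<lambda>z. ennreal (indicator \<Omega> z *\<^sub>R (cmod (f z))\<^sup>2) * indicator S z) =
      (\<lambda>z. ennreal ((cmod (f z))\<^sup>2) * indicator S z)"
    using assms(3) by (auto simp: indicator_def fun_eq_iff)
  ultimately show ?thesis by (simp only:)
qed

text \<open>As a real linear map, multiplication by \<open>deriv \<psi> z\<close> has determinant
  \<open>(cmod (deriv \<psi> z))\<^sup>2\<close>. Finite measure puts the image into
  \<open>lmeasurable\<close>, the setting of the change of variables formula.\<close>

lemma nn_integral_holomorphic_image:
  assumes \<Omega>: "open \<Omega>" and \<psi>: "\<psi> holomorphic_on \<Omega>" "inj_on \<psi> \<Omega>" and S: "S \<subseteq> \<Omega>" "S \<in> sets borel"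
    and fin: "emeasure lborel (\<psi> ` S) < \<infinity>"
  shows "(\<integral>\<^sup>+z\<in>S. ennreal ((cmod (deriv \<psi> z))\<^sup>2) \<partial>lborel) = emeasure lborel (\<psi> ` S)"
proof -
  define f where "f = (\<lambda>v. complex_to_plane (\<psi> (plane_to_complex v)))"
  define f' where "f' = (\<lambda>x h. complex_to_plane (deriv \<psi> (plane_to_complex x) * plane_to_complex h))"
  define S2 where "S2 = complex_to_plane ` S"
  have S2: "S2 \<in> sets borel" unfolding S2_def using emeasure_complex_to_plane(1)[OF S(2)] .
  have \<psi>S: "\<psi> ` S \<in> sets borel" by (rule borel_holomorphic_image[OF \<Omega> \<psi> S])
  have fS2: "f ` S2 = complex_to_plane ` (\<psi> ` S)" unfolding f_def S2_def image_image by simp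
  have der: "(f has_derivative f' x) (at x within S2)" if "x \<in> S2" for x
  proof -
    have x: "plane_to_complex x \<in> \<Omega>" using that S(1) unfolding S2_def by auto
    have "(\<psi> has_derivative (\<lambda>h. deriv \<psi> (plane_to_complex x) * h)) (at (plane_to_complex x))"
      using holomorphic_derivI[OF \<psi>(1) \<Omega> x] unfolding has_field_derivative_def by simp
    from has_derivative_compose[OF bounded_linear_imp_has_derivative[OF bounded_linear_plane_to_complex] this]
    have "((\<lambda>v. \<psi> (plane_to_complex v)) has_derivative
        (\<lambda>h. deriv \<psi> (plane_to_complex x) * plane_to_complex h)) (at x)" .
    from bounded_linear.has_derivative[OF bounded_linear_complex_to_plane this]
    have "(f has_derivative f' x) (at x)" unfolding f_def f'_def .
    then show ?thesis by (rule has_derivative_at_withinI)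
  qed
  have inj: "inj_on f S2"
  proof (rule inj_onI)
    fix x y assume xy: "x \<in> S2" "y \<in> S2" "f x = f y"
    then have "\<psi> (plane_to_complex x) = \<psi> (plane_to_complex y)" unfolding f_def by (metis plane_complex_inverse(1))
    moreover have "plane_to_complex x \<in> \<Omega>" "plane_to_complex y \<in> \<Omega>" using xy S(1) unfolding S2_def by auto
    ultimately show "x = y" using inj_onD[OF \<psi>(2)] by (metis plane_complex_inverse(2))
  qed
  have det: "\<bar>det (matrix (f' x))\<bar> = (cmod (deriv \<psi> (plane_to_complex x)))\<^sup>2" for x
  proof -
    have 1: "plane_to_complex (axis 1 1) = 1" "plane_to_complex (axis 2 1) = \<i>"
      unfolding plane_to_complex_def by (auto simp: complex_eq_iff axis_def)
    show ?thesis
      unfolding cmod_power2 det_2 matrix_def f'_def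
      by (simp add: 1 complex_to_plane_def power2_eq_square)
  qed
  have fS2m: "f ` S2 \<in> lmeasurable" unfolding fS2
  proof (rule fmeasurableI)
    show "complex_to_plane ` \<psi> ` S \<in> sets lebesgue" using emeasure_complex_to_plane(1)[OF \<psi>S] by simp
    show "emeasure lebesgue (complex_to_plane ` \<psi> ` S) < \<infinity>"
      using emeasure_complex_to_plane[OF \<psi>S] fin by simp
  qed
  have "((\<lambda>x. \<bar>det (matrix (f' x))\<bar>) has_integral measure lebesgue (f ` S2)) S2"
    using has_measure_differentiable_image[OF _ der inj, of "measure lebesgue (f ` S2)"] S2 fS2m by simp
  from nn_integral_has_integral_lebesgue[OF _ this]
  have "(\<integral>\<^sup>+x. ennreal (indicator S2 x * \<bar>det (matrix (f' x))\<bar>) \<partial>lborel) = ennreal (measure lebesgue (f ` S2))"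
    by simp
  also have "\<dots> = emeasure lebesgue (f ` S2)"
    using fS2m by (simp add: emeasure_eq_measure2)
  also have "\<dots> = emeasure lborel (\<psi> ` S)"
    unfolding fS2 using emeasure_complex_to_plane[OF \<psi>S] by simp
  finally have A: "(\<integral>\<^sup>+x. ennreal (indicator S2 x * \<bar>det (matrix (f' x))\<bar>) \<partial>lborel) = emeasure lborel (\<psi> ` S)" .
  have ind: "indicator S2 x = (indicator S (plane_to_complex x) :: real)" for x
    unfolding S2_def vimage_plane_to_complex[symmetric] by (simp add: indicator_def)
  have m: "(\<lambda>z. ennreal ((cmod (deriv \<psi> z))\<^sup>2) * indicator S z) \<in> borel_measurable borel"
    by (rule holomorphic_indicator_measurable[OF \<Omega> holomorphic_deriv[OF \<psi>(1) \<Omega>] S])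
  have "(\<integral>\<^sup>+z\<in>S. ennreal ((cmod (deriv \<psi> z))\<^sup>2) \<partial>lborel) =
      (\<integral>\<^sup>+z\<in>S. ennreal ((cmod (deriv \<psi> z))\<^sup>2) \<partial>distr lborel borel plane_to_complex)"
    by (subst lborel_complex) simp
  also have "\<dots> = (\<integral>\<^sup>+x. ennreal ((cmod (deriv \<psi> (plane_to_complex x)))\<^sup>2) * indicator S (plane_to_complex x) \<partial>lborel)"
    by (rule nn_integral_distr) (use m in auto)
  also have "\<dots> = (\<integral>\<^sup>+x. ennreal (indicator S2 x * \<bar>det (matrix (f' x))\<bar>) \<partial>lborel)"
    unfolding det ind by (intro nn_integral_cong) (auto simp: indicator_def)
  also have "\<dots> = emeasure lborel (\<psi> ` S)" by (rule A)
  finally show ?thesis .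
qed

text \<open>This is the branch cut of \<open>Ln\<close>; \<open>packing\<close> removes it from the
  ellipse at no cost of area.\<close>

lemma emeasure_nonpos_Reals: "emeasure lborel (\<real>\<^sub>\<le>\<^sub>0 :: complex set) = 0"
proof -
  have "negligible {z::complex. z \<bullet> \<i> = 0}"
    by (rule negligible_standard_hyperplane) (simp add: Basis_complex_def)
  then have "negligible (\<real>\<^sub>\<le>\<^sub>0 :: complex set)"
    by (rule negligible_subset) (auto simp: complex_nonpos_Reals_iff)
  then have "emeasure lebesgue (\<real>\<^sub>\<le>\<^sub>0 :: complex set) = 0"
    unfolding negligible_iff_null_sets by auto
  moreover have "(\<real>\<^sub>\<le>\<^sub>0 :: complex set) \<in> sets borel"
    by (intro borel_closed closed_nonpos_Reals_complex)
  ultimately show ?thesis by simp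
qed

section \<open>Stretching the plane without changing areas\<close>

definition stretch :: "real \<Rightarrow> complex \<Rightarrow> complex" where
  "stretch t v = Complex (exp t * Re v) (exp (- t) * Im v)"

lemma lborel_stretch: "lborel = distr lborel borel (stretch t)"
proof -
  define c where "c = (\<lambda>j::complex. if j = 1 then exp t else exp (- t))"
  have st: "0 + (\<Sum>j\<in>Basis. (c j * (x \<bullet> j)) *\<^sub>R j) = stretch t x" for x :: complex
    unfolding c_def stretch_def by (auto simp: Basis_complex_def complex_eq_iff)
  have "(\<Prod>j\<in>Basis. \<bar>c j\<bar>) = 1"
    unfolding c_def by (simp add: Basis_complex_def exp_minus)
  then show ?thesis
    using lborel_affine_euclidean[of c 0] unfolding st by (simp add: density_1 c_def)
qed

lemma emeasure_stretch_ball: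
  assumes "0 \<le> r"
  shows "emeasure lborel {v. cmod (stretch t v) < r} = ennreal (pi * r\<^sup>2)"
proof -
  have m: "stretch t \<in> borel_measurable borel"
    unfolding stretch_def[abs_def] Complex_eq by (intro borel_measurable_continuous_onI continuous_intros)
  have "emeasure lborel (ball (0::complex) r) = emeasure (distr lborel borel (stretch t)) (ball 0 r)"
    by (subst lborel_stretch[of t]) simp
  also have "\<dots> = emeasure lborel (stretch t -` ball 0 r \<inter> space lborel)"
    by (rule emeasure_distr) (use m in auto)
  also have "stretch t -` ball 0 r \<inter> space lborel = {v. cmod (stretch t v) < r}" by auto
  finally show ?thesis using assms by (simp add: emeasure_ball unit_ball_vol_2)
qed

lemma stretch_diff: "stretch t (v - w) = stretch t v - stretch t w"
  and stretch_scaleR: "stretch t (r *\<^sub>R v) = r *\<^sub>R stretch t v"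
  unfolding stretch_def by (auto simp: complex_eq_iff algebra_simps)

lemma continuous_on_stretch [continuous_intros]:
  "continuous_on S f \<Longrightarrow> continuous_on S (\<lambda>x. stretch t (f x))"
  unfolding stretch_def Complex_eq by (intro continuous_intros)

text \<open>At \<open>L = 0\<close> the quotient is infinity, which covers the surfaces with a
  vertical saddle connection.\<close>

lemma ereal_le_divide_bound:
  assumes L: "0 \<le> L" "L \<le> ereal (1 / b)" and b: "b > 0"
  shows "ereal b \<le> 1 / L"
proof (cases L)
  case (real l)
  show ?thesis
  proof (cases "l = 0")
    case False
    then have l: "l > 0" "l \<le> 1 / b" using L real by auto
    then have "b \<le> 1 / l" using b by (simp add: field_simps)
    then show ?thesis using l(1) unfolding real by (simp add: one_ereal_def)
  qed (simp add: real divide_ereal_def zero_ereal_def[symmetric])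
qed (use L in auto)

text \<open>The product of the two components is unchanged by the stretch, and twice the product of
  the stretched ones is at most the sum of their squares.\<close>

lemma period_area_le_stretch: "period_area v \<le> (cmod (stretch t v))\<^sup>2 / 2"
proof -
  have "exp t * exp (- t) = (1::real)" by (simp add: exp_minus)
  then have "\<bar>Re v\<bar> * \<bar>Im v\<bar> = (exp t * \<bar>Re v\<bar>) * (exp (- t) * \<bar>Im v\<bar>)" by (simp add: algebra_simps)
  also have "2 * \<dots> \<le> (exp t * \<bar>Re v\<bar>)\<^sup>2 + (exp (- t) * \<bar>Im v\<bar>)\<^sup>2"
    using sum_squares_bound[of "exp t * \<bar>Re v\<bar>" "exp (- t) * \<bar>Im v\<bar>"] by simp
  also have "\<dots> = (cmod (stretch t v))\<^sup>2" unfolding stretch_def cmod_power2 by (simp add: power_mult_distrib)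
  finally show ?thesis unfolding period_area_def by simp
qed

section \<open>Rays and locally constant predicates\<close>

text \<open>The filters \<open>at x within W\<close> match those of the developing maps, so that the
  continuation arguments below reduce to a local claim about a predicate and its negation.\<close>

lemma connected_locally_constant_pred:
  fixes W :: "'b::metric_space set"
  assumes W: "connected W" "a \<in> W" "\<phi> a" "x \<in> W"
    and t: "\<And>x. x \<in> W \<Longrightarrow> \<phi> x \<Longrightarrow> \<forall>\<^sub>F y in at x within W. \<phi> y"
    and f: "\<And>x. x \<in> W \<Longrightarrow> \<not> \<phi> x \<Longrightarrow> \<forall>\<^sub>F y in at x within W. \<not> \<phi> y"
  shows "\<phi> x"
proof -
  have "\<phi> constant_on W"
  proof (rule locally_constant_imp_constant[OF W(1)])
    fix x assume x: "x \<in> W"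
    have "\<forall>\<^sub>F y in at x within W. \<phi> y = \<phi> x" using t[OF x] f[OF x] by (cases "\<phi> x") simp_all
    then obtain d where d: "d > 0" "\<And>y. y \<in> W \<Longrightarrow> y \<noteq> x \<Longrightarrow> dist y x < d \<Longrightarrow> \<phi> y = \<phi> x"
      unfolding eventually_at by blast
    have "\<forall>y\<in>W \<inter> ball x d. \<phi> y = \<phi> x"
    proof
      fix y assume "y \<in> W \<inter> ball x d"
      then show "\<phi> y = \<phi> x" using d(2)[of y] by (cases "y = x") (auto simp: dist_commute)
    qed
    moreover have "openin (top_of_set W) (W \<inter> ball x d)" by (simp add: openin_open_Int)
    moreover have "x \<in> W \<inter> ball x d" using x d(1) by simp
    ultimately show "\<exists>S. openin (top_of_set W) S \<and> x \<in> S \<and> (\<forall>y\<in>S. \<phi> y = \<phi> x)"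
      by (intro exI[of _ "W \<inter> ball x d"] conjI)
  qed
  then show ?thesis using W unfolding constant_on_def by metis
qed

text \<open>The end 0 is missing since it stands for the singularity itself, where no developing map
  is defined.\<close>

definition punctured_ray :: "complex \<Rightarrow> complex set" where
  "punctured_ray \<zeta> = (\<lambda>\<tau>. \<tau> *\<^sub>R \<zeta>) ` {0<..1}"

lemma punctured_rayE:
  assumes "x \<in> punctured_ray \<zeta>"
  obtains \<tau> where "x = \<tau> *\<^sub>R \<zeta>" "0 < \<tau>" "\<tau> \<le> 1"
proof -
  obtain \<tau> where "x = \<tau> *\<^sub>R \<zeta>" "\<tau> \<in> {0<..1}" using assms unfolding punctured_ray_def by (rule imageE)
  then show ?thesis by (intro that[of \<tau>]) auto
qed

lemma connected_punctured_ray: "connected (punctured_ray \<zeta>)"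
  unfolding punctured_ray_def by (intro connected_continuous_image continuous_intros connected_Ioc)

lemma punctured_ray_self: "\<zeta> \<in> punctured_ray \<zeta>"
  unfolding punctured_ray_def by (intro image_eqI[of _ _ 1]) auto

lemma punctured_ray_scale: "0 < \<tau> \<Longrightarrow> \<tau> \<le> 1 \<Longrightarrow> \<tau> *\<^sub>R \<zeta> \<in> punctured_ray \<zeta>"
  unfolding punctured_ray_def by auto

lemma punctured_ray_subset: 
  assumes "x \<in> punctured_ray \<zeta>" shows "punctured_ray x \<subseteq> punctured_ray \<zeta>"
proof -
  obtain \<tau> where \<tau>: "x = \<tau> *\<^sub>R \<zeta>" "0 < \<tau>" "\<tau> \<le> 1" using assms by (rule punctured_rayE)
  show ?thesis
  proof
    fix y assume "y \<in> punctured_ray x"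
    then obtain s where s: "y = s *\<^sub>R x" "0 < s" "s \<le> 1" by (rule punctured_rayE)
    have "y = (s * \<tau>) *\<^sub>R \<zeta>" using s \<tau> by simp
    moreover have "0 < s * \<tau>" "s * \<tau> \<le> 1" using s \<tau> by (auto intro: mult_le_one)
    ultimately show "y \<in> punctured_ray \<zeta>" by (simp add: punctured_ray_scale)
  qed
qed

lemma punctured_ray_small:
  assumes "\<delta> > 0"
  obtains \<tau> where "0 < \<tau>" "\<tau> \<le> 1" "cmod (\<tau> *\<^sub>R \<zeta>) < \<delta>"
proof
  define K where "K = cmod \<zeta> + 1"
  have K: "K > 0" "cmod \<zeta> \<le> K" using norm_ge_zero[of \<zeta>] unfolding K_def by linarith+
  define \<tau> where "\<tau> = min 1 (\<delta> / 2 / K)"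
  show "0 < \<tau>" "\<tau> \<le> 1" using assms K unfolding \<tau>_def by auto
  have "cmod (\<tau> *\<^sub>R \<zeta>) = \<tau> * cmod \<zeta>" using \<open>0 < \<tau>\<close> by simp
  also have "\<dots> \<le> \<tau> * K" using \<open>0 < \<tau>\<close> K by simp
  also have "\<dots> \<le> \<delta> / 2 / K * K" using K by (intro mult_right_mono) (auto simp: \<tau>_def)
  also have "\<dots> = \<delta> / 2" using K by simp
  finally show "cmod (\<tau> *\<^sub>R \<zeta>) < \<delta>" using assms by simp
qed

text \<open>On a cone of angle \<open>2 * pi * m\<close> the distance from the apex is the
  \<open>m\<close>-th power of the modulus; the root makes the developed ray move with constant
  velocity.\<close>

lemma root_scaleR_power:
  assumes "0 \<le> t" "0 < m" shows "(root m t *\<^sub>R z) ^ m = of_real t * (z::complex) ^ m"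
proof -
  have "(root m t *\<^sub>R z) ^ m = root m t ^ m *\<^sub>R z ^ m" by (rule scaleR_power)
  also have "root m t ^ m = t" using assms by simp
  finally show ?thesis by (simp add: scaleR_conv_of_real)
qed

lemma continuous_map_within_iff:
  "continuous_map (top_of_set W) Y F \<longleftrightarrow> (\<forall>x\<in>W. limitin Y F (F x) (at x within W))"
proof -
  have "atin_within euclidean x W = at x within W" for x
    by (auto simp: filter_eq_iff eventually_atin_within eventually_at_topological)
  then show ?thesis by (simp add: continuous_map_atin atin_subtopology_within)
qed

section \<open>Charts of a translation surface\<close>

locale tsurf =
  fixes X :: "'a translation_surface"
  assumes translation_surface: "translation_surface X"
begin

abbreviation T :: "'a topology" where "T \<equiv> rs_top X"
abbreviation Sing :: "'a set" where "Sing \<equiv> ts_sing X"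

lemma Hausdorff: "Hausdorff_space T"
  and atlas_cover: "(\<Union>(U, \<phi>) \<in> rs_atlas X. U) = topspace T"
  and compact: "compact_space T"
  and nonempty: "topspace T \<noteq> {}"
  and finite_Sing: "finite Sing"
  and Sing_subset: "Sing \<subseteq> topspace T"
  and form_nonzero: "\<And>U \<phi> p. (U, \<phi>) \<in> rs_atlas X \<Longrightarrow> p \<in> U \<Longrightarrow> p \<notin> Sing \<Longrightarrow> ts_form X (U, \<phi>) (\<phi> p) \<noteq> 0"
  and form_holomorphic: "\<And>U \<phi>. (U, \<phi>) \<in> rs_atlas X \<Longrightarrow> ts_form X (U, \<phi>) holomorphic_on \<phi> ` U"
  and form_change: "\<And>U \<phi> V \<psi> p. (U, \<phi>) \<in> rs_atlas X \<Longrightarrow> (V, \<psi>) \<in> rs_atlas X \<Longrightarrow> p \<in> U \<Longrightarrow> p \<in> V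
     \<Longrightarrow> ts_form X (U, \<phi>) (\<phi> p) = ts_form X (V, \<psi>) (\<psi> p) * deriv (\<psi> \<circ> inv_into U \<phi>) (\<phi> p)"
  and atlas_openin: "\<And>U \<phi>. (U, \<phi>) \<in> rs_atlas X \<Longrightarrow> openin T U"
  and atlas_open_range: "\<And>U \<phi>. (U, \<phi>) \<in> rs_atlas X \<Longrightarrow> open (\<phi> ` U)"
  and atlas_homeo: "\<And>U \<phi>. (U, \<phi>) \<in> rs_atlas X \<Longrightarrow>
         homeomorphic_map (subtopology T U) (top_of_set (\<phi> ` U)) \<phi>"
  and atlas_transition: "\<And>U \<phi> V \<psi>. (U, \<phi>) \<in> rs_atlas X \<Longrightarrow> (V, \<psi>) \<in> rs_atlas X \<Longrightarrow>
        (\<psi> \<circ> inv_into U \<phi>) holomorphic_on \<phi> ` (U \<inter> V)"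
proof -
  note defs = translation_surface_def compact_riemann_surface_def riemann_surface_def
    holomorphic_one_form_def
  note ts = translation_surface[unfolded defs]
  show "Hausdorff_space T" "(\<Union>(U, \<phi>) \<in> rs_atlas X. U) = topspace T" "compact_space T"
    "topspace T \<noteq> {}" "finite Sing" "Sing \<subseteq> topspace T"
    using ts by simp_all
  show "ts_form X (U, \<phi>) (\<phi> p) \<noteq> 0" if "(U, \<phi>) \<in> rs_atlas X" "p \<in> U" "p \<notin> Sing" for U \<phi> p
    using ts that by fast
  have *: "\<forall>(U, \<phi>) \<in> rs_atlas X. ts_form X (U, \<phi>) holomorphic_on \<phi> ` U"
    "\<forall>(U, \<phi>) \<in> rs_atlas X. openin T U \<and> open (\<phi> ` U) \<and>
        homeomorphic_map (subtopology T U) (top_of_set (\<phi> ` U)) \<phi>"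
    "\<forall>(U, \<phi>) \<in> rs_atlas X. \<forall>(V, \<psi>) \<in> rs_atlas X.
        (\<psi> \<circ> inv_into U \<phi>) holomorphic_on \<phi> ` (U \<inter> V)"
    "\<forall>(U, \<phi>) \<in> rs_atlas X. \<forall>(V, \<psi>) \<in> rs_atlas X. \<forall>p \<in> U \<inter> V. ts_form X (U, \<phi>) (\<phi> p)
       = ts_form X (V, \<psi>) (\<psi> p) * deriv (\<psi> \<circ> inv_into U \<phi>) (\<phi> p)"
    using ts by simp_all
  fix U \<phi> assume U: "(U, \<phi>) \<in> rs_atlas X"
  show "ts_form X (U, \<phi>) holomorphic_on \<phi> ` U" using *(1) U by fast
  show "openin T U" "open (\<phi> ` U)" "homeomorphic_map (subtopology T U) (top_of_set (\<phi> ` U)) \<phi>"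
    using *(2) U by fast+
  fix V \<psi> assume V: "(V, \<psi>) \<in> rs_atlas X"
  show "(\<psi> \<circ> inv_into U \<phi>) holomorphic_on \<phi> ` (U \<inter> V)" using *(3) U V by fast
  show "ts_form X (U, \<phi>) (\<phi> p) = ts_form X (V, \<psi>) (\<psi> p) * deriv (\<psi> \<circ> inv_into U \<phi>) (\<phi> p)"
    if "p \<in> U" "p \<in> V" for p
    using *(4) U V that by fast
qed

lemma atlas_point:
  assumes "y \<in> topspace T"
  obtains U \<phi> where "(U, \<phi>) \<in> rs_atlas X" "y \<in> U"
  using assms unfolding atlas_cover[symmetric] by blast

lemma chart_at:
  assumes "y \<in> topspace T"
  shows "chart_at X y \<in> rs_atlas X" "y \<in> fst (chart_at X y)"
proof -
  have "\<exists>c. c \<in> rs_atlas X \<and> y \<in> fst c" using atlas_point[OF assms] by (metis fst_conv)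
  then have "chart_at X y \<in> rs_atlas X \<and> y \<in> fst (chart_at X y)"
    unfolding chart_at_def by (rule someI_ex)
  then show "chart_at X y \<in> rs_atlas X" "y \<in> fst (chart_at X y)" by auto
qed

lemma atlas_inj:
  assumes "(U, \<phi>) \<in> rs_atlas X" shows "inj_on \<phi> U"
  using homeomorphic_imp_injective_map[OF atlas_homeo[OF assms]] openin_subset[OF atlas_openin[OF assms]]
  by (simp add: Int_absorb1)

lemma atlas_open_image:
  assumes "(U, \<phi>) \<in> rs_atlas X" "openin T W" "W \<subseteq> U"
  shows "open (\<phi> ` W)"
proof -
  have "openin (subtopology T U) W" using assms by (simp add: openin_open_subtopology atlas_openin)
  then have "openin (top_of_set (\<phi> ` U)) (\<phi> ` W)"
    using homeomorphic_imp_open_map[OF atlas_homeo[OF assms(1)]] unfolding open_map_def by blast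
  then show ?thesis using atlas_open_range[OF assms(1)] openin_open_eq by blast
qed

lemma atlas_vimage:
  assumes "(U, \<phi>) \<in> rs_atlas X" "open B"
  shows "openin T (U \<inter> \<phi> -` B)"
proof -
  have "continuous_map (subtopology T U) (top_of_set (\<phi> ` U)) \<phi>"
    using homeomorphic_imp_continuous_map[OF atlas_homeo[OF assms(1)]] .
  then have "continuous_map (subtopology T U) euclidean \<phi>"
    by (simp add: continuous_map_in_subtopology)
  then have "openin (subtopology T U) {x \<in> topspace (subtopology T U). \<phi> x \<in> B}"
    using assms(2) unfolding continuous_map_def by auto
  moreover have "{x \<in> topspace (subtopology T U). \<phi> x \<in> B} = U \<inter> \<phi> -` B"
    using openin_subset[OF atlas_openin[OF assms(1)]] by (auto simp: topspace_subtopology_subset)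
  ultimately show ?thesis
    using atlas_openin[OF assms(1)] by (simp add: openin_open_subtopology)
qed

text \<open>Unlike for a translation chart, \<open>U\<close> may contain singularities and
  \<open>P\<close> need not be injective. This admits the function \<open>\<zeta> ^ m\<close> around
  a zero of order \<open>m - 1\<close>.\<close>

definition primitive_on :: "'a set \<Rightarrow> ('a \<Rightarrow> complex) \<Rightarrow> bool" where
  "primitive_on U P \<longleftrightarrow> openin T U \<and> (\<forall>(V, \<phi>) \<in> rs_atlas X. \<forall>p \<in> U \<inter> V.
        ((P \<circ> inv_into V \<phi>) has_field_derivative ts_form X (V, \<phi>) (\<phi> p)) (at (\<phi> p)))"

lemma translation_chart_iff:
  "translation_chart X U z \<longleftrightarrow> primitive_on U z \<and> U \<inter> Sing = {} \<and> inj_on z U"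
  unfolding translation_chart_def primitive_on_def by (simp only: conj_ac)

lemma primitive_onD:
  assumes "primitive_on U P" "(V, \<phi>) \<in> rs_atlas X" "p \<in> U" "p \<in> V"
  shows "((P \<circ> inv_into V \<phi>) has_field_derivative ts_form X (V, \<phi>) (\<phi> p)) (at (\<phi> p))"
proof -
  have "\<forall>(V, \<phi>) \<in> rs_atlas X. \<forall>p \<in> U \<inter> V.
        ((P \<circ> inv_into V \<phi>) has_field_derivative ts_form X (V, \<phi>) (\<phi> p)) (at (\<phi> p))"
    using assms(1) unfolding primitive_on_def by simp
  from bspec[OF this assms(2)] show ?thesis using assms(3,4) by simp
qed

lemma primitive_on_openin: "primitive_on U P \<Longrightarrow> openin T U"
  unfolding primitive_on_def by blast

lemma atlas_eventually:
  assumes "(V, \<phi>) \<in> rs_atlas X" "openin T U" "p \<in> U" "p \<in> V"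
  shows "eventually (\<lambda>x. x \<in> \<phi> ` (U \<inter> V)) (nhds (\<phi> p))"
proof (rule eventually_nhds_in_open)
  have "openin T (U \<inter> V)" using assms(2) atlas_openin[OF assms(1)] by blast
  then show "open (\<phi> ` (U \<inter> V))" by (rule atlas_open_image[OF assms(1)]) simp
qed (use assms in simp)

lemma primitive_on_cong:
  assumes "primitive_on U P" "\<And>q. q \<in> U \<Longrightarrow> P' q = P q"
  shows "primitive_on U P'"
  unfolding primitive_on_def
proof (intro conjI primitive_on_openin[OF assms(1)] ballI, clarify)
  fix V \<phi> p assume V: "(V, \<phi>) \<in> rs_atlas X" and p: "p \<in> U" "p \<in> V"
  have "eventually (\<lambda>x. (P' \<circ> inv_into V \<phi>) x = (P \<circ> inv_into V \<phi>) x) (nhds (\<phi> p))"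
    using atlas_eventually[OF V primitive_on_openin[OF assms(1)] p]
    by eventually_elim (use assms(2) atlas_inj[OF V] in auto)
  then show "((P' \<circ> inv_into V \<phi>) has_field_derivative ts_form X (V, \<phi>) (\<phi> p)) (at (\<phi> p))"
    using primitive_onD[OF assms(1) V p] by (subst DERIV_cong_ev[OF refl _ refl])
qed

text \<open>One chart suffices: the chain rule and the transformation law of the form give the
  derivative in all the others.\<close>

lemma primitive_on_chart:
  assumes U: "(U, \<phi>) \<in> rs_atlas X" and V: "openin T V" "V \<subseteq> U"
    and f: "\<And>x. x \<in> \<phi> ` V \<Longrightarrow> (f has_field_derivative ts_form X (U, \<phi>) x) (at x)"
  shows "primitive_on V (f \<circ> \<phi>)"
  unfolding primitive_on_def
proof (intro conjI V ballI, clarify)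
  fix W \<psi> p assume W: "(W, \<psi>) \<in> rs_atlas X" and p: "p \<in> V" "p \<in> W"
  have op: "open (\<psi> ` (W \<inter> U))"
    using atlas_open_image[OF W, of "W \<inter> U"] atlas_openin[OF U] atlas_openin[OF W] by auto
  have in_op: "\<psi> p \<in> \<psi> ` (W \<inter> U)" using p V by auto
  have d: "((\<phi> \<circ> inv_into W \<psi>) has_field_derivative deriv (\<phi> \<circ> inv_into W \<psi>) (\<psi> p)) (at (\<psi> p))"
    using atlas_transition[OF W U] op in_op holomorphic_derivI by blast
  have inv: "inv_into W \<psi> (\<psi> p) = p" using atlas_inj[OF W] p by simp
  have "(f has_field_derivative ts_form X (U, \<phi>) (\<phi> p)) (at ((\<phi> \<circ> inv_into W \<psi>) (\<psi> p)))"
    using f[of "\<phi> p"] p by (simp add: inv)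
  from DERIV_chain[OF this d]
  show "((f \<circ> \<phi> \<circ> inv_into W \<psi>) has_field_derivative ts_form X (W, \<psi>) (\<psi> p)) (at (\<psi> p))"
    using form_change[OF W U, of p] p V by (auto simp: o_assoc)
qed

lemma primitive_on_continuous:
  assumes P: "primitive_on U P"
  shows "continuous_map (subtopology T U) euclidean P"
proof -
  have oU: "openin T U" using P primitive_on_openin by blast
  then have top: "topspace (subtopology T U) = U" by (simp add: openin_subset Int_absorb1)
  have "openin (subtopology T U) {x \<in> U. P x \<in> B}" if "open B" for B
  proof (subst openin_subopen, safe)
    fix q assume q: "q \<in> U" "P q \<in> B"
    then obtain V \<phi> where V: "(V, \<phi>) \<in> rs_atlas X" "q \<in> V"
      using atlas_point oU openin_subset by blast
    have inv: "inv_into V \<phi> (\<phi> q') = q'" if "q' \<in> V" for q' using atlas_inj[OF V(1)] that by simp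
    have "isCont (P \<circ> inv_into V \<phi>) (\<phi> q)"
      using primitive_onD[OF P V(1) q(1) V(2)] DERIV_isCont by blast
    then have "((P \<circ> inv_into V \<phi>) \<longlongrightarrow> P q) (nhds (\<phi> q))"
      using inv[OF V(2)] by (simp add: isCont_def tendsto_nhds_iff)
    then have "eventually (\<lambda>x. (P \<circ> inv_into V \<phi>) x \<in> B) (nhds (\<phi> q))"
      by (rule topological_tendstoD) (use q \<open>open B\<close> in auto)
    then obtain D where D: "open D" "\<phi> q \<in> D" "\<And>x. x \<in> D \<Longrightarrow> P (inv_into V \<phi> x) \<in> B"
      unfolding eventually_nhds by auto
    let ?O = "U \<inter> (V \<inter> \<phi> -` D)"
    have "openin (subtopology T U) ?O"
      using openin_Int[OF oU atlas_vimage[OF V(1) D(1)]] oU by (simp add: openin_open_subtopology)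
    moreover have "q \<in> ?O" using q V D by auto
    moreover have "?O \<subseteq> {x \<in> U. P x \<in> B}" using D(3) inv by force
    ultimately show "\<exists>W. openin (subtopology T U) W \<and> q \<in> W \<and> W \<subseteq> {x \<in> U. P x \<in> B}" by blast
  qed
  then show ?thesis unfolding continuous_map_def top by auto
qed

text \<open>In an atlas chart the difference has derivative 0 on a disc. This lets any primitive
  take the place of the translation chart that a developing map comes with.\<close>

lemma primitive_on_diff:
  assumes P: "primitive_on U P" and P': "primitive_on U' P'" and q: "q \<in> U" "q \<in> U'"
  shows "\<exists>V. openin T V \<and> q \<in> V \<and> V \<subseteq> U \<inter> U' \<and> (\<forall>q'\<in>V. P q' - P' q' = P q - P' q)"
proof -
  obtain V \<phi> where V: "(V, \<phi>) \<in> rs_atlas X" "q \<in> V"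
    using atlas_point q(1) P primitive_on_openin openin_subset by blast
  have inv: "inv_into V \<phi> (\<phi> q') = q'" if "q' \<in> V" for q' using atlas_inj[OF V(1)] that by simp
  have o: "openin T (U \<inter> U' \<inter> V)"
    using primitive_on_openin[OF P] primitive_on_openin[OF P'] atlas_openin[OF V(1)] by blast
  have "open (\<phi> ` (U \<inter> U' \<inter> V))" using atlas_open_image[OF V(1) o] by blast
  then obtain r where r: "r > 0" "ball (\<phi> q) r \<subseteq> \<phi> ` (U \<inter> U' \<inter> V)"
    using q V open_contains_ball by (metis IntI imageI)
  let ?f = "\<lambda>x. P (inv_into V \<phi> x) - P' (inv_into V \<phi> x)"
  have "(?f has_field_derivative 0) (at x within ball (\<phi> q) r)" if "x \<in> ball (\<phi> q) r" for x
  proof -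
    have "x \<in> \<phi> ` (U \<inter> U' \<inter> V)" using r(2) that by (rule subsetD)
    then obtain q' where q': "q' \<in> U" "q' \<in> U'" "q' \<in> V" "x = \<phi> q'" by blast
    have "(?f has_field_derivative (ts_form X (V, \<phi>) (\<phi> q') - ts_form X (V, \<phi>) (\<phi> q'))) (at x)"
      using DERIV_diff[OF primitive_onD[OF P V(1) q'(1,3)] primitive_onD[OF P' V(1) q'(2,3)]]
      by (simp add: q'(4) o_def)
    then show ?thesis using has_field_derivative_at_within by fastforce
  qed
  then have "\<exists>c. \<forall>x\<in>ball (\<phi> q) r. ?f x = c"
    by (intro has_field_derivative_zero_constant) auto
  then obtain c where c: "\<And>x. x \<in> ball (\<phi> q) r \<Longrightarrow> ?f x = c" by blast
  let ?V = "V \<inter> \<phi> -` ball (\<phi> q) r"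
  show ?thesis
  proof (intro exI[of _ ?V] conjI ballI)
    show "openin T ?V" using atlas_vimage[OF V(1)] by blast
    show "q \<in> ?V" using V r by auto
    show "?V \<subseteq> U \<inter> U'" 
    proof
      fix q' assume q': "q' \<in> ?V"
      then obtain q'' where "q'' \<in> U \<inter> U' \<inter> V" "\<phi> q' = \<phi> q''" using r by blast
      then show "q' \<in> U \<inter> U'" using q' atlas_inj[OF V(1)] by (metis IntD1 IntD2 inj_onD)
    qed
    show "P q' - P' q' = P q - P' q" if "q' \<in> ?V" for q'
      using c[of "\<phi> q'"] c[of "\<phi> q"] that r V inv by auto
  qed
qed

text \<open>Read in an atlas chart, \<open>z\<close> is holomorphic and injective, so the open
  mapping theorem applies.\<close>

lemma translation_chart_open_image:
  assumes z: "translation_chart X U z" and W: "openin T W" "W \<subseteq> U"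
  shows "open (z ` W)"
proof (subst open_subopen, safe)
  fix q assume q: "q \<in> W"
  obtain V \<phi> where V: "(V, \<phi>) \<in> rs_atlas X" "q \<in> V"
    using atlas_point q W(1) openin_subset by blast
  have inv: "inv_into V \<phi> (\<phi> q') = q'" if "q' \<in> V" for q' using atlas_inj[OF V(1)] that by simp
  let ?O = "\<phi> ` (W \<inter> V)"
  have o: "open ?O" using atlas_open_image[OF V(1), of "W \<inter> V"] W(1) atlas_openin[OF V(1)] by auto
  have hol: "(z \<circ> inv_into V \<phi>) holomorphic_on ?O"
    unfolding holomorphic_on_def
  proof
    fix x assume "x \<in> ?O"
    then obtain q' where q': "q' \<in> W" "q' \<in> V" "x = \<phi> q'" by blast
    then show "(z \<circ> inv_into V \<phi>) field_differentiable at x within ?O"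
      using z W(2) primitive_onD[of U z V \<phi> q'] V(1) unfolding translation_chart_iff
      by (metis field_differentiable_at_within field_differentiable_def subsetD)
  qed
  have "inj_on (z \<circ> inv_into V \<phi>) ?O"
    using z W(2) inv unfolding translation_chart_iff inj_on_def by auto blast
  then have "open ((z \<circ> inv_into V \<phi>) ` ?O)" using open_mapping_thm3[OF hol o] by blast
  moreover have "(z \<circ> inv_into V \<phi>) ` ?O = z ` (W \<inter> V)" using inv by force
  ultimately show "\<exists>O'. open O' \<and> z q \<in> O' \<and> O' \<subseteq> z ` W"
    using q V by (intro exI[of _ "z ` (W \<inter> V)"]) auto
qed

lemma atlas_inv_continuous:
  assumes U: "(U, \<phi>) \<in> rs_atlas X"
  shows "continuous_map (top_of_set (\<phi> ` U)) T (inv_into U \<phi>)"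
proof -
  have inj: "inj_on \<phi> U" and oU: "openin T U" using atlas_inj[OF U] atlas_openin[OF U] .
  have "openin (top_of_set (\<phi> ` U)) {x \<in> \<phi> ` U. inv_into U \<phi> x \<in> W}" if W: "openin T W" for W
  proof -
    have "{x \<in> \<phi> ` U. inv_into U \<phi> x \<in> W} = \<phi> ` (U \<inter> W)"
      using inj by (auto simp: inv_into_f_f)
    moreover have "open (\<phi> ` (U \<inter> W))" using atlas_open_image[OF U, of "U \<inter> W"] oU W by auto
    ultimately show ?thesis using atlas_open_range[OF U] by (simp add: openin_open_eq image_mono)
  qed
  then show ?thesis using inj openin_subset[OF oU] unfolding continuous_map_def by (auto simp: inv_into_f_f)
qed

text \<open>
  A coordinate \<open>\<zeta>\<close> centred at \<open>y\<close>, with inverse \<open>e\<close>, in which the form is \<open>d(\<zeta> ^ m)\<close>.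
\<close>

definition cone :: "'a \<Rightarrow> nat \<Rightarrow> real \<Rightarrow> (complex \<Rightarrow> 'a) \<Rightarrow> bool" where
  "cone y m R e \<longleftrightarrow> m > 0 \<and> R > 0 \<and> e 0 = y \<and> inj_on e (ball 0 R) \<and>
     (\<forall>D. open D \<longrightarrow> D \<subseteq> ball 0 R \<longrightarrow> openin T (e ` D)) \<and>
     continuous_map (top_of_set (ball 0 R)) T e \<and>
     (\<forall>x\<in>ball 0 R. x \<noteq> 0 \<longrightarrow> e x \<notin> Sing) \<and>
     primitive_on (e ` ball 0 R) (\<lambda>q. inv_into (ball 0 R) e q ^ m) \<and>
     (\<forall>(V, \<psi>) \<in> rs_atlas X.
        (inv_into (ball 0 R) e \<circ> inv_into V \<psi>) holomorphic_on \<psi> ` (e ` ball 0 R \<inter> V)) \<and>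
     (y \<notin> Sing \<longrightarrow> m = 1) \<and> int m = zero_order X y + 1"

text \<open>A primitive \<open>F\<close> of the form, minus its value at the centre, vanishes there
  to some finite order \<open>n\<close>, hence is the \<open>n\<close>-th power of a function
  \<open>h\<close> with a simple zero. Locally \<open>h\<close> is invertible and serves as the
  coordinate; its inverse gives \<open>e\<close>.\<close>

lemma cone_exists:
  assumes y: "y \<in> topspace T"
  obtains m R e where "cone y m R e"
proof -
  \<comment> \<open>\<open>zero_order\<close> refers to \<open>chart_at\<close>, so the coordinate
    is built from this very chart; the order of the zero can then be read off directly.\<close>
  obtain U \<phi> where c: "chart_at X y = (U, \<phi>)" by force
  have U: "(U, \<phi>) \<in> rs_atlas X" and yU: "y \<in> U" using chart_at[OF y] c by auto
  define f where "f = ts_form X (U, \<phi>)"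
  define \<xi> where "\<xi> = \<phi> y"
  have inj: "inj_on \<phi> U" using atlas_inj[OF U] .
  \<comment> \<open>The disc has to avoid all singularities other than \<open>y\<close>, which may
    or may not be one itself.\<close>
  have "open (\<phi> ` U - (\<phi> ` (Sing \<inter> U) - {\<xi>}))"
    using atlas_open_range[OF U] finite_Sing by (intro open_Diff finite_imp_closed) auto
  moreover have "\<xi> \<in> \<phi> ` U - (\<phi> ` (Sing \<inter> U) - {\<xi>})" using yU \<xi>_def by auto
  ultimately obtain r0 where r0: "r0 > 0" "ball \<xi> r0 \<subseteq> \<phi> ` U - (\<phi> ` (Sing \<inter> U) - {\<xi>})"
    unfolding open_contains_ball by blast
  have regular: "p \<notin> Sing" if "p \<in> U" "\<phi> p \<in> ball \<xi> r0" "\<phi> p \<noteq> \<xi>" for p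
    using r0(2) that by blast
  have f0: "f x \<noteq> 0" if "x \<in> ball \<xi> r0" "x \<noteq> \<xi>" for x
  proof -
    have "x \<in> \<phi> ` U" using r0(2) that by blast
    then obtain p where "p \<in> U" "x = \<phi> p" by blast
    then show ?thesis using form_nonzero[OF U] regular that unfolding f_def by blast
  qed
  have fhol: "f holomorphic_on ball \<xi> r0"
    using form_holomorphic[OF U] r0 unfolding f_def by (meson Diff_subset holomorphic_on_subset order_trans)
  obtain F where "\<And>x. x \<in> ball \<xi> r0 \<Longrightarrow> (F has_field_derivative f x) (at x within ball \<xi> r0)"
    by (rule holomorphic_convex_primitive'[OF convex_ball open_ball fhol]) (rule that; simp)
  then have F: "(F has_field_derivative f x) (at x)" if "x \<in> ball \<xi> r0" for x
    using that at_within_open[OF that open_ball] by metis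
  have Fhol: "F holomorphic_on ball \<xi> r0"
    using F by (meson field_differentiable_at_within field_differentiable_def holomorphic_on_def)
  have \<xi>0: "\<xi> \<in> ball \<xi> r0" using r0 by simp
  \<comment> \<open>If all derivatives vanished, \<open>F\<close> would be constant on the disc and
    the form zero at points other than the centre, which are regular.\<close>
  have ex: "\<exists>n. 0 < n \<and> (deriv ^^ n) F \<xi> \<noteq> 0"
  proof (rule ccontr)
    assume "\<not> ?thesis"
    then have F_const: "F x = F \<xi>" if "x \<in> ball \<xi> r0" for x
      using holomorphic_fun_eq_const_on_connected[OF Fhol open_ball connected_ball _ \<xi>0 that] by blast
    define x where "x = \<xi> + of_real (r0 / 2)"
    have x: "x \<in> ball \<xi> r0" "x \<noteq> \<xi>" using r0(1) unfolding x_def by (auto simp: dist_norm)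
    have "(F has_field_derivative 0) (at x)"
      using F_const x(1) by (intro has_field_derivative_transform_within_open[OF DERIV_const open_ball x(1), of "F \<xi>"]) auto
    then have "f x = 0" using F[OF x(1)] DERIV_unique by blast
    then show False using f0 x by blast
  qed
  define n where "n = (LEAST n. 0 < n \<and> (deriv ^^ n) F \<xi> \<noteq> 0)"
  have n: "0 < n" "(deriv ^^ n) F \<xi> \<noteq> 0" using LeastI_ex[OF ex] unfolding n_def by auto
  have n_least: "(deriv ^^ i) F \<xi> = 0" if "0 < i" "i < n" for i
    using not_less_Least[of i "\<lambda>n. 0 < n \<and> (deriv ^^ n) F \<xi> \<noteq> 0"] that unfolding n_def by simp
  have "\<exists>g r1. 0 < r1 \<and> g holomorphic_on ball \<xi> r1 \<and>
      (\<forall>w\<in>ball \<xi> r1. F w - F \<xi> = ((w - \<xi>) * g w) ^ n) \<and> (\<forall>w\<in>ball \<xi> r1. g w \<noteq> 0)"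
  proof (rule holomorphic_factor_order_of_zero_strong[OF Fhol open_ball \<xi>0 n])
    show "(deriv ^^ i) F \<xi> = 0" if "0 < i" "i < n" for i using n_least that .
  qed blast
  then obtain g r1 where g: "0 < r1" "g holomorphic_on ball \<xi> r1"
      "\<And>w. w \<in> ball \<xi> r1 \<Longrightarrow> F w - F \<xi> = ((w - \<xi>) * g w) ^ n" "\<And>w. w \<in> ball \<xi> r1 \<Longrightarrow> g w \<noteq> 0"
    by blast
  define r2 where "r2 = min r0 r1"
  have r2: "r2 > 0" "ball \<xi> r2 \<subseteq> ball \<xi> r0" "ball \<xi> r2 \<subseteq> ball \<xi> r1" using r0 g unfolding r2_def by auto
  have \<xi>2: "\<xi> \<in> ball \<xi> r2" using r2 by simp
  define h where "h = (\<lambda>w. (w - \<xi>) * g w)"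
  have ghol: "g holomorphic_on ball \<xi> r2" using g(2) r2 holomorphic_on_subset by blast
  have hhol: "h holomorphic_on ball \<xi> r2" unfolding h_def by (intro holomorphic_intros ghol)
  have "(g has_field_derivative deriv g \<xi>) (at \<xi>)" using ghol \<xi>2 holomorphic_derivI open_ball by blast
  then have "(h has_field_derivative g \<xi>) (at \<xi>)" unfolding h_def by (auto intro!: derivative_eq_intros)
  then have dh: "deriv h \<xi> = g \<xi>" by (rule DERIV_imp_deriv)
  have g\<xi>: "g \<xi> \<noteq> 0" using g \<xi>2 r2 by blast
  obtain r3 where r3: "r3 > 0" "ball \<xi> r3 \<subseteq> ball \<xi> r2" "inj_on h (ball \<xi> r3)"
    by (rule has_complex_derivative_locally_injective[OF hhol \<xi>2 open_ball]) (use dh g\<xi> in auto)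
  have h3: "h holomorphic_on ball \<xi> r3" using hhol r3 holomorphic_on_subset by blast
  have h\<xi>: "h \<xi> = 0" unfolding h_def by simp
  have "open (h ` ball \<xi> r3)" using open_mapping_thm3[OF h3 open_ball r3(3)] .
  moreover have "0 \<in> h ` ball \<xi> r3" using h\<xi> r3(1) by (metis centre_in_ball imageI)
  ultimately obtain R where R: "R > 0" "ball 0 R \<subseteq> h ` ball \<xi> r3" unfolding open_contains_ball by blast
  obtain k where k: "k holomorphic_on h ` ball \<xi> r3"
      "\<And>z. z \<in> ball \<xi> r3 \<Longrightarrow> deriv h z * deriv k (h z) = 1" "\<And>z. z \<in> ball \<xi> r3 \<Longrightarrow> k (h z) = z"
    by (rule holomorphic_has_inverse[OF h3 open_ball r3(3)]) (rule that; simp)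
  have k_in: "k x \<in> ball \<xi> r3" "h (k x) = x" if "x \<in> ball 0 R" for x
  proof -
    have "x \<in> h ` ball \<xi> r3" using R(2) that by (rule subsetD)
    then obtain w where "w \<in> ball \<xi> r3" "x = h w" by (rule imageE)
    then show "k x \<in> ball \<xi> r3" "h (k x) = x" using k(3) by simp_all
  qed
  have sub: "ball \<xi> r3 \<subseteq> \<phi> ` U" using r3(2) r2(2) r0(2) by blast
  define e where "e = (\<lambda>x. inv_into U \<phi> (k x))"
  have e: "e x \<in> U" "\<phi> (e x) = k x" "h (\<phi> (e x)) = x" if "x \<in> ball 0 R" for x
    using k_in[OF that] sub unfolding e_def by (auto simp: f_inv_into_f inv_into_into subset_iff)
  have inv: "inv_into U \<phi> (\<phi> q') = q'" if "q' \<in> U" for q' using inj that by simp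
  have inje: "inj_on e (ball 0 R)" using e(3) by (metis inj_onI)
  have image: "e ` D = U \<inter> \<phi> -` (ball \<xi> r3 \<inter> h -` D)" if "D \<subseteq> ball 0 R" for D
  proof (intro equalityI subsetI)
    fix q assume "q \<in> e ` D"
    then obtain x where "x \<in> D" and q: "q = e x" by (rule imageE) 
    then have x: "x \<in> ball 0 R" using that by blast
    show "q \<in> U \<inter> \<phi> -` (ball \<xi> r3 \<inter> h -` D)"
      using e[OF x] k_in[OF x] \<open>x \<in> D\<close> unfolding q by simp
  next
    fix q assume "q \<in> U \<inter> \<phi> -` (ball \<xi> r3 \<inter> h -` D)"
    then have q: "q \<in> U" "\<phi> q \<in> ball \<xi> r3" "h (\<phi> q) \<in> D" by simp_all
    have "e (h (\<phi> q)) = q" unfolding e_def using k(3)[OF q(2)] inv[OF q(1)] by simp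
    then show "q \<in> e ` D" using q(3) by (metis imageI)
  qed
  have open_pre: "open (ball \<xi> r3 \<inter> h -` D)" if "open D" for D
    using continuous_open_preimage[OF holomorphic_on_imp_continuous_on[OF h3] open_ball that] by simp
  define B where "B = e ` ball 0 R"
  have B: "B = U \<inter> \<phi> -` (ball \<xi> r3 \<inter> h -` ball 0 R)" unfolding B_def using image by blast
  have coord: "inv_into (ball 0 R) e q = h (\<phi> q)" if "q \<in> B" for q
    using that e(3) inje unfolding B_def by (auto simp: inv_into_f_f)
  have oB: "openin T B" unfolding B using atlas_vimage[OF U open_pre] by blast
  have Fh: "((\<lambda>x. h x ^ n) has_field_derivative f x) (at x)" if x: "x \<in> ball \<xi> r2" for x
  proof -
    have "((\<lambda>x. F x - F \<xi>) has_field_derivative f x) (at x)"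
      using F[of x] x r2 by (auto intro!: derivative_eq_intros)
    then show ?thesis
      by (rule has_field_derivative_transform_within_open[OF _ open_ball x]) (use g(3) r2 in \<open>auto simp: h_def\<close>)
  qed
  have "cone y n R e"
    unfolding cone_def
  proof (intro conjI allI impI ballI)
    show "n > 0" "R > 0" by fact+
    have "k 0 = \<xi>" using k(3)[of \<xi>] h\<xi> r3 by simp
    then show "e 0 = y" unfolding e_def \<xi>_def using inv[OF yU] by simp
    show "inj_on e (ball 0 R)" by fact
    show "openin T (e ` D)" if "open D" "D \<subseteq> ball 0 R" for D
      unfolding image[OF that(2)] using atlas_vimage[OF U open_pre[OF that(1)]] .
    have "continuous_map (top_of_set (ball 0 R)) (top_of_set (\<phi> ` U)) k"
      using k_in sub holomorphic_on_imp_continuous_on[OF holomorphic_on_subset[OF k(1) R(2)]] by auto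
    from continuous_map_compose[OF this atlas_inv_continuous[OF U]]
    show "continuous_map (top_of_set (ball 0 R)) T e" unfolding e_def by (simp add: o_def)
    show "e x \<notin> Sing" if x: "x \<in> ball 0 R" "x \<noteq> 0" for x
    proof (rule regular)
      show "e x \<in> U" using e[OF x(1)] by simp
      have "k x \<in> ball \<xi> r0" using k_in(1)[OF x(1)] r3(2) r2(2) by blast
      then show "\<phi> (e x) \<in> ball \<xi> r0" using e(2)[OF x(1)] by simp
      show "\<phi> (e x) \<noteq> \<xi>" using e(3)[OF x(1)] h\<xi> x(2) by auto
    qed
    have "primitive_on B ((\<lambda>x. h x ^ n) \<circ> \<phi>)"
    proof (rule primitive_on_chart[OF U oB])
      show "B \<subseteq> U" unfolding B by blast
      fix x assume "x \<in> \<phi> ` B"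
      then have "x \<in> ball \<xi> r2" using B r3(2) by blast
      then show "((\<lambda>x. h x ^ n) has_field_derivative ts_form X (U, \<phi>) x) (at x)"
        using Fh unfolding f_def by blast
    qed
    then show "primitive_on (e ` ball 0 R) (\<lambda>q. inv_into (ball 0 R) e q ^ n)"
      unfolding B_def[symmetric] by (rule primitive_on_cong) (simp add: coord)
    show "case c of (V, \<psi>) \<Rightarrow>
        (inv_into (ball 0 R) e \<circ> inv_into V \<psi>) holomorphic_on \<psi> ` (e ` ball 0 R \<inter> V)"
      if "c \<in> rs_atlas X" for c
    proof (cases c)
      case (Pair V \<psi>)
      then have V: "(V, \<psi>) \<in> rs_atlas X" using that by simp
      have 1: "(\<phi> \<circ> inv_into V \<psi>) holomorphic_on \<psi> ` (B \<inter> V)"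
        by (rule holomorphic_on_subset[OF atlas_transition[OF V U]]) (use B in blast)
      have "(\<phi> \<circ> inv_into V \<psi>) ` \<psi> ` (B \<inter> V) \<subseteq> ball \<xi> r3"
        using atlas_inj[OF V] B by auto
      from holomorphic_on_compose_gen[OF 1 h3 this]
      have "(\<lambda>x. h (\<phi> (inv_into V \<psi> x))) holomorphic_on \<psi> ` (B \<inter> V)" by (simp add: o_def)
      then have "(inv_into (ball 0 R) e \<circ> inv_into V \<psi>) holomorphic_on \<psi> ` (B \<inter> V)"
        by (rule holomorphic_transform) (use atlas_inj[OF V] coord in auto)
      then show ?thesis unfolding Pair B_def by simp
    qed
    show "n = 1" if "y \<notin> Sing"
    proof (rule ccontr)
      assume "n \<noteq> 1"
      then have "(deriv ^^ 1) F \<xi> = 0" using n by (intro n_least) auto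
      moreover have "deriv F \<xi> = f \<xi>" using F[OF \<xi>0] DERIV_imp_deriv by blast
      moreover have "f \<xi> \<noteq> 0" using form_nonzero[OF U yU that] unfolding f_def \<xi>_def .
      ultimately show False by simp
    qed
    \<comment> \<open>Differentiating \<open>h ^ n\<close> with
      \<open>h w = (w - \<xi>) * g w\<close> exhibits the factor
      \<open>(w - \<xi>) ^ (n - 1)\<close>; the cofactor at the centre is
      \<open>n * g \<xi> ^ n\<close>, which is not 0.\<close>
    have "zorder f \<xi> = int (n - 1)"
    proof (rule zorder_eqI)
      show "open (ball \<xi> r2)" "\<xi> \<in> ball \<xi> r2" using \<xi>2 by auto
      show "(\<lambda>w. of_nat n * g w ^ (n - 1) * deriv h w) holomorphic_on ball \<xi> r2"
        by (intro holomorphic_intros ghol holomorphic_deriv hhol open_ball)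
      show "of_nat n * g \<xi> ^ (n - 1) * deriv h \<xi> \<noteq> 0" using dh g\<xi> n(1) by simp
      fix w assume w: "w \<in> ball \<xi> r2" "w \<noteq> \<xi>"
      have "(h has_field_derivative deriv h w) (at w)" using hhol w holomorphic_derivI open_ball by blast
      then have "((\<lambda>x. h x ^ n) has_field_derivative of_nat n * (deriv h w * h w ^ (n - 1))) (at w)"
        by (auto intro!: derivative_eq_intros)
      then have "f w = of_nat n * (deriv h w * h w ^ (n - 1))" using Fh[OF w(1)] DERIV_unique by blast
      then show "f w = of_nat n * g w ^ (n - 1) * deriv h w * (w - \<xi>) powi int (n - 1)"
        unfolding h_def by (simp add: power_mult_distrib)
    qed
    then show "int n = zero_order X y + 1"
      unfolding zero_order_def Let_def c f_def \<xi>_def using n(1) by simp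
  qed
  then show ?thesis by (rule that)
qed

section \<open>Developing maps and geodesics\<close>

lemma primitive_vimage:
  assumes "primitive_on U P" "open S"
  shows "openin T {q \<in> U. P q \<in> S}"
proof -
  have o: "openin T U" using primitive_on_openin[OF assms(1)] .
  then have "topspace (subtopology T U) = U" by (simp add: openin_subset Int_absorb1)
  then have "openin (subtopology T U) {q \<in> U. P q \<in> S}"
    using primitive_on_continuous[OF assms(1)] assms(2) unfolding continuous_map_def by auto
  then show ?thesis using o by (simp add: openin_open_subtopology)
qed

lemma primitive_tendsto:
  assumes "primitive_on U P" "y \<in> U" "limitin T \<sigma> y F"
  shows "((\<lambda>t. P (\<sigma> t)) \<longlongrightarrow> P y) F"
proof (rule topological_tendstoI)
  fix S assume S: "open S" "P y \<in> S"
  have "openin T {q \<in> U. P q \<in> S}" by (rule primitive_vimage[OF assms(1) S(1)])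
  then have "eventually (\<lambda>t. \<sigma> t \<in> {q \<in> U. P q \<in> S}) F"
    using assms(2,3) S(2) unfolding limitin_def by blast
  then show "eventually (\<lambda>t. P (\<sigma> t) \<in> S) F" by eventually_elim simp
qed

lemma coneD:
  assumes "cone y m R e"
  shows "m > 0" "R > 0" "e 0 = y" "inj_on e (ball 0 R)"
    "\<And>D. open D \<Longrightarrow> D \<subseteq> ball 0 R \<Longrightarrow> openin T (e ` D)"
    "continuous_map (top_of_set (ball 0 R)) T e"
    "\<And>x. x \<in> ball 0 R \<Longrightarrow> x \<noteq> 0 \<Longrightarrow> e x \<notin> Sing"
    "primitive_on (e ` ball 0 R) (\<lambda>q. inv_into (ball 0 R) e q ^ m)"
    "y \<notin> Sing \<Longrightarrow> m = 1" "int m = zero_order X y + 1"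
    "\<And>x. x \<in> ball 0 R \<Longrightarrow> inv_into (ball 0 R) e (e x) = x"
  using assms unfolding cone_def by (simp_all add: inv_into_f_f)

lemma coneD_holomorphic:
  assumes "cone y m R e" "(V, \<psi>) \<in> rs_atlas X"
  shows "(inv_into (ball 0 R) e \<circ> inv_into V \<psi>) holomorphic_on \<psi> ` (e ` ball 0 R \<inter> V)"
proof -
  have "\<forall>(V, \<psi>) \<in> rs_atlas X.
        (inv_into (ball 0 R) e \<circ> inv_into V \<psi>) holomorphic_on \<psi> ` (e ` ball 0 R \<inter> V)"
    using assms(1) unfolding cone_def by simp
  from bspec[OF this assms(2)] show ?thesis by simp
qed

text \<open>At a regular point \<open>m = 1\<close>, so the cone coordinate is itself an injective
  primitive.\<close>

lemma regular_point_chart: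
  assumes "y \<in> topspace T" "y \<notin> Sing"
  obtains U z where "translation_chart X U z" "y \<in> U"
proof -
  obtain m R e where c: "cone y m R e" using cone_exists[OF assms(1)] .
  note c = coneD[OF this]
  have m: "m = 1" using c(9) assms(2) by simp
  have "e x \<notin> Sing" if "x \<in> ball 0 R" for x using c(7)[OF that] c(3) assms(2) by (cases "x = 0") auto
  then have "translation_chart X (e ` ball 0 R) (\<lambda>q. inv_into (ball 0 R) e q ^ m)"
    unfolding translation_chart_iff using c(8) m by (auto simp: inj_on_def inv_into_injective)
  moreover have "y \<in> e ` ball 0 R" using c(2,3) by (metis centre_in_ball imageI)
  ultimately show ?thesis by (rule that)
qed

text \<open>
  \<open>F\<close> pulls the form back to \<open>dQ\<close>.  With \<open>Q = id\<close> this is the inverse of a translation chart, with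
  \<open>Q t = t * v\<close> a geodesic of velocity \<open>v\<close>, and with \<open>Q \<zeta> = \<zeta> ^ m\<close> a local isometry from the cone of
  angle \<open>2 * pi * m\<close>.  The set \<open>W\<close> need not be open.
\<close>

definition dev :: "('b::metric_space \<Rightarrow> complex) \<Rightarrow> 'b set \<Rightarrow> ('b \<Rightarrow> 'a) \<Rightarrow> bool" where
  "dev Q W F \<longleftrightarrow> continuous_on W Q \<and> (\<forall>x\<in>W. \<exists>U z. translation_chart X U z \<and> F x \<in> U \<and>
     (\<forall>\<^sub>F y in at x within W. F y \<in> U \<and> z (F y) - z (F x) = Q y - Q x))"

lemma dev_continuous_on: "dev Q W F \<Longrightarrow> continuous_on W Q"
  unfolding dev_def by simp

lemma dev_obtain:
  assumes "dev Q W F" "x \<in> W"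
  obtains U z where "translation_chart X U z" "F x \<in> U"
    "\<forall>\<^sub>F y in at x within W. F y \<in> U \<and> z (F y) - z (F x) = Q y - Q x"
proof -
  have "\<exists>U z. translation_chart X U z \<and> F x \<in> U \<and>
     (\<forall>\<^sub>F y in at x within W. F y \<in> U \<and> z (F y) - z (F x) = Q y - Q x)"
    using assms unfolding dev_def by simp
  then show ?thesis using that by (elim exE conjE)
qed

lemma translation_chartD:
  assumes "translation_chart X U z"
  shows "openin T U" "primitive_on U z" "inj_on z U" "U \<inter> Sing = {}" "U \<subseteq> topspace T"
  using assms primitive_on_openin[of U z] openin_subset[of T U] unfolding translation_chart_iff by auto

lemma dev_in:
  assumes "dev Q W F" "x \<in> W"
  shows "F x \<in> topspace T" "F x \<notin> Sing"
proof -
  obtain U z where "translation_chart X U z" "F x \<in> U" using dev_obtain[OF assms] .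
  then show "F x \<in> topspace T" "F x \<notin> Sing" using translation_chartD(4,5)[of U z] by auto
qed

text \<open>Continuity of \<open>F\<close> is not part of \<open>dev\<close>. It follows because
  \<open>z\<close> is open and injective on \<open>U\<close>: a value \<open>z (F y)\<close> close
  to \<open>z (F x)\<close> forces \<open>F y\<close> into \<open>D\<close>.\<close>

lemma dev_eventually_in:
  assumes d: "dev Q W F" and x: "x \<in> W" and D: "openin T D" "F x \<in> D"
  shows "\<forall>\<^sub>F y in at x within W. F y \<in> D"
proof -
  obtain U z where U: "translation_chart X U z" "F x \<in> U"
    "\<forall>\<^sub>F y in at x within W. F y \<in> U \<and> z (F y) - z (F x) = Q y - Q x"
    using dev_obtain[OF d x] .
  note tc = translation_chartD[OF U(1)]
  have "openin T (D \<inter> U)" using D tc by blast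
  then have o: "open (z ` (D \<inter> U))" using translation_chart_open_image[OF U(1)] by simp
  have "(Q \<longlongrightarrow> Q x) (at x within W)" using d x unfolding dev_def continuous_on_def by simp
  then have "((\<lambda>y. z (F x) + Q y - Q x) \<longlongrightarrow> z (F x) + Q x - Q x) (at x within W)"
    by (intro tendsto_intros)
  then have "\<forall>\<^sub>F y in at x within W. z (F x) + Q y - Q x \<in> z ` (D \<inter> U)"
    by (rule topological_tendstoD[OF _ o]) (use D U(2) in simp)
  with U(3) show ?thesis
  proof eventually_elim
    case (elim y)
    then have "z (F y) \<in> z ` (D \<inter> U)" by (metis add_diff_eq diff_add_cancel add.commute)
    then obtain q where q: "q \<in> D" "q \<in> U" "z (F y) = z q" by blast
    then show ?case using inj_onD[OF tc(3) q(3)] elim by simp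
  qed
qed

text \<open>The constant by which two primitives differ cancels in increments, so any primitive
  around \<open>F x\<close> develops \<open>F\<close> just as the given chart does.\<close>

lemma dev_primitive_local:
  assumes d: "dev Q W F" and x: "x \<in> W" and P: "primitive_on V P" "F x \<in> V"
  shows "\<forall>\<^sub>F y in at x within W. F y \<in> V \<and> P (F y) - P (F x) = Q y - Q x"
proof -
  obtain U z where U: "translation_chart X U z" "F x \<in> U"
    "\<forall>\<^sub>F y in at x within W. F y \<in> U \<and> z (F y) - z (F x) = Q y - Q x"
    using dev_obtain[OF d x] .
  obtain D where D: "openin T D" "F x \<in> D" "D \<subseteq> V \<inter> U"
      "\<forall>q\<in>D. P q - z q = P (F x) - z (F x)"
    using primitive_on_diff[OF P(1) translation_chartD(2)[OF U(1)] P(2) U(2)] by (elim exE conjE)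
  show ?thesis using U(3) dev_eventually_in[OF d x D(1,2)]
  proof eventually_elim
    case (elim y)
    then have "P (F y) - z (F y) = P (F x) - z (F x)" using D(4) by blast
    then have "P (F y) - P (F x) = z (F y) - z (F x)" by (simp add: algebra_simps)
    then show ?case using elim D(3) by auto
  qed
qed

lemma dev_continuous_map:
  assumes "dev Q W F"
  shows "continuous_map (top_of_set W) T F"
  using dev_in(1)[OF assms] dev_eventually_in[OF assms]
  by (simp add: continuous_map_within_iff limitin_def)

lemma dev_subset:
  assumes "dev Q W F" "W' \<subseteq> W"
  shows "dev Q W' F"
  unfolding dev_def
proof (intro conjI ballI)
  show "continuous_on W' Q" using dev_continuous_on[OF assms(1)] assms(2) continuous_on_subset by blast
  fix x assume x: "x \<in> W'"
  then have xW: "x \<in> W" using assms(2) by blast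
  obtain U z where U: "translation_chart X U z" "F x \<in> U"
    "\<forall>\<^sub>F y in at x within W. F y \<in> U \<and> z (F y) - z (F x) = Q y - Q x"
    using dev_obtain[OF assms(1) xW] .
  have "at x within W' \<le> at x within W" using assms(2) by (rule at_le)
  then show "\<exists>U z. translation_chart X U z \<and> F x \<in> U \<and>
     (\<forall>\<^sub>F y in at x within W'. F y \<in> U \<and> z (F y) - z (F x) = Q y - Q x)"
    using U filter_leD by blast
qed

text \<open>Only increments of \<open>Q\<close> enter \<open>dev\<close>, which accounts for the
  additive constant.\<close>

lemma dev_cong:
  assumes "dev Q W F" "\<And>x. x \<in> W \<Longrightarrow> F' x = F x" "\<And>x. x \<in> W \<Longrightarrow> Q' x = Q x + c"
  shows "dev Q' W F'"
  unfolding dev_def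
proof (intro conjI ballI)
  have "continuous_on W (\<lambda>x. Q x + c)" using dev_continuous_on[OF assms(1)] by (intro continuous_intros)
  then show "continuous_on W Q'" by (rule continuous_on_eq) (simp add: assms(3))
  fix x assume x: "x \<in> W"
  obtain U z where U: "translation_chart X U z" "F x \<in> U"
    "\<forall>\<^sub>F y in at x within W. F y \<in> U \<and> z (F y) - z (F x) = Q y - Q x"
    using dev_obtain[OF assms(1) x] .
  have "\<forall>\<^sub>F y in at x within W. y \<in> W" by (simp add: eventually_at_filter)
  with U(3) have "\<forall>\<^sub>F y in at x within W. F' y \<in> U \<and> z (F' y) - z (F' x) = Q' y - Q' x"
    by eventually_elim (simp add: assms(2,3) x)
  then show "\<exists>U z. translation_chart X U z \<and> F' x \<in> U \<and>
     (\<forall>\<^sub>F y in at x within W. F' y \<in> U \<and> z (F' y) - z (F' x) = Q' y - Q' x)"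
    using U(1,2) assms(2)[OF x] by (intro exI[of _ U] exI[of _ z]) simp
qed

lemma dev_local:
  assumes "\<And>x. x \<in> W \<Longrightarrow> \<exists>D F'. open D \<and> x \<in> D \<and> dev Q (W \<inter> D) F' \<and> (\<forall>y\<in>W \<inter> D. F y = F' y)"
  shows "dev Q W F"
  unfolding dev_def continuous_on_eq_continuous_within
proof (intro conjI ballI)
  fix x assume x: "x \<in> W"
  from assms[OF x] obtain D F' where D: "open D" "x \<in> D" "dev Q (W \<inter> D) F'" "\<forall>y\<in>W \<inter> D. F y = F' y"
    by (elim exE conjE)
  have at: "at x within W = at x within (W \<inter> D)" by (rule at_within_nhd[OF D(2,1)]) auto
  have d: "dev Q (W \<inter> D) F" by (rule dev_cong[OF D(3), where c = 0]) (use D(4) in auto)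
  show "continuous (at x within W) Q"
    using dev_continuous_on[OF d] x D(2) unfolding at continuous_on_eq_continuous_within by simp
  obtain U z where "translation_chart X U z" "F x \<in> U"
    "\<forall>\<^sub>F y in at x within (W \<inter> D). F y \<in> U \<and> z (F y) - z (F x) = Q y - Q x"
    using dev_obtain[OF d] x D(2) by blast
  then show "\<exists>U z. translation_chart X U z \<and> F x \<in> U \<and>
     (\<forall>\<^sub>F y in at x within W. F y \<in> U \<and> z (F y) - z (F x) = Q y - Q x)"
    unfolding at by (intro exI conjI)
qed

lemma dev_compose:
  assumes d: "dev Q W F" and g: "continuous_on W' g" "g ` W' \<subseteq> W"
  shows "dev (\<lambda>x. Q (g x)) W' (\<lambda>x. F (g x))"
  unfolding dev_def
proof (intro conjI ballI)
  show "continuous_on W' (\<lambda>x. Q (g x))"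
    using continuous_on_compose2[OF dev_continuous_on[OF d] g] .
  fix x assume x: "x \<in> W'"
  then have gx: "g x \<in> W" using g by blast
  obtain U z where U: "translation_chart X U z" "F (g x) \<in> U"
    "\<forall>\<^sub>F y in at (g x) within W. F y \<in> U \<and> z (F y) - z (F (g x)) = Q y - Q (g x)"
    using dev_obtain[OF d gx] .
  have "(g \<longlongrightarrow> g x) (at x within W')" using g(1) x unfolding continuous_on_def by simp
  moreover have "\<forall>\<^sub>F y in at x within W'. y \<in> W'" by (simp add: eventually_at_filter)
  then have "\<forall>\<^sub>F y in at x within W'. g y \<in> W" by eventually_elim (use g(2) in blast)
  ultimately have lim: "filterlim g (inf (nhds (g x)) (principal W)) (at x within W')"
    by (simp add: filterlim_inf filterlim_principal)
  \<comment> \<open>\<open>g\<close> may take the value \<open>g x\<close> again at nearby points,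
    so the punctured filter at \<open>g x\<close> is not enough; at \<open>g x\<close> itself both
    increments are 0.\<close>
  have "\<forall>\<^sub>F y in inf (nhds (g x)) (principal W). F y \<in> U \<and> z (F y) - z (F (g x)) = Q y - Q (g x)"
    using U(3) unfolding eventually_at_filter eventually_inf_principal
    by eventually_elim (use U(2) in auto)
  then have "\<forall>\<^sub>F y in at x within W'. F (g y) \<in> U \<and> z (F (g y)) - z (F (g x)) = Q (g y) - Q (g x)"
    using lim unfolding filterlim_iff by blast
  then show "\<exists>U z. translation_chart X U z \<and> F (g x) \<in> U \<and>
     (\<forall>\<^sub>F y in at x within W'. F (g y) \<in> U \<and> z (F (g y)) - z (F (g x)) = Q (g y) - Q (g x))"
    using U by (intro exI conjI)
qed

text \<open>Unique continuation. Coincidence spreads because a chart is injective and both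
  increments equal that of \<open>Q\<close>; distinctness spreads because \<open>T\<close> is
  Hausdorff.\<close>

lemma dev_unique:
  assumes d: "dev Q W F" "dev Q W F'" and W: "connected W" "a \<in> W" "F a = F' a" and x: "x \<in> W"
  shows "F x = F' x"
proof (rule connected_locally_constant_pred[of W a "\<lambda>x. F x = F' x", OF W x])
  fix x assume x: "x \<in> W"
  show "\<forall>\<^sub>F y in at x within W. F y = F' y" if e: "F x = F' x"
  proof -
    obtain U z where U: "translation_chart X U z" "F x \<in> U"
      "\<forall>\<^sub>F y in at x within W. F y \<in> U \<and> z (F y) - z (F x) = Q y - Q x"
      using dev_obtain[OF d(1) x] .
    note tc = translation_chartD[OF U(1)]
    have "\<forall>\<^sub>F y in at x within W. F' y \<in> U \<and> z (F' y) - z (F' x) = Q y - Q x"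
      by (rule dev_primitive_local[OF d(2) x tc(2)]) (use U(2) e in simp)
    with U(3) show ?thesis
    proof eventually_elim
      case (elim y)
      then have "z (F y) = z (F' y)" using e by (metis diff_add_cancel)
      then show ?case using inj_onD[OF tc(3)] elim by simp
    qed
  qed
  show "\<forall>\<^sub>F y in at x within W. F y \<noteq> F' y" if n: "F x \<noteq> F' x"
  proof -
    obtain A B where AB: "openin T A" "openin T B" "F x \<in> A" "F' x \<in> B" "disjnt A B"
      using Hausdorff n dev_in(1)[OF d(1) x] dev_in(1)[OF d(2) x]
      unfolding Hausdorff_space_def by metis
    show ?thesis
      using dev_eventually_in[OF d(1) x AB(1,3)] dev_eventually_in[OF d(2) x AB(2,4)]
      by eventually_elim (use AB(5) in \<open>auto simp: disjnt_iff\<close>)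
  qed
qed

lemma dev_primitive:
  assumes d: "dev Q W F" and P: "primitive_on U P" and W: "connected W" "F ` W \<subseteq> U"
  obtains c where "\<And>x. x \<in> W \<Longrightarrow> P (F x) = Q x + c"
proof (cases "W = {}")
  case False
  then obtain a where a: "a \<in> W" by blast
  have "P (F x) - Q x = P (F a) - Q a" if x: "x \<in> W" for x
  proof (rule connected_locally_constant_pred[of W a "\<lambda>x. P (F x) - Q x = P (F a) - Q a", OF W(1) a refl x])
    fix x assume x: "x \<in> W"
    then have "F x \<in> U" using W(2) by blast
    from dev_primitive_local[OF d x P this]
    have ev: "\<forall>\<^sub>F y in at x within W. P (F y) - Q y = P (F x) - Q x"
      by eventually_elim (simp add: algebra_simps)
    show "\<forall>\<^sub>F y in at x within W. P (F y) - Q y = P (F a) - Q a" if "P (F x) - Q x = P (F a) - Q a"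
      using ev unfolding that .
    show "\<forall>\<^sub>F y in at x within W. P (F y) - Q y \<noteq> P (F a) - Q a" if n: "P (F x) - Q x \<noteq> P (F a) - Q a"
      using ev by eventually_elim (use n in simp)
  qed
  then have "P (F x) = Q x + (P (F a) - Q a)" if "x \<in> W" for x
    using that by (metis add.commute diff_add_cancel)
  then show ?thesis by (rule that)
next
  case True
  then show ?thesis using that[of 0] by simp
qed

text \<open>
  Local extensions to balls around points of \<open>W\<close> are compatible after dividing the radii by 3: if two
  of the small balls meet, the larger of the original balls contains the centre of the other one.
\<close>

lemma dev_extend:
  fixes W :: "'b::real_normed_vector set"
  assumes d: "dev Q W F" and Q: "continuous_on UNIV Q"
  obtains D F' where "open D" "W \<subseteq> D" "dev Q D F'" "\<forall>x\<in>W. F' x = F x"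
proof -
  have "\<exists>\<delta> G. \<delta> > 0 \<and> dev Q (ball x \<delta>) G \<and> (\<forall>y\<in>W \<inter> ball x \<delta>. G y = F y)" if x: "x \<in> W" for x
  proof -
    obtain U z where U: "translation_chart X U z" "F x \<in> U"
      "\<forall>\<^sub>F y in at x within W. F y \<in> U \<and> z (F y) - z (F x) = Q y - Q x"
      using dev_obtain[OF d x] .
    note tc = translation_chartD[OF U(1)]
    have o: "open (z ` U)" using translation_chart_open_image[OF U(1) tc(1)] by simp
    \<comment> \<open>The extension is forced: its value in the chart \<open>z\<close> has to be
      \<open>H y\<close>, which for \<open>y\<close> near \<open>x\<close> lies in the open image of
      \<open>U\<close>.\<close>
    define H where "H = (\<lambda>y. z (F x) + (Q y - Q x))"
    have Hc: "continuous_on UNIV H" unfolding H_def by (intro continuous_intros Q)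
    have oH: "open (H -` (z ` U))" using continuous_on_open_vimage[OF open_UNIV] Hc o by auto
    moreover have "x \<in> H -` (z ` U)" using U(2) unfolding H_def by simp
    ultimately obtain d1 where d1: "d1 > 0" "ball x d1 \<subseteq> H -` (z ` U)" unfolding open_contains_ball by blast
    from U(3) obtain d2 where d2: "d2 > 0"
      "\<And>y. y \<in> W \<Longrightarrow> y \<noteq> x \<Longrightarrow> dist y x < d2 \<Longrightarrow> F y \<in> U \<and> z (F y) - z (F x) = Q y - Q x"
      unfolding eventually_at by blast
    define G where "G = (\<lambda>y. inv_into U z (H y))"
    define \<delta> where "\<delta> = min d1 d2"
    have \<delta>: "\<delta> > 0" using d1 d2 unfolding \<delta>_def by simp
    have H_in: "H y \<in> z ` U" if "y \<in> ball x \<delta>" for y using d1(2) that unfolding \<delta>_def by auto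
    have G: "G y \<in> U" "z (G y) = H y" if "y \<in> ball x \<delta>" for y
      using H_in[OF that] unfolding G_def by (auto simp: inv_into_into f_inv_into_f)
    have "dev Q (ball x \<delta>) G"
      unfolding dev_def
    proof (intro conjI ballI exI)
      show "continuous_on (ball x \<delta>) Q" using Q continuous_on_subset by blast
      fix y assume y: "y \<in> ball x \<delta>"
      show "translation_chart X U z" by fact
      show "G y \<in> U" using G y by blast
      have "\<forall>\<^sub>F y' in at y within ball x \<delta>. y' \<in> ball x \<delta>" by (simp add: eventually_at_filter)
      then show "\<forall>\<^sub>F y' in at y within ball x \<delta>. G y' \<in> U \<and> z (G y') - z (G y) = Q y' - Q y"
      proof eventually_elim
        case (elim y')
        then show ?case using G[OF elim] G[OF y] unfolding H_def by simp
      qed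
    qed
    moreover have "G y = F y" if y: "y \<in> W \<inter> ball x \<delta>" for y
    proof -
      have "F y \<in> U \<and> z (F y) - z (F x) = Q y - Q x"
        using d2(2)[of y] y U(2) unfolding \<delta>_def by (cases "y = x") (auto simp: dist_commute)
      then have "F y \<in> U" "z (F y) = H y" unfolding H_def by (auto simp: algebra_simps)
      then show ?thesis using G[of y] inj_onD[OF tc(3)] y by auto
    qed
    ultimately show ?thesis using \<delta> by blast
  qed
  then obtain \<delta> G where \<delta>G: "\<And>x. x \<in> W \<Longrightarrow> \<delta> x > 0" "\<And>x. x \<in> W \<Longrightarrow> dev Q (ball x (\<delta> x)) (G x)"
      "\<And>x y. x \<in> W \<Longrightarrow> y \<in> W \<Longrightarrow> y \<in> ball x (\<delta> x) \<Longrightarrow> G x y = F y"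
    by (metis IntI)
  define B where "B = (\<lambda>x. ball x (\<delta> x / 3))"
  have compat1: "G x y = G x' y" if "x \<in> W" "x' \<in> W" "y \<in> B x" "y \<in> B x'" "\<delta> x' \<le> \<delta> x" for x x' y
  proof -
    have "dist x x' \<le> dist x y + dist y x'" by (rule dist_triangle)
    also have "\<dots> < \<delta> x / 3 + \<delta> x' / 3" using that(3,4) unfolding B_def by (simp add: dist_commute)
    finally have "dist x x' < \<delta> x" using that(5) \<delta>G(1)[OF that(1)] by linarith
    then have x': "x' \<in> ball x (\<delta> x)" "x' \<in> ball x' (\<delta> x')" using \<delta>G(1)[OF that(2)] by auto
    let ?C = "ball x (\<delta> x) \<inter> ball x' (\<delta> x')"
    have "connected ?C" by (intro convex_connected convex_Int convex_ball)
    moreover have "G x x' = G x' x'" using \<delta>G(3)[of x x'] \<delta>G(3)[of x' x'] x' that(1,2) by simp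
    moreover have "y \<in> ?C" using that(3,4) \<delta>G(1)[OF that(1)] \<delta>G(1)[OF that(2)] unfolding B_def by auto
    moreover have "x' \<in> ?C" using x' by blast
    ultimately show ?thesis
      using dev_unique[OF dev_subset[OF \<delta>G(2)[OF that(1)]] dev_subset[OF \<delta>G(2)[OF that(2)]]]
      by (metis inf_le1 inf_le2)
  qed
  have compat: "G x y = G x' y" if "x \<in> W" "x' \<in> W" "y \<in> B x" "y \<in> B x'" for x x' y
    using compat1[of x x' y] compat1[of x' x y] that by (cases "\<delta> x' \<le> \<delta> x") auto
  define F' where "F' = (\<lambda>y. G (SOME x. x \<in> W \<and> y \<in> B x) y)"
  have F': "F' y = G x y" if "x \<in> W" "y \<in> B x" for x y
  proof -
    have "\<exists>x. x \<in> W \<and> y \<in> B x" using that by blast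
    then have "(SOME x. x \<in> W \<and> y \<in> B x) \<in> W \<and> y \<in> B (SOME x. x \<in> W \<and> y \<in> B x)" by (rule someI_ex)
    then show ?thesis unfolding F'_def using compat that by blast
  qed
  show ?thesis
  proof
    show "open (\<Union>x\<in>W. B x)" unfolding B_def by auto
    show "W \<subseteq> (\<Union>x\<in>W. B x)" using \<delta>G(1) unfolding B_def by force
    show "dev Q (\<Union>x\<in>W. B x) F'"
    proof (rule dev_local)
      fix y assume "y \<in> (\<Union>x\<in>W. B x)"
      then obtain x where x: "x \<in> W" "y \<in> B x" by blast
      have sub: "(\<Union>x\<in>W. B x) \<inter> B x \<subseteq> ball x (\<delta> x)" using \<delta>G(1)[OF x(1)] unfolding B_def by auto
      show "\<exists>D H. open D \<and> y \<in> D \<and> dev Q ((\<Union>x\<in>W. B x) \<inter> D) H \<and> (\<forall>y\<in>(\<Union>x\<in>W. B x) \<inter> D. F' y = H y)"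
        using x F'[OF x(1)] dev_subset[OF \<delta>G(2)[OF x(1)] sub]
        by (intro exI[of _ "B x"] exI[of _ "G x"]) (auto simp: B_def)
    qed
    show "\<forall>x\<in>W. F' x = F x"
    proof
      fix x assume x: "x \<in> W"
      have "x \<in> B x" using \<delta>G(1)[OF x] unfolding B_def by simp
      then show "F' x = F x" using F'[OF x] \<delta>G(3)[OF x x] \<delta>G(1)[OF x] by simp
    qed
  qed
qed

text \<open>To leave the cone the geodesic would have to cross its rim, but as long as it is inside,
  its developed value keeps it in a smaller compact cone. So the set of times at which it is inside
  with the expected value is both open and closed.\<close>

lemma dev_stays_in_cone:
  fixes a b :: real
  assumes c: "cone y m R e" and d: "dev Q {a..<b} \<sigma>" and ab: "a < b"
    and x0: "x0 \<in> ball 0 R" "\<sigma> a = e x0"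
    and small: "\<And>t. a \<le> t \<Longrightarrow> t < b \<Longrightarrow> cmod (x0 ^ m + (Q t - Q a)) \<le> \<eta>" and \<eta>: "\<eta> < R ^ m"
    and t: "a \<le> t" "t < b"
  shows "\<exists>x\<in>ball 0 R. \<sigma> t = e x \<and> x ^ m = x0 ^ m + (Q t - Q a)"
proof -
  note cd = coneD[OF c]
  define P where "P = (\<lambda>q. inv_into (ball 0 R) e q ^ m)"
  define B where "B = e ` ball 0 R"
  have P: "primitive_on B P" using cd(8) unfolding B_def P_def .
  have Pe: "P (e x) = x ^ m" if "x \<in> ball 0 R" for x using cd(11)[OF that] unfolding P_def by simp
  define \<phi> where "\<phi> = (\<lambda>t. \<sigma> t \<in> B \<and> P (\<sigma> t) = x0 ^ m + (Q t - Q a))"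
  have \<eta>0: "0 \<le> \<eta>" using small[of a] ab norm_ge_zero order_trans by blast
  define \<rho> where "\<rho> = root m \<eta>"
  have \<rho>: "\<rho> \<ge> 0" "\<rho> < R" "\<rho> ^ m = \<eta>"
  proof -
    show "\<rho> \<ge> 0" unfolding \<rho>_def using \<eta>0 cd(1) by (simp add: real_root_ge_zero)
    have "root m \<eta> < root m (R ^ m)" using \<eta> cd(1) by simp
    then show "\<rho> < R" unfolding \<rho>_def using cd(1,2) by (simp add: real_root_power_cancel)
    show "\<rho> ^ m = \<eta>" unfolding \<rho>_def using cd(1) \<eta>0 by simp
  qed
  \<comment> \<open>\<open>K\<close> is compact, hence closed in the Hausdorff space
    \<open>T\<close>; closedness of the set of good times rests on this.\<close>
  define K where "K = e ` cball 0 \<rho>"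
  have KB: "K \<subseteq> B" unfolding K_def B_def using \<rho>(2) by (intro image_mono) auto
  have "compactin (top_of_set (ball 0 R)) (cball (0::complex) \<rho>)"
    using \<rho>(2) by (auto simp: compactin_subtopology)
  then have "compactin T K" unfolding K_def using image_compactin cd(6) by blast
  then have "closedin T K" using compactin_imp_closedin[OF Hausdorff] by blast
  then have oK: "openin T (topspace T - K)" by blast
  have \<phi>K: "\<sigma> t \<in> K" if \<phi>t: "\<phi> t" and t: "a \<le> t" "t < b" for t
  proof -
    have "\<sigma> t \<in> e ` ball 0 R" using \<phi>t unfolding \<phi>_def B_def by simp
    then obtain x where x: "x \<in> ball 0 R" "\<sigma> t = e x" by blast
    then have "x ^ m = x0 ^ m + (Q t - Q a)" using \<phi>t Pe[OF x(1)] unfolding \<phi>_def by simp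
    then have "cmod x ^ m \<le> \<rho> ^ m" using small[OF t] \<rho>(3) by (simp add: norm_power[symmetric])
    then have "cmod x \<le> \<rho>" using \<rho>(1) cd(1) by (simp add: power_mono_iff)
    then show ?thesis using x unfolding K_def by auto
  qed
  have "\<phi> t"
  proof (rule connected_locally_constant_pred[of "{a..<b}" a])
    show "connected {a..<b}" by simp
    show "a \<in> {a..<b}" "t \<in> {a..<b}" using t ab by auto
    show "\<phi> a" unfolding \<phi>_def using x0 Pe[OF x0(1)] unfolding B_def by auto
    fix s assume s: "s \<in> {a..<b}"
    show "\<forall>\<^sub>F y in at s within {a..<b}. \<phi> y" if "\<phi> s"
    proof -
      have "\<sigma> s \<in> B" using that unfolding \<phi>_def by simp
      from dev_primitive_local[OF d s P this] show ?thesis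
      proof eventually_elim
        case (elim y)
        have "P (\<sigma> y) = (Q y - Q s) + P (\<sigma> s)" using elim by (simp add: diff_eq_eq)
        then show ?case using elim that unfolding \<phi>_def by simp
      qed
    qed
    \<comment> \<open>If \<open>\<sigma> s\<close> lies in \<open>K\<close>, its developed value is
      wrong and stays wrong nearby. If not, \<open>\<sigma>\<close> stays outside \<open>K\<close>
      nearby, whereas \<open>\<phi>\<close> would put it inside.\<close>
    show "\<forall>\<^sub>F y in at s within {a..<b}. \<not> \<phi> y" if n: "\<not> \<phi> s"
    proof (cases "\<sigma> s \<in> K")
      case True
      then have B: "\<sigma> s \<in> B" using KB by blast
      then have "P (\<sigma> s) \<noteq> x0 ^ m + (Q s - Q a)" using n unfolding \<phi>_def by simp
      from dev_primitive_local[OF d s P B] show ?thesis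
      proof eventually_elim
        case (elim y)
        have "P (\<sigma> s) = P (\<sigma> y) - (P (\<sigma> y) - P (\<sigma> s))" by simp
        also have "\<dots> = P (\<sigma> y) - (Q y - Q s)" using elim by (simp only:)
        finally have "P (\<sigma> s) = P (\<sigma> y) - (Q y - Q s)" .
        then show ?case using \<open>P (\<sigma> s) \<noteq> x0 ^ m + (Q s - Q a)\<close> unfolding \<phi>_def by auto
      qed
    next
      case False
      then have "\<sigma> s \<in> topspace T - K" using dev_in(1)[OF d s] by blast
      then have 1: "\<forall>\<^sub>F y in at s within {a..<b}. \<sigma> y \<in> topspace T - K"
        by (rule dev_eventually_in[OF d s oK])
      have "\<forall>\<^sub>F y in at s within {a..<b}. y \<in> {a..<b}" by (simp add: eventually_at_filter)
      with 1 show ?thesis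
      proof eventually_elim
        case (elim y)
        then show ?case using \<phi>K[of y] by auto
      qed
    qed
  qed
  then show ?thesis using Pe unfolding \<phi>_def B_def by auto
qed

text \<open>
  If the geodesic returns to each small cone neighbourhood of \<open>y\<close>, it stays there once the remaining
  length is small, so \<open>y\<close> is the limit; otherwise compactness leaves no room for it.
\<close>

lemma dev_endpoint_limit:
  fixes a b :: real
  assumes d: "dev Q {a..<b} \<sigma>" and ab: "a < b" and Q: "continuous_on {a..b} Q"
  obtains y where "limitin T \<sigma> y (at_left b)"
proof -
  have limQ: "(Q \<longlongrightarrow> Q b) (at_left b)"
    using Q ab unfolding continuous_on_def by (metis at_within_Icc_at_left atLeastAtMost_iff less_imp_le order_refl)
  have key: "(\<exists>V. openin T V \<and> y \<in> V \<and> (\<forall>\<^sub>F t in at_left b. \<sigma> t \<notin> V)) \<or> limitin T \<sigma> y (at_left b)"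
    if y: "y \<in> topspace T" for y
  proof (rule disjCI)
    assume no: "\<not> limitin T \<sigma> y (at_left b)"
    show "\<exists>V. openin T V \<and> y \<in> V \<and> (\<forall>\<^sub>F t in at_left b. \<sigma> t \<notin> V)"
    proof (rule ccontr)
    assume none: "\<not> ?thesis"
    obtain m R e where c: "cone y m R e" using cone_exists[OF y] .
    note cd = coneD[OF c]
    have "limitin T \<sigma> y (at_left b)"
      unfolding limitin_def
    proof (intro conjI y allI impI)
      fix D assume D: "openin T D \<and> y \<in> D"
      have "openin (top_of_set (ball 0 R)) {x \<in> ball 0 R. e x \<in> D}"
        using cd(6) D unfolding continuous_map_def by auto
      then have "open {x \<in> ball 0 R. e x \<in> D}" by (simp add: openin_open_eq)
      moreover have "0 \<in> {x \<in> ball 0 R. e x \<in> D}" using cd(2,3) D by simp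
      ultimately obtain \<rho> where \<rho>: "\<rho> > 0" "ball 0 \<rho> \<subseteq> {x \<in> ball 0 R. e x \<in> D}"
        unfolding open_contains_ball by blast
      define r where "r = min \<rho> R / 2"
      have r: "r > 0" "r < R" "r < \<rho>" using \<rho>(1) cd(2) unfolding r_def by auto
      define \<eta> where "\<eta> = r ^ m"
      have \<eta>: "\<eta> > 0" "\<eta> < R ^ m" using r cd(1) unfolding \<eta>_def by (auto intro: power_strict_mono)
      \<comment> \<open>The factor 1/2 leaves room for the remaining variation of \<open>Q\<close>:
        once that is below \<open>\<eta> / 4\<close>, a return to \<open>V\<close> keeps the
        developed value below \<open>\<eta>\<close> until the end.\<close>
      define V where "V = e ` {x \<in> ball 0 R. cmod (x ^ m) < \<eta> / 2}"
      have "open {x \<in> ball 0 R. cmod (x ^ m) < \<eta> / 2}"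
        by (auto intro!: open_Collect_conj open_Collect_less continuous_intros)
      then have "openin T V" unfolding V_def by (rule cd(5)) auto
      moreover have "y \<in> V" unfolding V_def using cd(1,2,3) \<eta> by (intro image_eqI[of _ _ 0]) (auto simp: power_0_left)
      ultimately have fr: "\<not> (\<forall>\<^sub>F t in at_left b. \<sigma> t \<notin> V)" using none by blast
      have "\<forall>\<^sub>F t in at_left b. dist (Q t) (Q b) < \<eta> / 8" using limQ \<eta> by (intro tendstoD) auto
      then obtain t0 where t0: "t0 < b" "\<And>t. t0 < t \<Longrightarrow> t < b \<Longrightarrow> dist (Q t) (Q b) < \<eta> / 8"
        unfolding eventually_at_left[OF ab] by blast
      have "\<exists>t1>max a t0. t1 < b \<and> \<sigma> t1 \<in> V"
      proof (rule ccontr)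
        assume "\<not> ?thesis"
        then have "\<forall>t>max a t0. t < b \<longrightarrow> \<sigma> t \<notin> V" by blast
        moreover have "max a t0 < b" using ab t0(1) by simp
        ultimately show False using fr unfolding eventually_at_left[OF ab] by blast
      qed
      then obtain t1 where t1: "a < t1" "t0 < t1" "t1 < b" "\<sigma> t1 \<in> V" by auto
      then obtain x1 where x1: "x1 \<in> ball 0 R" "cmod (x1 ^ m) < \<eta> / 2" "\<sigma> t1 = e x1" unfolding V_def by blast
      have d1: "dev Q {t1..<b} \<sigma>" by (rule dev_subset[OF d]) (use t1 in auto)
      have sm: "cmod (x1 ^ m + (Q t - Q t1)) \<le> \<eta>" if "t1 \<le> t" "t < b" for t
      proof -
        have "dist (Q t) (Q b) < \<eta> / 8" "dist (Q t1) (Q b) < \<eta> / 8" using t0(2) t1 that by auto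
        then have "cmod (Q t - Q t1) < \<eta> / 4"
          using dist_triangle2[of "Q t" "Q t1" "Q b"] unfolding dist_norm by linarith
        then show ?thesis using x1(2) norm_triangle_ineq[of "x1 ^ m" "Q t - Q t1"] \<eta>(1) by linarith
      qed
      have "\<sigma> t \<in> D" if t: "t1 < t" "t < b" for t
      proof -
        obtain x where x: "x \<in> ball 0 R" "\<sigma> t = e x" "x ^ m = x1 ^ m + (Q t - Q t1)"
          using dev_stays_in_cone[OF c d1 t1(3) x1(1,3) sm \<eta>(2), of t] t by auto
        have "cmod x ^ m \<le> r ^ m" using sm[of t] t unfolding \<eta>_def norm_power[symmetric] x(3) by simp
        then have "cmod x \<le> r" using r(1) cd(1) by (simp add: power_mono_iff)
        then have "x \<in> ball 0 \<rho>" using r by simp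
        with \<rho>(2) have "x \<in> {x \<in> ball 0 R. e x \<in> D}" by (rule subsetD)
        then show ?thesis using x(2) by simp
      qed
      then show "\<forall>\<^sub>F t in at_left b. \<sigma> t \<in> D"
        unfolding eventually_at_left[OF ab] using t1(3) by blast
    qed
    then show False using no by blast
    qed
  qed
  show ?thesis
  proof (rule ccontr)
    assume "\<not> thesis"
    then have no: "\<not> limitin T \<sigma> y (at_left b)" for y using that by blast
    let ?C = "{V. openin T V \<and> (\<forall>\<^sub>F t in at_left b. \<sigma> t \<notin> V)}"
    have cover: "topspace T \<subseteq> \<Union>?C" using key no by blast
    have "compactin T (topspace T)" using compact unfolding compact_space_def .
    then have "\<exists>\<F>. finite \<F> \<and> \<F> \<subseteq> ?C \<and> topspace T \<subseteq> \<Union>\<F>"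
      by (rule compactinD[OF _ _ cover]) blast
    then obtain \<F> where \<F>: "finite \<F>" "\<F> \<subseteq> ?C" "topspace T \<subseteq> \<Union>\<F>" by (elim exE conjE)
    have "\<forall>\<^sub>F t in at_left b. \<forall>V\<in>\<F>. \<sigma> t \<notin> V" using \<F> by (intro eventually_ball_finite) auto
    moreover have "\<forall>\<^sub>F t in at_left b. t \<in> {a..<b}"
      unfolding eventually_at_left[OF ab] using ab by (intro exI[of _ a]) auto
    ultimately have "\<forall>\<^sub>F t in at_left b. False"
    proof eventually_elim
      case (elim t)
      then show False using dev_in(1)[OF d elim(2)] \<F>(3) by blast
    qed
    then show False by (simp add: eventually_False trivial_limit_at_left_real)
  qed
qed

text \<open>In a chart around the regular limit, \<open>\<sigma>\<close> has the value
  \<open>Q + c\<close> at times shortly before \<open>b\<close>; by continuity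
  \<open>z y = Q b + c\<close>, so \<open>y\<close> is the right value at \<open>b\<close>.\<close>

lemma dev_endpoint_extend:
  fixes a b :: real
  assumes d: "dev Q {a..<b} \<sigma>" and ab: "a < b" and Q: "continuous_on {a..b} Q"
    and lim: "limitin T \<sigma> y (at_left b)" and y: "y \<notin> Sing"
  shows "dev Q {a..b} (\<sigma>(b := y))"
  unfolding dev_def
proof (intro conjI Q ballI)
  fix t assume t: "t \<in> {a..b}"
  show "\<exists>U z. translation_chart X U z \<and> (\<sigma>(b := y)) t \<in> U \<and>
     (\<forall>\<^sub>F s in at t within {a..b}. (\<sigma>(b := y)) s \<in> U \<and> z ((\<sigma>(b := y)) s) - z ((\<sigma>(b := y)) t) = Q s - Q t)"
  proof (cases "t = b")
    case False
    then have t': "t \<in> {a..<b}" using t by auto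
    obtain U z where U: "translation_chart X U z" "\<sigma> t \<in> U"
      "\<forall>\<^sub>F y in at t within {a..<b}. \<sigma> y \<in> U \<and> z (\<sigma> y) - z (\<sigma> t) = Q y - Q t"
      using dev_obtain[OF d t'] .
    have at: "at t within {a..b} = at t within {a..<b}"
      by (rule at_within_nhd[of t "{..<b}"]) (use t' in auto)
    have "\<forall>\<^sub>F s in at t within {a..<b}. s \<in> {a..<b}" by (simp add: eventually_at_filter)
    with U(3) have "\<forall>\<^sub>F s in at t within {a..<b}.
        (\<sigma>(b := y)) s \<in> U \<and> z ((\<sigma>(b := y)) s) - z ((\<sigma>(b := y)) t) = Q s - Q t"
      by eventually_elim (use t' in auto)
    then show ?thesis unfolding at using U(1,2) False by (intro exI[of _ U] exI[of _ z]) auto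
  next
    case True
    have ytop: "y \<in> topspace T" using lim unfolding limitin_def by simp
    obtain U z where U: "translation_chart X U z" "y \<in> U" using regular_point_chart[OF ytop y] .
    note tc = translation_chartD[OF U(1)]
    have "\<forall>\<^sub>F s in at_left b. \<sigma> s \<in> U" using lim tc(1) U(2) unfolding limitin_def by blast
    then obtain t0 where t0: "t0 < b" "\<And>s. t0 < s \<Longrightarrow> s < b \<Longrightarrow> \<sigma> s \<in> U"
      unfolding eventually_at_left[OF ab] by blast
    define t1 where "t1 = max a t0"
    have t1: "t1 < b" "{t1<..<b} \<subseteq> {a..<b}" "\<sigma> ` {t1<..<b} \<subseteq> U" using t0 ab unfolding t1_def by auto
    obtain c where c: "\<And>s. s \<in> {t1<..<b} \<Longrightarrow> z (\<sigma> s) = Q s + c"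
      using dev_primitive[OF dev_subset[OF d t1(2)] tc(2) _ t1(3)] by (metis connected_Ioo)
    have ev: "\<forall>\<^sub>F s in at_left b. s \<in> {t1<..<b}"
      unfolding eventually_at_left[OF t1(1)] by (intro exI[of _ t1]) (use t1 in auto)
    have limQ: "(Q \<longlongrightarrow> Q b) (at_left b)"
      using Q ab unfolding continuous_on_def by (metis at_within_Icc_at_left atLeastAtMost_iff less_imp_le order_refl)
    have "((\<lambda>s. z (\<sigma> s)) \<longlongrightarrow> z y) (at_left b)" by (rule primitive_tendsto[OF tc(2) U(2) lim])
    moreover have "((\<lambda>s. z (\<sigma> s)) \<longlongrightarrow> Q b + c) (at_left b)"
    proof (rule Lim_transform_eventually)
      show "((\<lambda>s. Q s + c) \<longlongrightarrow> Q b + c) (at_left b)" by (intro tendsto_intros limQ)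
      show "\<forall>\<^sub>F s in at_left b. Q s + c = z (\<sigma> s)" using ev by eventually_elim (simp add: c)
    qed
    ultimately have zy: "z y = Q b + c" using tendsto_unique trivial_limit_at_left_real by blast
    have at: "at t within {a..b} = at_left b" using at_within_Icc_at_left[OF ab] True by simp
    have "\<forall>\<^sub>F s in at_left b. (\<sigma>(b := y)) s \<in> U \<and> z ((\<sigma>(b := y)) s) - z ((\<sigma>(b := y)) t) = Q s - Q t"
      using ev
    proof eventually_elim
      case (elim s)
      then show ?case using c[OF elim] zy t1(3) True by auto
    qed
    then show ?thesis unfolding at using U True by (intro exI[of _ U] exI[of _ z]) auto
  qed
qed

text \<open>The primitive may live on a set that contains singularities, as in
  \<open>cone_dev\<close>; around each \<open>F w\<close> it is exchanged for a translation
  chart.\<close>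

lemma dev_if_primitive:
  assumes F: "continuous_map (top_of_set W) T F" "F ` W \<subseteq> U" and P: "primitive_on U P"
    and Q: "continuous_on W Q" and x: "\<And>x. x \<in> W \<Longrightarrow> F x \<notin> Sing" "\<And>x. x \<in> W \<Longrightarrow> P (F x) = Q x"
  shows "dev Q W F"
  unfolding dev_def
proof (intro conjI Q ballI)
  fix w assume w: "w \<in> W"
  have "F w \<in> topspace T" using F(1) w unfolding continuous_map_def by auto
  then obtain V z where V: "translation_chart X V z" "F w \<in> V" using regular_point_chart x(1)[OF w] by blast
  have FU: "F w \<in> U" using F(2) w by blast
  obtain D where D: "openin T D" "F w \<in> D" "D \<subseteq> U \<inter> V" "\<forall>q\<in>D. P q - z q = P (F w) - z (F w)"
    using primitive_on_diff[OF P translation_chartD(2)[OF V(1)] FU V(2)] by (elim exE conjE)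
  have "\<forall>\<^sub>F y in at w within W. F y \<in> D"
    using F(1) w D(1,2) unfolding continuous_map_within_iff limitin_def by blast
  moreover have "\<forall>\<^sub>F y in at w within W. y \<in> W" by (simp add: eventually_at_filter)
  ultimately have "\<forall>\<^sub>F y in at w within W. F y \<in> V \<and> z (F y) - z (F w) = Q y - Q w"
  proof eventually_elim
    case (elim y)
    have "P (F y) - z (F y) = P (F w) - z (F w)" using D(4) elim(1) by blast
    then show ?case using D(3) elim x(2)[OF w] x(2)[OF elim(2)] by (auto simp: algebra_simps)
  qed
  then show "\<exists>U z. translation_chart X U z \<and> F w \<in> U \<and>
      (\<forall>\<^sub>F y in at w within W. F y \<in> U \<and> z (F y) - z (F w) = Q y - Q w)"
    using V by (intro exI[of _ V] exI[of _ z]) simp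
qed

lemma cone_dev:
  assumes c: "cone y m R e"
  shows "dev (\<lambda>x. x ^ m) (ball 0 R - {0}) e"
proof (rule dev_if_primitive)
  note cd = coneD[OF c]
  show "continuous_map (top_of_set (ball 0 R - {0})) T e"
    using continuous_map_from_subtopology_mono[OF cd(6), of "ball 0 R - {0}"] by simp
  show "primitive_on (e ` ball 0 R) (\<lambda>q. inv_into (ball 0 R) e q ^ m)" by (rule cd(8))
qed (use coneD[OF c] in \<open>auto intro!: continuous_intros\<close>)

section \<open>The exponential map at a singularity\<close>

definition cone_data :: "'a \<Rightarrow> nat \<times> real \<times> (complex \<Rightarrow> 'a)" where
  "cone_data p = (SOME c. cone p (fst c) (fst (snd c)) (snd (snd c)))"

definition cone_angle :: "'a \<Rightarrow> nat" where "cone_angle p = fst (cone_data p)"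
definition cone_radius :: "'a \<Rightarrow> real" where "cone_radius p = fst (snd (cone_data p))"
definition cone_param :: "'a \<Rightarrow> complex \<Rightarrow> 'a" where "cone_param p = snd (snd (cone_data p))"

lemma cone_at:
  assumes "p \<in> Sing"
  shows "cone p (cone_angle p) (cone_radius p) (cone_param p)"
proof -
  have "p \<in> topspace T" using Sing_subset assms by blast
  then obtain m R e where "cone p m R e" by (rule cone_exists)
  then have "\<exists>c. cone p (fst c) (fst (snd c)) (snd (snd c))" by (intro exI[of _ "(m, R, e)"]) simp
  then show ?thesis unfolding cone_angle_def cone_radius_def cone_param_def cone_data_def by (rule someI_ex)
qed

lemmas cone_atD = coneD[OF cone_at]

text \<open>
  The exponential map at \<open>p\<close>, in the coordinate \<open>\<zeta>\<close> of the cone: \<open>expo p \<zeta>\<close> is the endpoint of the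
  geodesic from \<open>p\<close> with period \<open>\<zeta> ^ cone_angle p\<close>, and \<open>star p\<close> consists of the \<open>\<zeta> \<noteq> 0\<close> for which
  this geodesic avoids the singularities.
\<close>

definition ray :: "'a \<Rightarrow> complex \<Rightarrow> (complex \<Rightarrow> 'a) \<Rightarrow> bool" where
  "ray p \<zeta> F \<longleftrightarrow> dev (\<lambda>x. x ^ cone_angle p) (punctured_ray \<zeta>) F \<and>
     (\<exists>\<delta>>0. \<forall>x\<in>punctured_ray \<zeta>. cmod x < \<delta> \<longrightarrow> F x = cone_param p x)"

definition star :: "'a \<Rightarrow> complex set" where
  "star p = {\<zeta>. \<zeta> \<noteq> 0 \<and> (\<exists>F. ray p \<zeta> F)}"

definition expo :: "'a \<Rightarrow> complex \<Rightarrow> 'a" where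
  "expo p \<zeta> = (SOME F. ray p \<zeta> F) \<zeta>"

text \<open>The condition near 0 singles out one of the geodesics from \<open>p\<close> with the
  given period: two such maps agree at one small point, and agreement propagates along the ray. This
  makes the choice in \<open>expo\<close> harmless.\<close>

lemma ray_unique:
  assumes "ray p \<zeta> F" "ray p \<zeta> F'" "x \<in> punctured_ray \<zeta>"
  shows "F x = F' x"
proof -
  obtain \<delta> where \<delta>: "\<delta> > 0" "\<forall>x\<in>punctured_ray \<zeta>. cmod x < \<delta> \<longrightarrow> F x = cone_param p x"
    using assms(1) unfolding ray_def by blast
  obtain \<delta>' where \<delta>': "\<delta>' > 0" "\<forall>x\<in>punctured_ray \<zeta>. cmod x < \<delta>' \<longrightarrow> F' x = cone_param p x"
    using assms(2) unfolding ray_def by blast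
  obtain \<tau> where \<tau>: "0 < \<tau>" "\<tau> \<le> 1" "cmod (\<tau> *\<^sub>R \<zeta>) < min \<delta> \<delta>'"
    by (rule punctured_ray_small[of "min \<delta> \<delta>'" \<zeta>]) (use \<delta> \<delta>' in auto)
  have t: "\<tau> *\<^sub>R \<zeta> \<in> punctured_ray \<zeta>" using \<tau> punctured_ray_scale by blast
  have "F (\<tau> *\<^sub>R \<zeta>) = F' (\<tau> *\<^sub>R \<zeta>)" using \<delta>(2) \<delta>'(2) t \<tau>(3) by simp
  then show ?thesis
    using dev_unique[OF _ _ connected_punctured_ray t _ assms(3)] assms(1,2) unfolding ray_def by blast
qed

lemma ray_restrict:
  assumes "ray p \<zeta> F" "x \<in> punctured_ray \<zeta>"
  shows "ray p x F"
  using assms(1) dev_subset[OF _ punctured_ray_subset[OF assms(2)]] punctured_ray_subset[OF assms(2)]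
  unfolding ray_def by (metis subsetD)

lemma ray_expo:
  assumes "ray p \<zeta> F" "x \<in> punctured_ray \<zeta>"
  shows "expo p x = F x"
proof -
  have r: "ray p x F" by (rule ray_restrict[OF assms])
  then have "ray p x (SOME F. ray p x F)" by (rule someI[of "ray p x"])
  then show ?thesis unfolding expo_def using ray_unique[OF _ r punctured_ray_self] by blast
qed

lemma ray_star:
  assumes "ray p \<zeta> F" "\<zeta> \<noteq> 0" "x \<in> punctured_ray \<zeta>"
  shows "x \<in> star p"
proof -
  have "x \<noteq> 0" using assms(2,3) unfolding punctured_ray_def by auto
  then show ?thesis using ray_restrict[OF assms(1,3)] unfolding star_def by blast
qed

lemma star_ray: "\<zeta> \<in> star p \<Longrightarrow> x \<in> punctured_ray \<zeta> \<Longrightarrow> x \<in> star p"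
  using ray_star unfolding star_def by blast

lemma ray_cone_param:
  assumes p: "p \<in> Sing" and \<zeta>: "\<zeta> \<in> ball 0 (cone_radius p)" "\<zeta> \<noteq> 0"
  shows "ray p \<zeta> (cone_param p)"
  unfolding ray_def
proof (intro conjI exI[of _ 1])
  have "punctured_ray \<zeta> \<subseteq> ball 0 (cone_radius p) - {0}"
  proof
    fix x assume "x \<in> punctured_ray \<zeta>"
    then obtain \<tau> where \<tau>: "x = \<tau> *\<^sub>R \<zeta>" "0 < \<tau>" "\<tau> \<le> 1" by (rule punctured_rayE)
    then have "cmod x = \<tau> * cmod \<zeta>" by simp
    also have "\<dots> \<le> 1 * cmod \<zeta>" using \<tau>(3) by (rule mult_right_mono) simp
    also have "\<dots> < cone_radius p" using \<zeta>(1) by simp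
    finally have "x \<in> ball 0 (cone_radius p)" by simp
    moreover have "x \<noteq> 0" using \<zeta>(2) \<tau> by simp
    ultimately show "x \<in> ball 0 (cone_radius p) - {0}" by blast
  qed
  then show "dev (\<lambda>x. x ^ cone_angle p) (punctured_ray \<zeta>) (cone_param p)"
    using dev_subset[OF cone_dev[OF cone_at[OF p]]] by blast
qed auto

lemma star_near_0:
  assumes "p \<in> Sing" "\<zeta> \<in> ball 0 (cone_radius p)" "\<zeta> \<noteq> 0"
  shows "\<zeta> \<in> star p" "expo p \<zeta> = cone_param p \<zeta>"
  using ray_cone_param[OF assms] ray_star[OF _ assms(3) punctured_ray_self] ray_expo[OF _ punctured_ray_self]
  by blast+

text \<open>A developing map on the ray alone gives no control at 0, where it cannot be extended. So
  a punctured disc, on which \<open>cone_param\<close> is known, is joined to the ray before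
  extending to an open set; what is left of the ray is compact, hence all nearby rays fit into that
  set.\<close>

lemma star_nhd:
  assumes p: "p \<in> Sing" and \<zeta>: "\<zeta> \<in> star p"
  obtains \<epsilon> where "\<epsilon> > 0" "ball \<zeta> \<epsilon> \<subseteq> star p" "dev (\<lambda>x. x ^ cone_angle p) (ball \<zeta> \<epsilon>) (expo p)"
proof -
  define Q where "Q = (\<lambda>x::complex. x ^ cone_angle p)"
  define R where "R = cone_radius p"
  have R: "R > 0" using cone_atD(2)[OF p] unfolding R_def .
  have \<zeta>0: "\<zeta> \<noteq> 0" using \<zeta> unfolding star_def by simp
  obtain F where F: "ray p \<zeta> F" using \<zeta> unfolding star_def by blast
  have dF: "dev Q (punctured_ray \<zeta>) F" using F unfolding ray_def Q_def by blast
  have ceF: "F x = cone_param p x" if "x \<in> punctured_ray \<zeta>" "cmod x < R" for x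
  proof -
    have "x \<noteq> 0" using that(1) \<zeta>0 unfolding punctured_ray_def by auto
    then show ?thesis using star_near_0(2)[OF p, of x] ray_expo[OF F that(1)] that(2) unfolding R_def by simp
  qed
  \<comment> \<open>The disc has radius \<open>R / 2\<close> while \<open>cone_param\<close> is
    available up to \<open>R\<close>, so that the two local descriptions of \<open>F0\<close>
    overlap on an open set.\<close>
  define C where "C = (ball 0 (R / 2) - {0}) \<union> punctured_ray \<zeta>"
  define F0 where "F0 = (\<lambda>x. if cmod x < R then cone_param p x else F x)"
  have F0F: "F0 x = F x" if "x \<in> punctured_ray \<zeta>" for x using ceF[OF that] unfolding F0_def by simp
  have "dev Q C F0"
  proof (rule dev_local)
    fix x assume x: "x \<in> C"
    show "\<exists>D F'. open D \<and> x \<in> D \<and> dev Q (C \<inter> D) F' \<and> (\<forall>y\<in>C \<inter> D. F0 y = F' y)"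
    proof (cases "cmod x < R")
      case True
      have "C \<inter> ball 0 R \<subseteq> ball 0 R - {0}" using \<zeta>0 unfolding C_def punctured_ray_def by auto
      then have "dev Q (C \<inter> ball 0 R) (cone_param p)"
        using dev_subset[OF cone_dev[OF cone_at[OF p]]] unfolding Q_def R_def by blast
      then show ?thesis using True
        by (intro exI[of _ "ball 0 R"] exI[of _ "cone_param p"] conjI) (auto simp: F0_def)
    next
      case False
      let ?D = "- cball (0::complex) (R / 2)"
      have sub: "C \<inter> ?D \<subseteq> punctured_ray \<zeta>" unfolding C_def by auto
      then have "dev Q (C \<inter> ?D) F" using dev_subset[OF dF] by blast
      then show ?thesis using False R sub F0F
        by (intro exI[of _ ?D] exI[of _ F] conjI) auto
    qed
  qed
  then obtain D F' where D: "open D" "C \<subseteq> D" "dev Q D F'" "\<forall>x\<in>C. F' x = F0 x"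
    by (rule dev_extend) (auto simp: Q_def intro!: continuous_intros)
  \<comment> \<open>Up to the parameter \<open>\<tau>0\<close>, the rays to all points within
    distance 1 of \<open>\<zeta>\<close> stay in the small disc; hence the term
    \<open>cmod \<zeta> + 1\<close>.\<close>
  obtain \<tau>0 where \<tau>0: "\<tau>0 > 0" "\<tau>0 \<le> 1" "cmod (\<tau>0 *\<^sub>R of_real (cmod \<zeta> + 1)) < R / 2"
    by (rule punctured_ray_small[of "R / 2" "of_real (cmod \<zeta> + 1)"]) (use R in auto)
  have "cmod (\<tau>0 *\<^sub>R of_real (cmod \<zeta> + 1)) = \<tau>0 * (cmod \<zeta> + 1)"
    unfolding norm_scaleR norm_of_real using \<tau>0(1) norm_ge_zero[of \<zeta>] by simp
  then have \<tau>0R: "\<tau>0 * (cmod \<zeta> + 1) < R / 2" using \<tau>0(3) by (simp only:)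
  define S where "S = (\<lambda>\<tau>. \<tau> *\<^sub>R \<zeta>) ` {\<tau>0..1}"
  have "compact S" unfolding S_def by (intro compact_continuous_image continuous_intros compact_Icc)
  moreover have "S \<subseteq> punctured_ray \<zeta>" using \<tau>0 unfolding S_def punctured_ray_def by (intro image_mono) auto
  then have "S \<subseteq> D" using D(2) unfolding C_def by blast
  ultimately obtain e1 where e1: "e1 > 0" "(\<Union>x\<in>S. ball x e1) \<subseteq> D"
    using compact_subset_open_imp_ball_epsilon_subset[OF _ D(1)] by metis
  define \<epsilon> where "\<epsilon> = min e1 (min 1 (cmod \<zeta>))"
  have \<epsilon>: "\<epsilon> > 0" "\<epsilon> \<le> e1" "\<epsilon> \<le> 1" "\<epsilon> \<le> cmod \<zeta>" using e1 \<zeta>0 unfolding \<epsilon>_def by auto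
  have rayD: "punctured_ray \<zeta>' \<subseteq> D" "\<zeta>' \<noteq> 0" if "\<zeta>' \<in> ball \<zeta> \<epsilon>" for \<zeta>'
  proof -
    have dist: "cmod (\<zeta>' - \<zeta>) < \<epsilon>" using that by (simp add: dist_norm norm_minus_commute)
    show n0: "\<zeta>' \<noteq> 0" using dist \<epsilon>(4) by auto
    show "punctured_ray \<zeta>' \<subseteq> D"
    proof
      fix x assume "x \<in> punctured_ray \<zeta>'"
      then obtain \<tau> where \<tau>: "x = \<tau> *\<^sub>R \<zeta>'" "0 < \<tau>" "\<tau> \<le> 1" by (rule punctured_rayE)
      show "x \<in> D"
      proof (cases "\<tau>0 \<le> \<tau>")
        case True
        have "cmod (\<tau> *\<^sub>R \<zeta>' - \<tau> *\<^sub>R \<zeta>) = \<tau> * cmod (\<zeta>' - \<zeta>)"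
          using \<tau>(2) by (simp add: scaleR_diff_right[symmetric])
        also have "\<dots> \<le> 1 * cmod (\<zeta>' - \<zeta>)" using \<tau>(3) by (rule mult_right_mono) simp
        also have "\<dots> < e1" using dist \<epsilon>(2) by simp
        finally have "x \<in> ball (\<tau> *\<^sub>R \<zeta>) e1" unfolding \<tau>(1) by (simp add: dist_norm norm_minus_commute)
        moreover have "\<tau> *\<^sub>R \<zeta> \<in> S" using True \<tau>(3) unfolding S_def by auto
        ultimately show ?thesis using e1(2) by blast
      next
        case False
        have "cmod \<zeta>' \<le> cmod \<zeta> + cmod (\<zeta>' - \<zeta>)" by (metis add.commute diff_add_cancel norm_triangle_ineq)
        then have le: "cmod \<zeta>' \<le> cmod \<zeta> + 1" using dist \<epsilon>(3) by linarith
        have "cmod x = \<tau> * cmod \<zeta>'" using \<tau> by simp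
        also have "\<dots> \<le> \<tau>0 * (cmod \<zeta> + 1)" using False \<tau>(2) le by (intro mult_mono) auto
        finally have "cmod x < R / 2" using \<tau>0R by linarith
        moreover have "x \<noteq> 0" using \<tau> n0 by simp
        ultimately show ?thesis using D(2) unfolding C_def by auto
      qed
    qed
  qed
  have r: "ray p \<zeta>' F'" if "\<zeta>' \<in> ball \<zeta> \<epsilon>" for \<zeta>'
    unfolding ray_def
  proof (intro conjI exI[of _ "R / 2"] ballI impI)
    show "dev (\<lambda>x. x ^ cone_angle p) (punctured_ray \<zeta>') F'"
      using dev_subset[OF D(3) rayD(1)[OF that]] unfolding Q_def .
    show "R / 2 > 0" using R by simp
    fix x assume x: "x \<in> punctured_ray \<zeta>'" "cmod x < R / 2"
    have "x \<noteq> 0" using x(1) rayD(2)[OF that] unfolding punctured_ray_def by auto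
    then have "x \<in> C" using x(2) unfolding C_def by auto
    then have "F' x = F0 x" using D(4) by blast
    then show "F' x = cone_param p x" using x(2) R unfolding F0_def by simp
  qed
  show ?thesis
  proof
    show "\<epsilon> > 0" by fact
    show "ball \<zeta> \<epsilon> \<subseteq> star p" using ray_star[OF r rayD(2) punctured_ray_self] by blast
    have sub: "ball \<zeta> \<epsilon> \<subseteq> D" using rayD(1) punctured_ray_self by blast
    have "dev Q (ball \<zeta> \<epsilon>) (expo p)"
    proof (rule dev_cong[OF dev_subset[OF D(3) sub], where c = 0])
      fix x assume "x \<in> ball \<zeta> \<epsilon>"
      then show "expo p x = F' x" using ray_expo[OF r punctured_ray_self] by blast
    qed simp
    then show "dev (\<lambda>x. x ^ cone_angle p) (ball \<zeta> \<epsilon>) (expo p)" unfolding Q_def .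
  qed
qed

lemma star_open: 
  assumes "p \<in> Sing" shows "open (star p)"
  unfolding open_contains_ball
proof
  fix \<zeta> assume "\<zeta> \<in> star p"
  from star_nhd[OF assms this] show "\<exists>e>0. ball \<zeta> e \<subseteq> star p" by metis
qed

lemma expo_dev:
  assumes "p \<in> Sing" shows "dev (\<lambda>x. x ^ cone_angle p) (star p) (expo p)"
proof (rule dev_local)
  fix \<zeta> assume "\<zeta> \<in> star p"
  from star_nhd[OF assms this] obtain \<epsilon> where
    e: "\<epsilon> > 0" "ball \<zeta> \<epsilon> \<subseteq> star p" "dev (\<lambda>x. x ^ cone_angle p) (ball \<zeta> \<epsilon>) (expo p)" .
  have "star p \<inter> ball \<zeta> \<epsilon> = ball \<zeta> \<epsilon>" using e(2) by blast
  then show "\<exists>D F'. open D \<and> \<zeta> \<in> D \<and> dev (\<lambda>x. x ^ cone_angle p) (star p \<inter> D) F' \<and>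
      (\<forall>y\<in>star p \<inter> D. expo p y = F' y)"
    using e by (intro exI[of _ "ball \<zeta> \<epsilon>"] exI[of _ "expo p"]) auto
qed

section \<open>Saddle connections\<close>

text \<open>Read in the atlas chart, \<open>z\<close> has the coefficient of the form as its
  derivative, and this is nonzero at regular points, so the rule for the derivative of an inverse
  applies.\<close>

lemma translation_to_atlas_derivative:
  assumes U: "translation_chart X U z" and V: "(V, \<phi>) \<in> rs_atlas X" and q: "q \<in> U" "q \<in> V"
  shows "((\<phi> \<circ> inv_into U z) has_field_derivative inverse (ts_form X (V, \<phi>) (\<phi> q))) (at (z q))"
proof -
  note tc = translation_chartD[OF U]
  define w where "w = ts_form X (V, \<phi>) (\<phi> q)"
  have w: "w \<noteq> 0" unfolding w_def using form_nonzero[OF V q(2)] q(1) tc(4) by blast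
  define S where "S = \<phi> ` (U \<inter> V)"
  have oUV: "openin T (U \<inter> V)" using tc(1) atlas_openin[OF V] by blast
  have S: "open S" "\<phi> q \<in> S" unfolding S_def using atlas_open_image[OF V oUV] q by auto
  have inv: "inv_into V \<phi> (\<phi> q) = q" if "q \<in> V" for q using atlas_inj[OF V] that by simp
  have zinv: "inv_into U z (z q) = q" if "q \<in> U" for q using tc(3) that by simp
  have "((z \<circ> inv_into V \<phi>) has_field_derivative w) (at (\<phi> q))"
    unfolding w_def by (rule primitive_onD[OF tc(2) V q])
  moreover have "continuous_on S (z \<circ> inv_into V \<phi>)"
  proof (rule continuous_at_imp_continuous_on, rule ballI)
    fix x assume "x \<in> S"
    then obtain q where q: "q \<in> U" "q \<in> V" "x = \<phi> q" unfolding S_def by blast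
    then show "isCont (z \<circ> inv_into V \<phi>) x"
      using DERIV_isCont[OF primitive_onD[OF tc(2) V q(1,2)]] by simp
  qed
  moreover have "(\<phi> \<circ> inv_into U z) ((z \<circ> inv_into V \<phi>) x) = x" if "x \<in> S" for x
    using that inv zinv unfolding S_def by auto
  ultimately have "((\<phi> \<circ> inv_into U z) has_field_derivative inverse w) (at ((z \<circ> inv_into V \<phi>) (\<phi> q)))"
    using has_field_derivative_inverse_strong[OF _ w S] by blast
  then show ?thesis unfolding w_def using inv[OF q(2)] by simp
qed

text \<open>In an atlas chart the velocity is \<open>c\<close> divided by the coefficient of the
  form, so the integrand is \<open>c\<close> except possibly at the two endpoints.\<close>

lemma path_period_eq:
  assumes \<gamma>: "pathin T \<gamma>" and reg: "\<And>t. 0 < t \<Longrightarrow> t < 1 \<Longrightarrow> \<gamma> t \<notin> Sing"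
    and vel: "\<And>t U z. 0 < t \<Longrightarrow> t < 1 \<Longrightarrow> translation_chart X U z \<Longrightarrow> \<gamma> t \<in> U \<Longrightarrow>
        ((z \<circ> \<gamma>) has_vector_derivative c) (at t)"
  shows "path_period X \<gamma> = c"
proof -
  have cont: "continuous_map (top_of_set {0..1}) T \<gamma>" using \<gamma> unfolding pathin_def .
  have integrand: "(let c = chart_at X (\<gamma> t) in ts_form X c (snd c (\<gamma> t)) * vector_derivative (snd c \<circ> \<gamma>) (at t)) = c"
    if t: "0 < t" "t < 1" for t
  proof -
    have top: "\<gamma> t \<in> topspace T" using cont t unfolding continuous_map_def by auto
    obtain V \<phi> where V: "chart_at X (\<gamma> t) = (V, \<phi>)" by force
    have Va: "(V, \<phi>) \<in> rs_atlas X" "\<gamma> t \<in> V" using chart_at[OF top] V by auto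
    obtain U z where U: "translation_chart X U z" "\<gamma> t \<in> U" using regular_point_chart[OF top reg[OF t]] .
    note tc = translation_chartD[OF U(1)]
    define w where "w = ts_form X (V, \<phi>) (\<phi> (\<gamma> t))"
    have w: "w \<noteq> 0" unfolding w_def by (rule form_nonzero[OF Va reg[OF t]])
    have zinv: "inv_into U z (z q) = q" if "q \<in> U" for q using tc(3) that by simp
    have d1: "((\<phi> \<circ> inv_into U z) has_field_derivative inverse w) (at ((z \<circ> \<gamma>) t))"
      using translation_to_atlas_derivative[OF U(1) Va(1) U(2) Va(2)] unfolding w_def by simp
    have "(((\<phi> \<circ> inv_into U z) \<circ> (z \<circ> \<gamma>)) has_vector_derivative (c * inverse w)) (at t)"
      by (rule field_vector_diff_chain_at[OF vel[OF t U] d1])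
    then have vd: "((\<phi> \<circ> inv_into U z \<circ> (z \<circ> \<gamma>)) has_vector_derivative (c * inverse w)) (at t)" .
    have "limitin T \<gamma> (\<gamma> t) (at t within {0..1})" using cont t unfolding continuous_map_within_iff by simp
    then have "\<forall>\<^sub>F s in at t. \<gamma> s \<in> U"
      using tc(1) U(2) unfolding limitin_def at_within_Icc_at[OF t] by blast
    then have ev: "\<forall>\<^sub>F s in at t. (\<phi> \<circ> inv_into U z \<circ> (z \<circ> \<gamma>)) s = (\<phi> \<circ> \<gamma>) s"
      by eventually_elim (simp add: zinv)
    have "((\<phi> \<circ> \<gamma>) has_vector_derivative (c * inverse w)) (at t)"
      using vd unfolding has_vector_derivative_def
      by (rule has_derivative_transform_eventually[OF _ ev]) (simp_all add: zinv U(2))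
    then have "vector_derivative (\<phi> \<circ> \<gamma>) (at t) = c * inverse w" by (rule vector_derivative_at)
    then show ?thesis unfolding V Let_def using w by (simp add: w_def)
  qed
  have "((\<lambda>t. let c = chart_at X (\<gamma> t) in ts_form X c (snd c (\<gamma> t)) * vector_derivative (snd c \<circ> \<gamma>) (at t))
      has_integral c) {0..1}"
  proof (rule has_integral_spike_finite[of "{0, 1}" "{0..1}" _ "\<lambda>_. c"])
    show "((\<lambda>_. c) has_integral c) {0..1::real}" using has_integral_const_real[of c 0 1] by simp
  qed (use integrand in auto)
  then show ?thesis unfolding path_period_def by (rule integral_unique)
qed

text \<open>Velocity \<open>c\<close> in translation charts means that
  \<open>z (\<gamma> s) - s * c\<close> has derivative 0, which integrates to the increment
  condition of \<open>dev\<close>; the velocity equals the period.\<close>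

lemma saddle_connectionD:
  assumes "v \<in> Hol X"
  obtains \<gamma> where "pathin T \<gamma>" "\<gamma> 0 \<in> Sing" "\<gamma> 1 \<in> Sing" "v \<noteq> 0"
    "dev (\<lambda>t. of_real t * v) {0<..<1} \<gamma>"
proof -
  obtain \<gamma> where \<gamma>: "saddle_connection X \<gamma>" "v = path_period X \<gamma>" using assms unfolding Hol_def by blast
  then obtain c where c: "c \<noteq> 0" "\<forall>t \<in> {0<..<1}. \<forall>U z. translation_chart X U z \<and> \<gamma> t \<in> U \<longrightarrow>
        ((z \<circ> \<gamma>) has_vector_derivative c) (at t)" unfolding saddle_connection_def by blast
  have p: "pathin T \<gamma>" "\<gamma> 0 \<in> Sing" "\<gamma> 1 \<in> Sing" "\<forall>t \<in> {0<..<1}. \<gamma> t \<notin> Sing"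
    using \<gamma>(1) unfolding saddle_connection_def by simp_all
  have vc: "v = c" unfolding \<gamma>(2) by (rule path_period_eq[OF p(1)]) (use p(4) c(2) in auto)
  have cont: "continuous_map (top_of_set {0..1}) T \<gamma>" using p(1) unfolding pathin_def .
  have "dev (\<lambda>t. of_real t * c) {0<..<1} \<gamma>"
    unfolding dev_def
  proof (intro conjI ballI)
    show "continuous_on {0<..<1} (\<lambda>t. of_real t * c)" by (intro continuous_intros)
    fix t :: real assume t: "t \<in> {0<..<1}"
    have top: "\<gamma> t \<in> topspace T" using cont t unfolding continuous_map_def by auto
    have "\<gamma> t \<notin> Sing" using p(4) t by blast
    then obtain U z where U: "translation_chart X U z" "\<gamma> t \<in> U" using regular_point_chart[OF top] by metis
    have "limitin T \<gamma> (\<gamma> t) (at t within {0..1})" using cont t unfolding continuous_map_within_iff by simp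
    then have "\<forall>\<^sub>F s in at t. \<gamma> s \<in> U"
      using translation_chartD(1)[OF U(1)] U(2) t at_within_Icc_at[of 0 t 1] unfolding limitin_def by auto
    then obtain d0 where d0: "d0 > 0" "\<And>s. s \<noteq> t \<Longrightarrow> dist s t < d0 \<Longrightarrow> \<gamma> s \<in> U"
      unfolding eventually_at by auto
    define d where "d = min d0 (min t (1 - t))"
    have d: "d > 0" using d0(1) t unfolding d_def by simp
    have in_U: "s \<in> {0<..<1}" "\<gamma> s \<in> U" if "s \<in> ball t d" for s
      using that d0(2)[of s] U(2) unfolding d_def by (cases "s = t"; auto simp: dist_real_def)+
    have "\<exists>k. \<forall>s\<in>ball t d. z (\<gamma> s) - of_real s * c = k"
    proof (rule has_vector_derivative_zero_constant)
      fix s assume s: "s \<in> ball t d"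
      have "((z \<circ> \<gamma>) has_vector_derivative c) (at s)" using c(2) in_U[OF s] U(1) by blast
      then have 1: "((\<lambda>s. z (\<gamma> s)) has_vector_derivative c) (at s)" by (simp add: o_def)
      have 2: "((\<lambda>s. of_real s * c) has_vector_derivative c) (at s)"
        by (auto intro!: derivative_eq_intros)
      have "((\<lambda>s. z (\<gamma> s) - of_real s * c) has_vector_derivative (c - c)) (at s)"
        using 1 2 by (rule has_vector_derivative_diff)
      then show "((\<lambda>s. z (\<gamma> s) - of_real s * c) has_vector_derivative 0) (at s within ball t d)"
        by (simp add: has_vector_derivative_at_within)
    qed auto
    then obtain k where k: "\<forall>s\<in>ball t d. z (\<gamma> s) - of_real s * c = k" by blast
    have "\<forall>\<^sub>F s in at t within {0<..<1}. \<gamma> s \<in> U \<and> z (\<gamma> s) - z (\<gamma> t) = of_real s * c - of_real t * c"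
      unfolding eventually_at
    proof (intro exI[of _ d] conjI d ballI impI)
      fix s assume s: "s \<in> {0<..<1}" "s \<noteq> t \<and> dist s t < d"
      then have s: "s \<in> ball t d" by (simp add: dist_commute)
      show "\<gamma> s \<in> U" using in_U[OF s] by simp
      have "z (\<gamma> s) = of_real s * c + k" using bspec[OF k s] by (simp add: algebra_simps)
      moreover have "z (\<gamma> t) = of_real t * c + k" using bspec[OF k, of t] d by (simp add: algebra_simps)
      ultimately show "z (\<gamma> s) - z (\<gamma> t) = of_real s * c - of_real t * c" by simp
    qed
    then show "\<exists>U z. translation_chart X U z \<and> \<gamma> t \<in> U \<and>
       (\<forall>\<^sub>F s in at t within {0<..<1}. \<gamma> s \<in> U \<and> z (\<gamma> s) - z (\<gamma> t) = of_real s * c - of_real t * c)"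
      using U by (intro exI[of _ U] exI[of _ z]) simp
  qed
  then show ?thesis using that[OF p(1-3)] c(1) vc by simp
qed

lemma dev_Hol:
  assumes d: "dev (\<lambda>t. of_real t * c) {0<..<1} \<gamma>" and c: "c \<noteq> 0" and pq: "p \<in> Sing" "q \<in> Sing"
    and lim: "limitin T \<gamma> p (at_right 0)" "limitin T \<gamma> q (at_left 1)"
  shows "c \<in> Hol X"
proof -
  \<comment> \<open>\<open>\<gamma>\<close> is arbitrary at the endpoints, so its limits are put in
    to obtain a path on the closed interval.\<close>
  define \<delta> where "\<delta> = \<gamma>(0 := p, 1 := q)"
  have \<delta>: "\<delta> t = \<gamma> t" if "0 < t" "t < 1" for t using that unfolding \<delta>_def by simp
  have at01: "at t within {0..1} = at t within {0<..<1}" if "t \<in> {0<..<1}" for t :: real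
    by (rule at_within_nhd[of t "{0<..<1}"]) (use that in auto)
  have inI: "\<forall>\<^sub>F s in at_right 0. s \<in> {0<..<1::real}"
    by (rule eventually_at_right_real) simp
  have inI': "\<forall>\<^sub>F s in at_left 1. s \<in> {0<..<1::real}"
    by (rule eventually_at_left_real) simp
  have ev: "\<forall>\<^sub>F s in at t within {0..1}. \<delta> s \<in> D" if D: "openin T D" "\<delta> t \<in> D" "t \<in> {0..1}" for t D
  proof -
    consider "t = 0" | "t = 1" | "t \<in> {0<..<1}" using D(3) by fastforce
    then show ?thesis
    proof cases
      case 1
      then have "p \<in> D" using D(2) unfolding \<delta>_def by simp
      then have "\<forall>\<^sub>F s in at_right 0. \<gamma> s \<in> D" using lim(1) D(1) unfolding limitin_def by blast
      with inI have "\<forall>\<^sub>F s in at_right 0. \<delta> s \<in> D" by eventually_elim (simp add: \<delta>)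
      then show ?thesis unfolding 1 by (simp add: at_within_Icc_at_right)
    next
      case 2
      then have "q \<in> D" using D(2) unfolding \<delta>_def by simp
      then have "\<forall>\<^sub>F s in at_left 1. \<gamma> s \<in> D" using lim(2) D(1) unfolding limitin_def by blast
      with inI' have "\<forall>\<^sub>F s in at_left 1. \<delta> s \<in> D" by eventually_elim (simp add: \<delta>)
      then show ?thesis unfolding 2 by (simp add: at_within_Icc_at_left)
    next
      case 3
      have "\<gamma> t \<in> D" using D(2) \<delta>[of t] 3 by simp
      then have 4: "\<forall>\<^sub>F s in at t within {0<..<1}. \<gamma> s \<in> D" by (rule dev_eventually_in[OF d 3 D(1)])
      have "\<forall>\<^sub>F s in at t within {0<..<1}. s \<in> {0<..<1}" by (simp add: eventually_at_filter)
      with 4 have "\<forall>\<^sub>F s in at t within {0<..<1}. \<delta> s \<in> D" by eventually_elim (simp add: \<delta>)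
      then show ?thesis unfolding at01[OF 3] .
    qed
  qed
  have "\<delta> t \<in> topspace T" if "t \<in> {0..1}" for t
  proof -
    have "t = 0 \<or> t = 1 \<or> t \<in> {0<..<1}" using that by auto
    then show ?thesis using dev_in(1)[OF d, of t] pq Sing_subset \<delta>[of t] unfolding \<delta>_def by auto
  qed
  with ev have path: "pathin T \<delta>"
    unfolding pathin_def continuous_map_within_iff limitin_def by blast
  have reg: "\<delta> t \<notin> Sing" if "0 < t" "t < 1" for t
    using dev_in(2)[OF d, of t] that by (simp add: \<delta>)
  have vel: "((z \<circ> \<delta>) has_vector_derivative c) (at t)"
    if t: "0 < t" "t < 1" and U: "translation_chart X U z" "\<delta> t \<in> U" for t U z
  proof -
    have tI: "t \<in> {0<..<1}" using t by simp
    have "\<gamma> t \<in> U" using U(2) \<delta>[OF t] by simp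
    note ev1 = dev_primitive_local[OF d tI translation_chartD(2)[OF U(1)] this]
    have at: "at t within {0<..<1} = at t" using at_within_open[OF tI open_greaterThanLessThan] .
    from ev1[unfolded at] have 1: "\<forall>\<^sub>F s in at t. z (\<gamma> s) - z (\<gamma> t) = of_real s * c - of_real t * c"
      by eventually_elim simp
    have "\<forall>\<^sub>F s in at t within {0<..<1}. s \<in> {0<..<1}" by (simp add: eventually_at_filter)
    then have 2: "\<forall>\<^sub>F s in at t. s \<in> {0<..<1}" unfolding at .
    from 1 2 have ev: "\<forall>\<^sub>F s in at t. of_real s * c + (z (\<gamma> t) - of_real t * c) = (z \<circ> \<delta>) s"
      by eventually_elim (auto simp: \<delta> algebra_simps)
    have "((\<lambda>s. of_real s * c + (z (\<gamma> t) - of_real t * c)) has_vector_derivative c) (at t)"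
      by (auto intro!: derivative_eq_intros)
    then show ?thesis
      unfolding has_vector_derivative_def
      by (rule has_derivative_transform_eventually[OF _ ev]) (simp_all add: \<delta> t)
  qed
  have "saddle_connection X \<delta>"
    unfolding saddle_connection_def
  proof (intro conjI ballI)
    show "\<delta> 0 \<in> Sing" "\<delta> 1 \<in> Sing" using pq unfolding \<delta>_def by auto
    show "\<exists>c. c \<noteq> 0 \<and> (\<forall>t \<in> {0<..<1}. \<forall>U z. translation_chart X U z \<and> \<delta> t \<in> U \<longrightarrow>
        ((z \<circ> \<delta>) has_vector_derivative c) (at t))"
    proof (intro exI[of _ c] conjI c ballI allI impI)
      fix t :: real and U z assume "t \<in> {0<..<1}" "translation_chart X U z \<and> \<delta> t \<in> U"
      then show "((z \<circ> \<delta>) has_vector_derivative c) (at t)" by (intro vel) auto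
    qed
  qed (use path reg in auto)
  moreover have "path_period X \<delta> = c" by (rule path_period_eq[OF path reg vel])
  ultimately show ?thesis unfolding Hol_def by blast
qed

lemma expo_limit:
  assumes p: "p \<in> Sing" and z: "z \<noteq> 0"
  shows "limitin T (\<lambda>t. expo p (root (cone_angle p) t *\<^sub>R z)) p (at_right 0)"
  unfolding limitin_def
proof (intro conjI allI impI)
  show "p \<in> topspace T" using p Sing_subset by blast
  fix D assume D: "openin T D \<and> p \<in> D"
  define R where "R = cone_radius p"
  have m: "cone_angle p > 0" and R: "R > 0" using cone_atD(1,2)[OF p] unfolding R_def by simp_all
  define g where "g = (\<lambda>t. root (cone_angle p) t *\<^sub>R z)"
  have "continuous_on UNIV g" unfolding g_def by (intro continuous_intros)
  then have "(g \<longlongrightarrow> g 0) (at_right 0)"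
    unfolding continuous_on_def by (meson UNIV_I subset_UNIV tendsto_within_subset)
  then have lim: "(g \<longlongrightarrow> 0) (at_right 0)" unfolding g_def by simp
  have "openin (top_of_set (ball 0 R)) {x \<in> ball 0 R. cone_param p x \<in> D}"
    using cone_atD(6)[OF p] D unfolding continuous_map_def R_def by auto
  then have o: "open {x \<in> ball 0 R. cone_param p x \<in> D}" by (simp add: openin_open_eq)
  have "0 \<in> {x \<in> ball 0 R. cone_param p x \<in> D}" using R cone_atD(3)[OF p] D by simp
  with lim o have 1: "\<forall>\<^sub>F t in at_right 0. g t \<in> {x \<in> ball 0 R. cone_param p x \<in> D}"
    by (rule topological_tendstoD)
  have "\<forall>\<^sub>F t in at_right 0. (0::real) < t" by (simp add: eventually_at_filter)
  with 1 have "\<forall>\<^sub>F t in at_right 0. expo p (g t) \<in> D"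
  proof eventually_elim
    case (elim t)
    have "g t \<noteq> 0" using elim(2) m z unfolding g_def by simp
    then show ?case using elim(1) star_near_0(2)[OF p, of "g t"] unfolding R_def by simp
  qed
  then show "\<forall>\<^sub>F t in at_right 0. expo p (root (cone_angle p) t *\<^sub>R z) \<in> D" unfolding g_def .
qed

text \<open>At the first parameter \<open>b\<close> at which the ray leaves \<open>star p\<close>
  the geodesic still has a limit. A regular limit would put the point at \<open>b\<close> into the
  star; so the limit is a singularity, and the geodesic up to it is a saddle connection.\<close>

lemma star_exit:
  assumes p: "p \<in> Sing" and \<zeta>: "\<zeta> \<noteq> 0" "\<zeta> \<notin> star p"
  obtains \<tau> where "0 < \<tau>" "\<tau> \<le> 1" "(\<tau> *\<^sub>R \<zeta>) ^ cone_angle p \<in> Hol X"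
proof -
  define m where "m = cone_angle p"
  define R where "R = cone_radius p"
  have m: "m > 0" and R: "R > 0" using cone_atD(1,2)[OF p] unfolding m_def R_def by simp_all
  obtain \<tau>1 where \<tau>1: "0 < \<tau>1" "\<tau>1 \<le> 1" "cmod (\<tau>1 *\<^sub>R \<zeta>) < R" by (rule punctured_ray_small[OF R])
  \<comment> \<open>Below \<open>\<tau>1\<close> the ray lies in the cone and so in the star;
    starting there makes the set closed and its infimum positive.\<close>
  define N where "N = {\<tau>1..1} \<inter> (\<lambda>\<tau>. \<tau> *\<^sub>R \<zeta>) -` (- star p)"
  have "closed N" unfolding N_def
    by (intro continuous_closed_preimage continuous_intros closed_Compl star_open p closed_atLeastAtMost)
  moreover have N1: "1 \<in> N" using \<zeta>(2) \<tau>1 unfolding N_def by simp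
  moreover have bdd: "bdd_below N" unfolding N_def by (intro bdd_belowI[of _ \<tau>1]) auto
  ultimately have Inf: "Inf N \<in> N" using closed_contains_Inf by blast
  define b where "b = Inf N"
  have b: "b \<in> N" "0 < b" "b \<le> 1" using Inf \<tau>1 unfolding N_def b_def by auto
  have inside: "\<tau> *\<^sub>R \<zeta> \<in> star p" if \<tau>: "0 < \<tau>" "\<tau> < b" for \<tau>
  proof (cases "\<tau> \<le> \<tau>1")
    case True
    then have "\<tau> * cmod \<zeta> \<le> \<tau>1 * cmod \<zeta>" by (intro mult_right_mono) auto
    then have "\<tau> *\<^sub>R \<zeta> \<in> ball 0 R" using \<tau>1 \<tau> by simp
    then show ?thesis using star_near_0(1)[OF p] \<zeta>(1) \<tau>(1) unfolding R_def by simp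
  next
    case False
    have "\<tau> \<notin> N" using cInf_lower[OF _ bdd, of \<tau>] \<tau>(2) unfolding b_def by force
    then show ?thesis using False \<tau> b(3) unfolding N_def by auto
  qed
  define z0 where "z0 = b *\<^sub>R \<zeta>"
  have z0: "z0 \<noteq> 0" "z0 \<notin> star p" using b \<zeta>(1) unfolding z0_def N_def by auto
  define c where "c = z0 ^ m"
  have c0: "c \<noteq> 0" using z0 unfolding c_def by simp
  define g where "g = (\<lambda>t. root m t *\<^sub>R z0)"
  define \<gamma> where "\<gamma> = (\<lambda>t. expo p (g t))"
  have g_cont: "continuous_on UNIV g" unfolding g_def by (intro continuous_intros)
  have g_pow: "g t ^ m = of_real t * c" if "0 \<le> t" for t
    using root_scaleR_power[OF that m] unfolding g_def c_def .
  have g_star: "g t \<in> star p" if t: "0 < t" "t < 1" for t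
  proof -
    have "root m t < 1" "0 < root m t" using t m by (simp_all add: real_root_lt_1_iff)
    then have "0 < root m t * b" "root m t * b < b" using b by auto
    from inside[OF this] show ?thesis unfolding g_def z0_def by simp
  qed
  have "dev (\<lambda>t. g t ^ m) {0<..<1} \<gamma>"
    unfolding \<gamma>_def m_def
    by (rule dev_compose[OF expo_dev[OF p]]) (use g_star continuous_on_subset[OF g_cont] in auto)
  then have d: "dev (\<lambda>t. of_real t * c) {0<..<1} \<gamma>"
    by (rule dev_cong[where c = 0]) (use g_pow in auto)
  \<comment> \<open>The limit and extension lemmas ask for a left-closed interval; any start inside
    \<open>(0, 1)\<close> would do.\<close>
  have d2: "dev (\<lambda>t. of_real t * c) {1/2..<1} \<gamma>" by (rule dev_subset[OF d]) auto
  have Qc: "continuous_on {1/2..1} (\<lambda>t::real. of_real t * c)" by (intro continuous_intros)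
  obtain y where y: "limitin T \<gamma> y (at_left 1)" by (rule dev_endpoint_limit[OF d2 _ Qc]) auto
  show ?thesis
  proof (cases "y \<in> Sing")
    case True
    have "limitin T \<gamma> p (at_right 0)"
      using expo_limit[OF p z0(1)] unfolding \<gamma>_def g_def m_def .
    from dev_Hol[OF d c0 p True this y] have "c \<in> Hol X" .
    then show ?thesis using that[OF b(2,3)] unfolding c_def z0_def m_def by simp
  next
    case False
    define \<gamma>' where "\<gamma>' = \<gamma>(1 := y)"
    have d3: "dev (\<lambda>t. of_real t * c) {1/2..1} \<gamma>'"
      unfolding \<gamma>'_def by (rule dev_endpoint_extend[OF d2 _ Qc y False]) auto
    have d4: "dev (\<lambda>t. of_real t * c) {0<..1} \<gamma>'"
    proof (rule dev_local)
      fix t :: real assume t: "t \<in> {0<..1}"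
      show "\<exists>D F'. open D \<and> t \<in> D \<and> dev (\<lambda>t. of_real t * c) ({0<..1} \<inter> D) F' \<and> (\<forall>y\<in>{0<..1} \<inter> D. \<gamma>' y = F' y)"
      proof (cases "t < 1")
        case True
        have "dev (\<lambda>t. of_real t * c) ({0<..1} \<inter> {..<1}) \<gamma>" by (rule dev_subset[OF d]) auto
        then show ?thesis using True
          by (intro exI[of _ "{..<1}"] exI[of _ \<gamma>]) (auto simp: \<gamma>'_def)
      next
        case False
        have "dev (\<lambda>t. of_real t * c) ({0<..1} \<inter> {1/2<..}) \<gamma>'" by (rule dev_subset[OF d3]) auto
        then show ?thesis using False t
          by (intro exI[of _ "{1/2<..}"] exI[of _ \<gamma>']) auto
      qed
    qed
    \<comment> \<open>\<open>h\<close> inverts \<open>g\<close> on the ray: it gives the time at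
      which the geodesic of constant velocity reaches the point \<open>x\<close>.\<close>
    define h where "h = (\<lambda>x. (cmod x / cmod z0) ^ m)"
    have h: "h (\<tau> *\<^sub>R z0) = \<tau> ^ m" if "0 < \<tau>" for \<tau> using that z0(1) unfolding h_def by simp
    have h_in: "h x \<in> {0<..1}" if xr: "x \<in> punctured_ray z0" for x
    proof -
      obtain \<tau> where \<tau>: "x = \<tau> *\<^sub>R z0" "0 < \<tau>" "\<tau> \<le> 1" using xr by (rule punctured_rayE)
      show ?thesis using \<tau> h by (simp add: power_le_one)
    qed
    have "continuous_on (punctured_ray z0) h" unfolding h_def using z0(1) by (intro continuous_intros) auto
    then have d5: "dev (\<lambda>x. of_real (h x) * c) (punctured_ray z0) (\<lambda>x. \<gamma>' (h x))"
      by (rule dev_compose[OF d4]) (use h_in in auto)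
    have "ray p z0 (\<lambda>x. \<gamma>' (h x))"
      unfolding ray_def
    proof (intro conjI)
      show "dev (\<lambda>x. x ^ cone_angle p) (punctured_ray z0) (\<lambda>x. \<gamma>' (h x))"
      proof (rule dev_cong[OF d5, where c = 0])
        fix x assume "x \<in> punctured_ray z0"
        then obtain \<tau> where \<tau>: "x = \<tau> *\<^sub>R z0" "0 < \<tau>" "\<tau> \<le> 1" by (rule punctured_rayE)
        show "x ^ cone_angle p = of_real (h x) * c + 0"
          using h[OF \<tau>(2)] unfolding \<tau>(1) c_def m_def
          by (simp add: scaleR_conv_of_real power_mult_distrib)
      qed simp
      show "\<exists>\<delta>>0. \<forall>x\<in>punctured_ray z0. cmod x < \<delta> \<longrightarrow> \<gamma>' (h x) = cone_param p x"
      proof (intro exI[of _ "min R (cmod z0)"] conjI ballI impI)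
        show "0 < min R (cmod z0)" using R z0 by simp
        fix x assume x: "x \<in> punctured_ray z0" "cmod x < min R (cmod z0)"
        then obtain \<tau> where \<tau>: "x = \<tau> *\<^sub>R z0" "0 < \<tau>" "\<tau> \<le> 1" by (metis punctured_rayE)
        have "\<tau> \<noteq> 1" using x(2) \<tau>(1) by auto
        then have "\<tau> < 1" using \<tau>(3) by simp
        then have "\<tau> ^ m < 1" using \<tau>(2) m by (simp add: power_less_one_iff)
        then have "\<gamma>' (h x) = expo p (g (\<tau> ^ m))" using h[OF \<tau>(2)] \<tau>(1) unfolding \<gamma>'_def \<gamma>_def by simp
        also have "g (\<tau> ^ m) = x" unfolding g_def \<tau>(1) using \<tau>(2) m by (simp add: real_root_power_cancel)
        also have "expo p x = cone_param p x"
          using star_near_0(2)[OF p, of x] x(2) \<tau> z0(1) unfolding R_def by simp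
        finally show "\<gamma>' (h x) = cone_param p x" .
      qed
    qed
    then have "z0 \<in> star p" using ray_star[OF _ z0(1) punctured_ray_self] by blast
    then show ?thesis using z0(2) by blast
  qed
qed

text \<open>A saddle connection starts out inside the cone of its first endpoint, where it is a
  straight ray in the cone coordinate; \<open>\<zeta>\<close> is the point that this ray would reach
  at time 1.\<close>

lemma Hol_not_star:
  assumes "v \<in> Hol X"
  obtains p \<zeta> where "p \<in> Sing" "\<zeta> \<noteq> 0" "\<zeta> \<notin> star p" "\<zeta> ^ cone_angle p = v"
proof -
  obtain \<gamma> where \<gamma>: "pathin T \<gamma>" "\<gamma> 0 \<in> Sing" "\<gamma> 1 \<in> Sing" "v \<noteq> 0"
    "dev (\<lambda>t. of_real t * v) {0<..<1} \<gamma>" using saddle_connectionD[OF assms] .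
  define p where "p = \<gamma> 0"
  have p: "p \<in> Sing" using \<gamma>(2) unfolding p_def .
  define m where "m = cone_angle p"
  define R where "R = cone_radius p"
  define e where "e = cone_param p"
  have c: "cone p m R e" using cone_at[OF p] unfolding m_def R_def e_def .
  note cd = coneD[OF c]
  have cont: "continuous_map (top_of_set {0..1}) T \<gamma>" using \<gamma>(1) unfolding pathin_def .
  then have lim: "limitin T \<gamma> (\<gamma> t) (at t within {0..1})" if "t \<in> {0..1}" for t
    using that unfolding continuous_map_within_iff by blast
  have lim0: "limitin T \<gamma> p (at_right 0)" using lim[of 0] unfolding p_def by (simp add: at_within_Icc_at_right)
  have lim1: "limitin T \<gamma> (\<gamma> 1) (at_left 1)" using lim[of 1] by (simp add: at_within_Icc_at_left)
  define B where "B = e ` ball 0 R"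
  define P where "P = (\<lambda>q. inv_into (ball 0 R) e q ^ m)"
  have P: "primitive_on B P" using cd(8) unfolding B_def P_def .
  have pB: "p \<in> B" unfolding B_def using cd(2,3) by (intro image_eqI[of _ _ 0]) auto
  have "\<forall>\<^sub>F t in at_right 0. \<gamma> t \<in> B" using lim0 pB primitive_on_openin[OF P] unfolding limitin_def by blast
  then obtain t0 where t0: "t0 > 0" "\<And>t. 0 < t \<Longrightarrow> t < t0 \<Longrightarrow> \<gamma> t \<in> B"
    unfolding eventually_at_right[OF zero_less_one] by blast
  define t1 where "t1 = min (1/2) (t0 / 2)"
  have t1: "0 < t1" "t1 < 1" "t1 < t0" using t0(1) unfolding t1_def by auto
  have "dev (\<lambda>t. of_real t * v) {0<..t1} \<gamma>" by (rule dev_subset[OF \<gamma>(5)]) (use t1 in auto)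
  then obtain k where k: "\<And>t. t \<in> {0<..t1} \<Longrightarrow> P (\<gamma> t) = of_real t * v + k"
    by (rule dev_primitive[OF _ P connected_Ioc]) (use t0 t1 in auto)
  \<comment> \<open>Letting \<open>t\<close> tend to 0 identifies the constant \<open>k\<close>:
    since \<open>P p = 0\<close>, the developed value of \<open>\<gamma> t\<close> is
    \<open>t * v\<close> without an offset.\<close>
  have "((\<lambda>t. P (\<gamma> t)) \<longlongrightarrow> P p) (at_right 0)" by (rule primitive_tendsto[OF P pB lim0])
  moreover have "((\<lambda>t. P (\<gamma> t)) \<longlongrightarrow> of_real 0 * v + k) (at_right 0)"
  proof (rule Lim_transform_eventually)
    show "((\<lambda>t. of_real t * v + k) \<longlongrightarrow> of_real 0 * v + k) (at_right 0)" by (intro tendsto_intros)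
    show "\<forall>\<^sub>F t in at_right 0. of_real t * v + k = P (\<gamma> t)"
      unfolding eventually_at_right[OF zero_less_one] using k t1 by (intro exI[of _ t1]) auto
  qed
  ultimately have "P p = of_real 0 * v + k" using tendsto_unique trivial_limit_at_right_real by blast
  moreover have "P p = 0" using cd(11)[of 0] cd(1-3) unfolding P_def by simp
  ultimately have k0: "k = 0" by simp
  have "\<gamma> t1 \<in> e ` ball 0 R" using t0(2) t1 unfolding B_def by simp
  then obtain \<xi> where \<xi>: "\<xi> \<in> ball 0 R" "\<gamma> t1 = e \<xi>" by blast
  have \<xi>m: "\<xi> ^ m = of_real t1 * v" using k[of t1] t1 k0 cd(11)[OF \<xi>(1)] unfolding P_def \<xi>(2) by simp
  have \<xi>0: "\<xi> \<noteq> 0" using \<xi>m t1 \<gamma>(4) cd(1) by (metis mult_eq_0_iff of_real_eq_0_iff order_less_irrefl power_0_left not_gr0)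
  define s where "s = root m t1"
  have s: "0 < s" "s < 1" "s ^ m = t1" using t1 cd(1) unfolding s_def by (simp_all add: real_root_lt_1_iff)
  define \<zeta> where "\<zeta> = inverse s *\<^sub>R \<xi>"
  have \<zeta>m: "\<zeta> ^ m = v" unfolding \<zeta>_def scaleR_power \<xi>m using s t1 
    by (simp add: power_inverse scaleR_conv_of_real)
  have \<zeta>0: "\<zeta> \<noteq> 0" using \<xi>0 s unfolding \<zeta>_def by simp
  \<comment> \<open>Otherwise the ray to \<open>\<zeta>\<close> would coincide with
    \<open>\<gamma>\<close> on the open interval, as both pass through the same point at
    \<open>t1\<close>. Their limits at 1 would agree, although one is regular and the other is a
    singularity.\<close>
  have "\<zeta> \<notin> star p"
  proof
    assume st: "\<zeta> \<in> star p"
    define \<alpha> where "\<alpha> = (\<lambda>t. expo p (root m t *\<^sub>R \<zeta>))"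
    have gs: "root m t *\<^sub>R \<zeta> \<in> star p" if "0 < t" "t \<le> 1" for t
      by (rule star_ray[OF st punctured_ray_scale]) (use that cd(1) in auto)
    have gc: "continuous_on {0<..1} (\<lambda>t. root m t *\<^sub>R \<zeta>)" by (intro continuous_intros)
    have "dev (\<lambda>t. (root m t *\<^sub>R \<zeta>) ^ m) {0<..1} \<alpha>"
      unfolding \<alpha>_def m_def
      by (rule dev_compose[OF expo_dev[OF p]]) (use gs gc in \<open>auto simp: m_def\<close>)
    then have d\<alpha>: "dev (\<lambda>t. of_real t * v) {0<..1} \<alpha>"
      by (rule dev_cong[where c = 0]) (use cd(1) \<zeta>m root_scaleR_power[of _ m \<zeta>] in auto)
    then have d\<alpha>': "dev (\<lambda>t. of_real t * v) {0<..<1} \<alpha>" by (rule dev_subset) auto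
    have "\<alpha> t1 = expo p \<xi>" unfolding \<alpha>_def \<zeta>_def s_def[symmetric] using s by simp
    also have "\<dots> = e \<xi>" using star_near_0(2)[OF p, of \<xi>] \<xi>(1) \<xi>0 unfolding R_def e_def by simp
    finally have at1: "\<alpha> t1 = \<gamma> t1" using \<xi>(2) by simp
    have eq: "\<alpha> t = \<gamma> t" if "t \<in> {0<..<1}" for t
      by (rule dev_unique[OF d\<alpha>' \<gamma>(5) connected_Ioo _ at1 that]) (use t1 in auto)
    have "limitin T \<alpha> (\<alpha> 1) (at_left 1)"
    proof -
      have at: "at 1 within {0<..1} = at_left (1::real)"
        by (rule at_within_nhd[of 1 "{0<..}"]) auto
      show ?thesis
        unfolding limitin_def using dev_in(1)[OF d\<alpha>, of 1] dev_eventually_in[OF d\<alpha>, of 1] unfolding at by auto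
    qed
    moreover have "limitin T \<alpha> (\<gamma> 1) (at_left 1)"
    proof (rule limitin_transform_eventually[OF _ lim1])
      have "\<forall>\<^sub>F t in at_left 1. t \<in> {0<..<1::real}" by (rule eventually_at_left_real) simp
      then show "\<forall>\<^sub>F t in at_left 1. \<gamma> t = \<alpha> t" by eventually_elim (simp add: eq)
    qed
    ultimately have "\<alpha> 1 = \<gamma> 1"
      using limitin_Hausdorff_unique[OF _ _ trivial_limit_at_left_real Hausdorff] by blast
    then show False using dev_in(2)[OF d\<alpha>, of 1] \<gamma>(3) by simp
  qed
  then show ?thesis using that[OF p \<zeta>0] \<zeta>m unfolding m_def by blast
qed

section \<open>Lower bounds for periods\<close>

lemma not_star_radius:
  assumes "p \<in> Sing" "\<zeta> \<noteq> 0" "\<zeta> \<notin> star p"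
  shows "cone_radius p \<le> cmod \<zeta>"
  using star_near_0(1)[OF assms(1) _ assms(2)] assms(3) by (force simp: not_less[symmetric])

text \<open>A nonzero vector outside the star is at least as long as the radius of its cone. The
  bound serves to show that the area is positive.\<close>

lemma Hol_bounded_below:
  obtains r where "r > 0" "\<And>v. v \<in> Hol X \<Longrightarrow> r \<le> cmod v"
proof -
  define f where "f = (\<lambda>p. cone_radius p ^ cone_angle p)"
  define r where "r = Min (insert 1 (f ` Sing))"
  have fin: "finite (insert 1 (f ` Sing))" using finite_Sing by simp
  have "r > 0" unfolding r_def using fin cone_atD(2) by (subst Min_gr_iff) (auto simp: f_def)
  moreover have "r \<le> cmod v" if v: "v \<in> Hol X" for v
  proof -
    obtain p \<zeta> where p: "p \<in> Sing" "\<zeta> \<noteq> 0" "\<zeta> \<notin> star p" "\<zeta> ^ cone_angle p = v" using Hol_not_star[OF v] .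
    have "r \<le> f p" unfolding r_def using fin p(1) by (intro Min_le) auto
    also have "\<dots> \<le> cmod \<zeta> ^ cone_angle p"
      unfolding f_def using not_star_radius[OF p(1-3)] cone_atD(2)[OF p(1)] by (intro power_mono) auto
    also have "\<dots> = cmod v" using p(4) by (simp add: norm_power[symmetric])
    finally show ?thesis .
  qed
  ultimately show ?thesis by (rule that)
qed

text \<open>
  The vectors outside \<open>star p\<close> of bounded length form a compact set on which the horizontal component
  does not vanish, since a vertical one would give a vertical saddle connection.
\<close>

lemma Hol_strip:
  assumes nv: "\<And>v. v \<in> Hol X \<Longrightarrow> Re v \<noteq> 0"
  obtains \<epsilon> where "\<epsilon> > 0" "\<And>v. v \<in> Hol X \<Longrightarrow> \<bar>Im v\<bar> \<le> B \<Longrightarrow> \<epsilon> \<le> \<bar>Re v\<bar>"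
proof -
  \<comment> \<open>The lower bound on the modulus discards \<open>\<zeta> = 0\<close>, which is
    outside the star and has real part 0. The bound \<open>B + 1\<close> is what
    \<open>\<bar>Im v\<bar> \<le> B\<close> and \<open>\<bar>Re v\<bar> \<le> 1\<close> give for
    \<open>cmod v\<close>.\<close>
  define A where "A = (\<lambda>p. - star p \<inter> {\<zeta>. cone_radius p \<le> cmod \<zeta>} \<inter> {\<zeta>. cmod (\<zeta> ^ cone_angle p) \<le> B + 1})"
  have ex: "\<exists>\<epsilon>>0. \<forall>\<zeta>\<in>A p. \<epsilon> \<le> \<bar>Re (\<zeta> ^ cone_angle p)\<bar>" if p: "p \<in> Sing" for p
  proof (cases "A p = {}")
    case False
    have "closed (A p)" unfolding A_def
      by (intro closed_Int closed_Compl star_open p closed_Collect_le continuous_intros)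
    moreover have "A p \<subseteq> cball 0 (max 1 (B + 1))"
    proof
      fix \<zeta> assume "\<zeta> \<in> A p"
      then have le: "cmod \<zeta> ^ cone_angle p \<le> B + 1" unfolding A_def by (simp add: norm_power)
      show "\<zeta> \<in> cball 0 (max 1 (B + 1))"
      proof (cases "cmod \<zeta> \<le> 1")
        case False
        then have "cmod \<zeta> ^ 1 \<le> cmod \<zeta> ^ cone_angle p"
          using cone_atD(1)[OF p] by (intro power_increasing) auto
        then show ?thesis using le by simp
      qed simp
    qed
    ultimately have "compact (A p)" using bounded_subset[OF bounded_cball] compact_eq_bounded_closed by blast
    moreover have "continuous_on (A p) (\<lambda>\<zeta>. \<bar>Re (\<zeta> ^ cone_angle p)\<bar>)" by (intro continuous_intros)
    ultimately obtain \<zeta> where \<zeta>: "\<zeta> \<in> A p" "\<forall>\<xi>\<in>A p. \<bar>Re (\<zeta> ^ cone_angle p)\<bar> \<le> \<bar>Re (\<xi> ^ cone_angle p)\<bar>"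
      using continuous_attains_inf[OF _ False] by metis
    have \<zeta>0: "\<zeta> \<noteq> 0" "\<zeta> \<notin> star p" using \<zeta>(1) cone_atD(2)[OF p] unfolding A_def by auto
    \<comment> \<open>The minimiser \<open>\<zeta>\<close> need not yield a period, but a positive
      multiple of its power is one, and a zero real part would be inherited by the multiple.\<close>
    obtain \<tau> where \<tau>: "0 < \<tau>" "(\<tau> *\<^sub>R \<zeta>) ^ cone_angle p \<in> Hol X" using star_exit[OF p \<zeta>0] by metis
    have "Re ((\<tau> *\<^sub>R \<zeta>) ^ cone_angle p) = \<tau> ^ cone_angle p * Re (\<zeta> ^ cone_angle p)"
      by (simp add: scaleR_power)
    then have "Re (\<zeta> ^ cone_angle p) \<noteq> 0" using nv[OF \<tau>(2)] by auto
    then show ?thesis using \<zeta>(2) by (intro exI[of _ "\<bar>Re (\<zeta> ^ cone_angle p)\<bar>"]) simp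
  qed (use zero_less_one in blast)
  then obtain f where f: "\<And>p. p \<in> Sing \<Longrightarrow> f p > 0"
      "\<And>p \<zeta>. p \<in> Sing \<Longrightarrow> \<zeta> \<in> A p \<Longrightarrow> f p \<le> \<bar>Re (\<zeta> ^ cone_angle p)\<bar>" by metis
  \<comment> \<open>The entry 1 takes care of the periods with
    \<open>\<bar>Re v\<bar> > 1\<close>.\<close>
  define \<epsilon> where "\<epsilon> = Min (insert 1 (f ` Sing))"
  have fin: "finite (insert 1 (f ` Sing))" using finite_Sing by simp
  have "\<epsilon> > 0" unfolding \<epsilon>_def using fin f(1) by (subst Min_gr_iff) auto
  moreover have "\<epsilon> \<le> \<bar>Re v\<bar>" if v: "v \<in> Hol X" "\<bar>Im v\<bar> \<le> B" for v
  proof (cases "\<bar>Re v\<bar> \<le> 1")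
    case True
    obtain p \<zeta> where p: "p \<in> Sing" "\<zeta> \<noteq> 0" "\<zeta> \<notin> star p" "\<zeta> ^ cone_angle p = v" using Hol_not_star[OF v(1)] .
    have "cmod v \<le> B + 1" using cmod_le[of v] True v(2) by linarith
    then have "\<zeta> \<in> A p" unfolding A_def using p not_star_radius[OF p(1-3)] by simp
    then have "f p \<le> \<bar>Re v\<bar>" using f(2)[OF p(1)] p(4) by blast
    moreover have "\<epsilon> \<le> f p" unfolding \<epsilon>_def using fin p(1) by (intro Min_le) auto
    ultimately show ?thesis by simp
  next
    case False
    have "\<epsilon> \<le> 1" unfolding \<epsilon>_def using fin by (intro Min_le) auto
    then show ?thesis using False by simp
  qed
  ultimately show ?thesis by (rule that)
qed

section \<open>Packing\<close>

text \<open>If the ray were stopped before or at \<open>\<zeta>\<close>, the piece traversed would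
  yield a period of no larger norm, since the stretch commutes with scaling.\<close>

lemma short_star:
  assumes p: "p \<in> Sing" and short: "\<And>v. v \<in> Hol X \<Longrightarrow> s \<le> cmod (stretch t v)"
    and \<zeta>: "\<zeta> \<noteq> 0" "cmod (stretch t (\<zeta> ^ cone_angle p)) < s"
  shows "\<zeta> \<in> star p"
proof (rule ccontr)
  assume "\<zeta> \<notin> star p"
  then obtain \<tau> where \<tau>: "0 < \<tau>" "\<tau> \<le> 1" "(\<tau> *\<^sub>R \<zeta>) ^ cone_angle p \<in> Hol X"
    by (rule star_exit[OF p \<zeta>(1)])
  have "s \<le> cmod (stretch t ((\<tau> *\<^sub>R \<zeta>) ^ cone_angle p))" by (rule short[OF \<tau>(3)])
  also have "\<dots> = \<tau> ^ cone_angle p * cmod (stretch t (\<zeta> ^ cone_angle p))"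
    using \<tau>(1) unfolding scaleR_power stretch_scaleR by simp
  also have "\<dots> \<le> 1 * cmod (stretch t (\<zeta> ^ cone_angle p))"
    using \<tau> by (intro mult_right_mono power_le_one) auto
  finally show False using \<zeta>(2) by simp
qed

lemma dev_right_limit:
  assumes "dev Q {0..1} F"
  shows "limitin T F (F 0) (at_right (0::real))"
  unfolding limitin_def
  using dev_in(1)[OF assms, of 0] dev_eventually_in[OF assms, of 0] at_within_Icc_at_right[of 0 "1::real"] by auto

lemma expo_ray_dev:
  assumes p: "p \<in> Sing" and z: "z \<in> star p"
  shows "dev (\<lambda>t. of_real t * z ^ cone_angle p) {0<..1} (\<lambda>t. expo p (root (cone_angle p) t *\<^sub>R z))"
proof -
  have m: "cone_angle p > 0" using cone_atD(1)[OF p] .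
  have "dev (\<lambda>t. (root (cone_angle p) t *\<^sub>R z) ^ cone_angle p) {0<..1} (\<lambda>t. expo p (root (cone_angle p) t *\<^sub>R z))"
  proof (rule dev_compose[OF expo_dev[OF p]])
    show "continuous_on {0<..1} (\<lambda>t. root (cone_angle p) t *\<^sub>R z)" by (intro continuous_intros)
    show "(\<lambda>t. root (cone_angle p) t *\<^sub>R z) ` {0<..1} \<subseteq> star p"
      using m by (auto intro!: star_ray[OF z] punctured_ray_scale)
  qed
  then show ?thesis by (rule dev_cong[where c = 0]) (use root_scaleR_power[OF _ m] in auto)
qed

text \<open>
  Otherwise the segment from \<open>x = \<zeta> ^ m\<close> to \<open>x - y\<close> misses the cut opposite to \<open>x\<close>, hence lifts to
  a geodesic inside the embedded star of \<open>p\<close>; it retraces the segment from \<open>q\<close> and ends in \<open>q\<close>,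
  whereas the star contains no singularity.
\<close>

lemma expo_meet_collinear:
  assumes p: "p \<in> Sing" and q: "q \<in> Sing" and short: "\<And>v. v \<in> Hol X \<Longrightarrow> s \<le> cmod (stretch t v)"
    and \<zeta>: "\<zeta> \<noteq> 0" "cmod (stretch t (\<zeta> ^ cone_angle p)) < s / 2"
    and \<xi>: "\<xi> \<noteq> 0" "cmod (stretch t (\<xi> ^ cone_angle q)) < s / 2"
    and eq: "expo p \<zeta> = expo q \<xi>"
  obtains c where "c \<ge> 1" "\<xi> ^ cone_angle q = c *\<^sub>R \<zeta> ^ cone_angle p"
proof -
  define x where "x = \<zeta> ^ cone_angle p"
  define y where "y = \<xi> ^ cone_angle q"
  define m where "m = cone_angle p"
  have m: "m > 0" using cone_atD(1)[OF p] unfolding m_def .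
  have x0: "x \<noteq> 0" using \<zeta>(1) unfolding x_def by simp
  have s: "s > 0" using \<zeta>(2) norm_ge_zero[of "stretch t (\<zeta> ^ cone_angle p)"] by linarith
  have ss: "cmod (stretch t x) < s / 2" "cmod (stretch t y) < s / 2" using \<zeta>(2) \<xi>(2) unfolding x_def y_def by simp_all
  have "\<exists>c\<ge>1. y = c *\<^sub>R x"
  proof (rule ccontr)
    assume no: "\<not> ?thesis"
    \<comment> \<open>\<open>x * u \<tau>\<close> runs along the segment from \<open>x - y\<close>
      to \<open>x\<close>, and \<open>u \<tau>\<close> lies on the cut of \<open>Ln\<close> only if
      \<open>y\<close> is a multiple of \<open>x\<close> by a factor at least 1, the excluded
      case.\<close>
    define u where "u = (\<lambda>\<tau>::real. 1 - (1 - \<tau>) *\<^sub>R (y / x))"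
    have xu: "x * u \<tau> = x - (1 - \<tau>) *\<^sub>R y" for \<tau>
      using x0 unfolding u_def by (simp add: algebra_simps)
    have u: "u \<tau> \<notin> \<real>\<^sub>\<le>\<^sub>0" if \<tau>: "\<tau> \<in> {0..1}" for \<tau>
    proof
      assume "u \<tau> \<in> \<real>\<^sub>\<le>\<^sub>0"
      then obtain r where r: "u \<tau> = of_real r" "r \<le> 0" by (auto elim: nonpos_Reals_cases)
      have "(1 - \<tau>) *\<^sub>R y = x - x * u \<tau>" unfolding xu by simp
      also have "\<dots> = (1 - r) *\<^sub>R x" unfolding r(1) by (simp add: scaleR_conv_of_real algebra_simps)
      finally have e: "(1 - \<tau>) *\<^sub>R y = (1 - r) *\<^sub>R x" .
      have "(1 - r) *\<^sub>R x \<noteq> 0" using r(2) x0 by simp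
      then have \<tau>1: "1 - \<tau> \<noteq> 0" using e by auto
      have "y = (1 / (1 - \<tau>)) *\<^sub>R ((1 - \<tau>) *\<^sub>R y)" using \<tau>1 by simp
      then have "y = ((1 - r) / (1 - \<tau>)) *\<^sub>R x" unfolding e by simp
      moreover have "(1 - r) / (1 - \<tau>) \<ge> 1" using \<tau> \<tau>1 r(2) by simp
      ultimately show False using no by blast
    qed
    \<comment> \<open>The principal root lifts the segment to the cone coordinate at
      \<open>p\<close>; at \<open>\<tau> = 1\<close>, where \<open>u\<close> is 1, the lift is at
      \<open>\<zeta>\<close>.\<close>
    define g where "g = (\<lambda>\<tau>. \<zeta> * exp (Ln (u \<tau>) / of_nat m))"
    have gm: "g \<tau> ^ m = x - (1 - \<tau>) *\<^sub>R y" if \<tau>: "\<tau> \<in> {0..1}" for \<tau>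
    proof -
      have "u \<tau> \<noteq> 0" using u[OF \<tau>] by auto
      then have "exp (Ln (u \<tau>) / of_nat m) ^ m = u \<tau>" using m by (simp add: exp_divide_power_eq)
      then have "g \<tau> ^ m = x * u \<tau>" unfolding g_def x_def m_def by (simp add: power_mult_distrib)
      then show ?thesis unfolding xu .
    qed
    have g_star: "g \<tau> \<in> star p" if \<tau>: "\<tau> \<in> {0..1}" for \<tau>
    proof (rule short_star[OF p short])
      show "g \<tau> \<noteq> 0" using \<zeta>(1) unfolding g_def by simp
      have "stretch t (x - (1 - \<tau>) *\<^sub>R y) = stretch t x - (1 - \<tau>) *\<^sub>R stretch t y"
        unfolding stretch_diff stretch_scaleR ..
      then have "cmod (stretch t (x - (1 - \<tau>) *\<^sub>R y)) \<le> cmod (stretch t x) + (1 - \<tau>) * cmod (stretch t y)"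
        using norm_triangle_ineq4[of "stretch t x" "(1 - \<tau>) *\<^sub>R stretch t y"] \<tau> by simp
      also have "(1 - \<tau>) * cmod (stretch t y) \<le> 1 * cmod (stretch t y)" using \<tau> by (intro mult_right_mono) auto
      finally show "cmod (stretch t (g \<tau> ^ cone_angle p)) < s" using gm[OF \<tau>] ss unfolding m_def by simp
    qed
    have g_cont: "continuous_on {0..1} g"
      unfolding g_def by (intro continuous_intros u) (use m in \<open>auto simp: u_def intro!: continuous_intros\<close>)
    define \<alpha> where "\<alpha> = (\<lambda>\<tau>. expo p (g \<tau>))"
    have "dev (\<lambda>\<tau>. g \<tau> ^ m) {0..1} \<alpha>"
      unfolding \<alpha>_def m_def by (rule dev_compose[OF expo_dev[OF p] g_cont]) (use g_star in auto)
    \<comment> \<open>Since \<open>x - (1 - \<tau>) * y\<close> differs from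
      \<open>\<tau> * y\<close> by a constant, \<open>\<alpha>\<close> is comparable with the
      geodesic from \<open>q\<close>. In contrast to that one it is regular at time 0 too.\<close>
    then have d\<alpha>: "dev (\<lambda>\<tau>. of_real \<tau> * y) {0..1} \<alpha>"
      by (rule dev_cong[where c = "y - x"]) (use gm in \<open>auto simp: scaleR_conv_of_real algebra_simps\<close>)
    have d\<alpha>': "dev (\<lambda>\<tau>. of_real \<tau> * y) {0<..1} \<alpha>" by (rule dev_subset[OF d\<alpha>]) auto
    define \<beta> where "\<beta> = (\<lambda>\<tau>. expo q (root (cone_angle q) \<tau> *\<^sub>R \<xi>))"
    have "\<xi> \<in> star q" by (rule short_star[OF q short \<xi>(1)]) (use \<xi>(2) s in auto)
    then have d\<beta>: "dev (\<lambda>\<tau>. of_real \<tau> * y) {0<..1} \<beta>"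
      unfolding \<beta>_def y_def by (rule expo_ray_dev[OF q])
    have eq1: "\<alpha> 1 = \<beta> 1"
      using eq cone_atD(1)[OF q] unfolding \<alpha>_def \<beta>_def g_def u_def by simp
    have same: "\<alpha> \<tau> = \<beta> \<tau>" if "\<tau> \<in> {0<..1}" for \<tau>
      by (rule dev_unique[OF d\<alpha>' d\<beta> connected_Ioc _ eq1 that]) simp
    have "limitin T \<beta> q (at_right 0)" unfolding \<beta>_def by (rule expo_limit[OF q \<xi>(1)])
    then have "limitin T \<alpha> q (at_right 0)"
    proof (rule limitin_transform_eventually[rotated])
      have "\<forall>\<^sub>F \<tau> in at_right 0. \<tau> \<in> {0<..1::real}"
        unfolding eventually_at_right[OF zero_less_one] by (intro exI[of _ 1]) auto
      then show "\<forall>\<^sub>F \<tau> in at_right 0. \<beta> \<tau> = \<alpha> \<tau>" by eventually_elim (simp add: same)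
    qed
    then have "\<alpha> 0 = q"
      using limitin_Hausdorff_unique[OF dev_right_limit[OF d\<alpha>] _ trivial_limit_at_right_real Hausdorff] by blast
    then show False using dev_in(2)[OF d\<alpha>, of 0] q by simp
  qed
  then obtain c where "c \<ge> 1" "y = c *\<^sub>R x" by (elim exE conjE)
  then show ?thesis unfolding x_def y_def by (rule that)
qed

text \<open>Collinearity holds in both directions, and two factors at least 1 with product 1 are
  both 1, so the periods agree. Following the two geodesics back to time 0 gives
  \<open>p = q\<close>, and close to \<open>p\<close> the injectivity of \<open>cone_param\<close>
  decides.\<close>

lemma expo_inj:
  assumes p: "p \<in> Sing" and q: "q \<in> Sing" and short: "\<And>v. v \<in> Hol X \<Longrightarrow> s \<le> cmod (stretch t v)"
    and \<zeta>: "\<zeta> \<noteq> 0" "cmod (stretch t (\<zeta> ^ cone_angle p)) < s / 2"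
    and \<xi>: "\<xi> \<noteq> 0" "cmod (stretch t (\<xi> ^ cone_angle q)) < s / 2"
    and eq: "expo p \<zeta> = expo q \<xi>"
  shows "p = q \<and> \<zeta> = \<xi>"
proof -
  define x where "x = \<zeta> ^ cone_angle p"
  have x0: "x \<noteq> 0" using \<zeta>(1) unfolding x_def by simp
  have s: "s > 0" using \<zeta>(2) norm_ge_zero[of "stretch t (\<zeta> ^ cone_angle p)"] by linarith
  obtain c where c: "c \<ge> 1" "\<xi> ^ cone_angle q = c *\<^sub>R \<zeta> ^ cone_angle p"
    by (rule expo_meet_collinear[OF p q short \<zeta> \<xi> eq])
  obtain c' where c': "c' \<ge> 1" "\<zeta> ^ cone_angle p = c' *\<^sub>R \<xi> ^ cone_angle q"
    by (rule expo_meet_collinear[OF q p short \<xi> \<zeta> eq[symmetric]])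
  have "x = c' *\<^sub>R \<xi> ^ cone_angle q" using c'(2) unfolding x_def .
  also have "\<xi> ^ cone_angle q = c *\<^sub>R x" using c(2) unfolding x_def .
  finally have "x = (c' * c) *\<^sub>R x" by simp
  then have "(c' * c - 1) *\<^sub>R x = 0" by (simp add: scaleR_diff_left)
  then have "c' * c = 1" using x0 by simp
  moreover have "c \<le> c' * c" using mult_right_mono[OF c'(1), of c] c(1) by simp
  ultimately have "c = 1" using c(1) by linarith
  then have xy: "\<xi> ^ cone_angle q = x" using c(2) unfolding x_def by simp
  define \<alpha> where "\<alpha> = (\<lambda>\<tau>. expo p (root (cone_angle p) \<tau> *\<^sub>R \<zeta>))"
  define \<beta> where "\<beta> = (\<lambda>\<tau>. expo q (root (cone_angle q) \<tau> *\<^sub>R \<xi>))"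
  have "\<zeta> \<in> star p" by (rule short_star[OF p short \<zeta>(1)]) (use \<zeta>(2) s in auto)
  then have d\<alpha>: "dev (\<lambda>\<tau>. of_real \<tau> * x) {0<..1} \<alpha>"
    unfolding \<alpha>_def x_def by (rule expo_ray_dev[OF p])
  have "\<xi> \<in> star q" by (rule short_star[OF q short \<xi>(1)]) (use \<xi>(2) s in auto)
  then have d\<beta>: "dev (\<lambda>\<tau>. of_real \<tau> * x) {0<..1} \<beta>"
    unfolding \<beta>_def xy[symmetric] by (rule expo_ray_dev[OF q])
  have eq1: "\<alpha> 1 = \<beta> 1" using eq cone_atD(1)[OF p] cone_atD(1)[OF q] unfolding \<alpha>_def \<beta>_def by simp
  have same: "\<alpha> \<tau> = \<beta> \<tau>" if "\<tau> \<in> {0<..1}" for \<tau>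
    by (rule dev_unique[OF d\<alpha> d\<beta> connected_Ioc _ eq1 that]) simp
  have ev01: "\<forall>\<^sub>F \<tau> in at_right 0. \<tau> \<in> {0<..1::real}"
    unfolding eventually_at_right[OF zero_less_one] by (intro exI[of _ 1]) auto
  have "limitin T \<alpha> p (at_right 0)" unfolding \<alpha>_def by (rule expo_limit[OF p \<zeta>(1)])
  moreover have "limitin T \<beta> q (at_right 0)" unfolding \<beta>_def by (rule expo_limit[OF q \<xi>(1)])
  then have "limitin T \<alpha> q (at_right 0)"
  proof (rule limitin_transform_eventually[rotated])
    show "\<forall>\<^sub>F \<tau> in at_right 0. \<beta> \<tau> = \<alpha> \<tau>" using ev01 by eventually_elim (simp add: same)
  qed
  ultimately have pq: "p = q"
    using limitin_Hausdorff_unique[OF _ _ trivial_limit_at_right_real Hausdorff] by blast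
  define R where "R = cone_radius p"
  have R: "R > 0" using cone_atD(2)[OF p] unfolding R_def .
  obtain \<tau>1 where \<tau>1: "0 < \<tau>1" "\<tau>1 \<le> 1" "cmod (\<tau>1 *\<^sub>R \<zeta>) < R" by (rule punctured_ray_small[OF R])
  obtain \<tau>2 where \<tau>2: "0 < \<tau>2" "\<tau>2 \<le> 1" "cmod (\<tau>2 *\<^sub>R \<xi>) < R" by (rule punctured_ray_small[OF R])
  define r where "r = min \<tau>1 \<tau>2"
  have r: "0 < r" "r \<le> 1" using \<tau>1 \<tau>2 unfolding r_def by auto
  have "r * cmod \<zeta> \<le> \<tau>1 * cmod \<zeta>" "r * cmod \<xi> \<le> \<tau>2 * cmod \<xi>"
    unfolding r_def by (auto intro!: mult_right_mono)
  then have small: "r *\<^sub>R \<zeta> \<in> ball 0 R" "r *\<^sub>R \<xi> \<in> ball 0 R" using \<tau>1 \<tau>2 r by auto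
  \<comment> \<open>At this time both geodesics are at the points scaled by \<open>r\<close>, which
    lie in the disc of the cone coordinate.\<close>
  define \<tau> where "\<tau> = r ^ cone_angle p"
  have "\<tau> \<in> {0<..1}" unfolding \<tau>_def using r by (auto intro: power_le_one)
  then have "expo p (root (cone_angle p) \<tau> *\<^sub>R \<zeta>) = expo p (root (cone_angle p) \<tau> *\<^sub>R \<xi>)"
    using same[of \<tau>] unfolding \<alpha>_def \<beta>_def pq by simp
  then have "expo p (r *\<^sub>R \<zeta>) = expo p (r *\<^sub>R \<xi>)"
    unfolding \<tau>_def using r(1) cone_atD(1)[OF p] by (simp add: real_root_power_cancel)
  then have "cone_param p (r *\<^sub>R \<zeta>) = cone_param p (r *\<^sub>R \<xi>)"
    using star_near_0(2)[OF p] small \<zeta>(1) \<xi>(1) r(1) unfolding R_def by simp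
  then have "r *\<^sub>R \<zeta> = r *\<^sub>R \<xi>"
    using inj_onD[OF cone_atD(4)[OF p]] small unfolding R_def by blast
  then show ?thesis using pq r(1) by simp
qed

section \<open>The area of the surface: finiteness and lower bounds\<close>

lemma surface_area_ge_sum:
  assumes "finite F" "disjoint_family_on snd F"
    "\<And>U \<phi> B. ((U, \<phi>), B) \<in> F \<Longrightarrow> (U, \<phi>) \<in> rs_atlas X \<and> B \<subseteq> U \<and> \<phi> ` B \<in> sets borel"
  shows "(\<Sum>(c, B)\<in>F. \<integral>\<^sup>+ z \<in> snd c ` B. ennreal ((cmod (ts_form X c z))\<^sup>2) \<partial>lborel) \<le> surface_area X"
  unfolding surface_area_def
  by (rule SUP_upper) (use assms in auto)

text \<open>In the cone coordinate the form has the coefficient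
  \<open>m * \<zeta> ^ (m - 1)\<close>, bounded by \<open>m * R ^ (m - 1)\<close>; what remains is
  the Lebesgue measure of the piece in that coordinate.\<close>

lemma cone_chart_area:
  assumes c: "cone y m R e" and U: "(U, \<phi>) \<in> rs_atlas X" and B: "B \<subseteq> U" "\<phi> ` B \<in> sets borel"
  defines "A \<equiv> inv_into (ball 0 R) e ` (B \<inter> e ` ball 0 R)"
  shows "A \<in> sets borel" "\<phi> ` (B \<inter> e ` ball 0 R) \<in> sets borel"
    "(\<integral>\<^sup>+ z \<in> \<phi> ` (B \<inter> e ` ball 0 R). ennreal ((cmod (ts_form X (U, \<phi>) z))\<^sup>2) \<partial>lborel)
      \<le> ennreal ((real m * R ^ (m - 1))\<^sup>2) * emeasure lborel A"
proof -
  note cd = coneD[OF c]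
  define V where "V = e ` ball 0 R"
  define \<zeta> where "\<zeta> = inv_into (ball 0 R) e"
  define \<psi> where "\<psi> = \<zeta> \<circ> inv_into U \<phi>"
  define \<Omega> where "\<Omega> = \<phi> ` (V \<inter> U)"
  define S where "S = \<phi> ` (B \<inter> V)"
  have V: "openin T V" unfolding V_def by (rule cd(5)) auto
  have inv: "inv_into U \<phi> (\<phi> q) = q" if "q \<in> U" for q using atlas_inj[OF U] that by simp
  have \<Omega>: "open \<Omega>" unfolding \<Omega>_def
    by (rule atlas_open_image[OF U]) (use V atlas_openin[OF U] in auto)
  have \<psi>: "\<psi> holomorphic_on \<Omega>" unfolding \<psi>_def \<zeta>_def \<Omega>_def V_def by (rule coneD_holomorphic[OF c U])
  have inj: "inj_on \<psi> \<Omega>"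
  proof (rule inj_onI)
    fix a b assume "a \<in> \<Omega>" "b \<in> \<Omega>" and ab: "\<psi> a = \<psi> b"
    then obtain q r where q: "q \<in> V" "q \<in> U" "a = \<phi> q" and r: "r \<in> V" "r \<in> U" "b = \<phi> r" unfolding \<Omega>_def by blast
    have "\<zeta> q = \<zeta> r" using ab inv[OF q(2)] inv[OF r(2)] unfolding \<psi>_def q(3) r(3) by simp
    then have "q = r" using q(1) r(1) inv_into_injective unfolding \<zeta>_def V_def by metis
    then show "a = b" unfolding q(3) r(3) by simp
  qed
  have S\<Omega>: "S \<subseteq> \<Omega>" unfolding S_def \<Omega>_def using B(1) by blast
  have "S = \<phi> ` B \<inter> \<Omega>"
  proof
    show "S \<subseteq> \<phi> ` B \<inter> \<Omega>" using S\<Omega> unfolding S_def by blast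
    show "\<phi> ` B \<inter> \<Omega> \<subseteq> S"
    proof
      fix a assume "a \<in> \<phi> ` B \<inter> \<Omega>"
      then obtain q r where "q \<in> B" "a = \<phi> q" "r \<in> V" "r \<in> U" "a = \<phi> r" unfolding \<Omega>_def by blast
      then have "q = r" using atlas_inj[OF U] B(1) by (metis inj_onD subsetD)
      then show "a \<in> S" using \<open>q \<in> B\<close> \<open>r \<in> V\<close> \<open>a = \<phi> q\<close> unfolding S_def by blast
    qed
  qed
  then have S: "S \<in> sets borel" using B(2) \<Omega> by auto
  then show "\<phi> ` (B \<inter> e ` ball 0 R) \<in> sets borel" unfolding S_def V_def .
  have \<psi>S: "\<psi> ` S = A" unfolding S_def A_def V_def[symmetric] \<zeta>_def[symmetric] \<psi>_def image_image
    using inv B(1) by (intro image_cong refl) auto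
  show A: "A \<in> sets borel" using borel_holomorphic_image[OF \<Omega> \<psi> inj S\<Omega> S] unfolding \<psi>S .
  have "A \<subseteq> ball 0 R" unfolding A_def using cd(11) by auto
  then have "emeasure lborel A \<le> emeasure lborel (ball (0::complex) R)" using A by (intro emeasure_mono) auto
  also have "\<dots> < \<infinity>" using cd(2) by (simp add: emeasure_ball)
  finally have fin: "emeasure lborel (\<psi> ` S) < \<infinity>" unfolding \<psi>S .
  define C where "C = real m * R ^ (m - 1)"
  have bound: "(cmod (ts_form X (U, \<phi>) a))\<^sup>2 \<le> C\<^sup>2 * (cmod (deriv \<psi> a))\<^sup>2" if a: "a \<in> \<Omega>" for a
  proof -
    obtain q where q: "q \<in> V" "q \<in> U" "a = \<phi> q" using a unfolding \<Omega>_def by blast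
    have d1: "((\<lambda>x. \<psi> x ^ m) has_field_derivative ts_form X (U, \<phi>) a) (at a)"
      using primitive_onD[OF cd(8) U _ q(2)] q(1,3) unfolding V_def \<psi>_def \<zeta>_def o_def by simp
    have "(\<psi> has_field_derivative deriv \<psi> a) (at a)" using holomorphic_derivI[OF \<psi> \<Omega> a] by simp
    then have "((\<lambda>x. \<psi> x ^ m) has_field_derivative of_nat m * (deriv \<psi> a * \<psi> a ^ (m - 1))) (at a)"
      by (auto intro!: derivative_eq_intros)
    with d1 have w: "ts_form X (U, \<phi>) a = of_nat m * (deriv \<psi> a * \<psi> a ^ (m - 1))" by (rule DERIV_unique)
    have "\<psi> a \<in> ball 0 R" using q inv cd(11) unfolding \<psi>_def \<zeta>_def V_def by auto
    then have "cmod (\<psi> a) ^ (m - 1) \<le> R ^ (m - 1)" by (intro power_mono) auto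
    then have "cmod (ts_form X (U, \<phi>) a) \<le> C * cmod (deriv \<psi> a)"
      unfolding w C_def norm_mult norm_power norm_of_nat
      by (simp add: mult.commute mult.left_commute mult_left_mono)
    then have "(cmod (ts_form X (U, \<phi>) a))\<^sup>2 \<le> (C * cmod (deriv \<psi> a))\<^sup>2" by (rule power_mono) simp
    then show ?thesis by (simp add: power_mult_distrib)
  qed
  have "(\<integral>\<^sup>+ z \<in> S. ennreal ((cmod (ts_form X (U, \<phi>) z))\<^sup>2) \<partial>lborel)
      \<le> (\<integral>\<^sup>+ z. ennreal (C\<^sup>2) * (ennreal ((cmod (deriv \<psi> z))\<^sup>2) * indicator S z) \<partial>lborel)"
  proof (rule nn_integral_mono)
    fix z show "ennreal ((cmod (ts_form X (U, \<phi>) z))\<^sup>2) * indicator S z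
        \<le> ennreal (C\<^sup>2) * (ennreal ((cmod (deriv \<psi> z))\<^sup>2) * indicator S z)"
    proof (cases "z \<in> S")
      case True
      then have "z \<in> \<Omega>" using S\<Omega> by blast
      from ennreal_leI[OF bound[OF this]] show ?thesis using True by (simp add: ennreal_mult)
    qed simp
  qed
  also have "\<dots> = ennreal (C\<^sup>2) * (\<integral>\<^sup>+ z \<in> S. ennreal ((cmod (deriv \<psi> z))\<^sup>2) \<partial>lborel)"
    using holomorphic_indicator_measurable[OF \<Omega> holomorphic_deriv[OF \<psi> \<Omega>] S\<Omega> S]
    by (intro nn_integral_cmult) simp
  also have "(\<integral>\<^sup>+ z \<in> S. ennreal ((cmod (deriv \<psi> z))\<^sup>2) \<partial>lborel) = emeasure lborel A"
    using nn_integral_holomorphic_image[OF \<Omega> \<psi> inj S\<Omega> S fin] unfolding \<psi>S .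
  finally show "(\<integral>\<^sup>+ z \<in> \<phi> ` (B \<inter> e ` ball 0 R). ennreal ((cmod (ts_form X (U, \<phi>) z))\<^sup>2) \<partial>lborel)
      \<le> ennreal ((real m * R ^ (m - 1))\<^sup>2) * emeasure lborel A" unfolding S_def V_def C_def .
qed

text \<open>\<open>surface_area\<close> is a supremum, so a bound independent of the family is
  needed. Finitely many cones cover \<open>X\<close>, and in each coordinate disc the traces of
  disjoint pieces have together at most the measure of the disc.\<close>

lemma surface_area_finite: "surface_area X < \<infinity>"
proof -
  have "\<exists>c. cone y (fst c) (fst (snd c)) (snd (snd c))" if y: "y \<in> topspace T" for y
  proof -
    obtain m R e where "cone y m R e" using cone_exists[OF y] .
    then show ?thesis by (intro exI[of _ "(m, R, e)"]) simp
  qed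
  then obtain d where d: "\<And>y. y \<in> topspace T \<Longrightarrow> cone y (fst (d y)) (fst (snd (d y))) (snd (snd (d y)))" by metis
  define m R e where "m = (\<lambda>y. fst (d y))" and "R = (\<lambda>y. fst (snd (d y)))" and "e = (\<lambda>y. snd (snd (d y)))"
  have c: "cone y (m y) (R y) (e y)" if "y \<in> topspace T" for y using d[OF that] unfolding m_def R_def e_def .
  define V where "V = (\<lambda>y. e y ` ball 0 (R y))"
  have V: "openin T (V y)" "y \<in> V y" if y: "y \<in> topspace T" for y
  proof -
    note cd = coneD[OF c[OF y]]
    show "openin T (V y)" unfolding V_def by (rule cd(5)) auto
    show "y \<in> V y" unfolding V_def using cd(2,3) by (intro image_eqI[of _ _ 0]) auto
  qed
  have cover: "topspace T \<subseteq> \<Union>(V ` topspace T)" using V(2) by blast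
  have "compactin T (topspace T)" using compact unfolding compact_space_def .
  then have "\<exists>\<F>. finite \<F> \<and> \<F> \<subseteq> V ` topspace T \<and> topspace T \<subseteq> \<Union>\<F>"
    by (rule compactinD[OF _ _ cover]) (use V(1) in auto)
  then obtain \<F> where \<F>: "finite \<F>" "\<F> \<subseteq> V ` topspace T" "topspace T \<subseteq> \<Union>\<F>" by (elim exE conjE)
  obtain Y where Y: "finite Y" "Y \<subseteq> topspace T" "\<F> = V ` Y"
    using finite_subset_image[OF \<F>(1,2)] by metis
  define K where "K = (\<lambda>y. ennreal ((real (m y) * R y ^ (m y - 1))\<^sup>2))"
  define M where "M = (\<Sum>y\<in>Y. K y * emeasure lborel (ball (0::complex) (R y)))"
  have "K y * emeasure lborel (ball (0::complex) (R y)) \<noteq> \<infinity>" if y: "y \<in> Y" for y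
  proof -
    have "R y > 0" using coneD(2)[OF c] Y(2) y by blast
    then have "emeasure lborel (ball (0::complex) (R y)) \<noteq> \<infinity>" by (simp add: emeasure_ball)
    then show ?thesis unfolding K_def by (simp add: ennreal_mult_eq_top_iff)
  qed
  then have "M < \<infinity>" unfolding M_def using Y(1) by (simp add: less_top[symmetric])
  have "surface_area X \<le> M"
    unfolding surface_area_def
  proof (rule SUP_least)
    fix F assume "F \<in> {F. finite F \<and> disjoint_family_on snd F \<and>
                  (\<forall>((U, \<phi>), B) \<in> F. (U, \<phi>) \<in> rs_atlas X \<and> B \<subseteq> U \<and> \<phi> ` B \<in> sets borel)}"
    then have F: "finite F" "disjoint_family_on snd F"
      "\<forall>((U, \<phi>), B) \<in> F. (U, \<phi>) \<in> rs_atlas X \<and> B \<subseteq> U \<and> \<phi> ` B \<in> sets borel" by simp_all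
    define A where "A = (\<lambda>y (f :: 'a chart \<times> 'a set). inv_into (ball 0 (R y)) (e y) ` (snd f \<inter> V y) :: complex set)"
    have 1: "(\<integral>\<^sup>+ z \<in> snd (fst f) ` snd f. ennreal ((cmod (ts_form X (fst f) z))\<^sup>2) \<partial>lborel)
        \<le> (\<Sum>y\<in>Y. K y * emeasure lborel (A y f)) \<and> (\<forall>y\<in>Y. A y f \<in> sets borel)" if f: "f \<in> F" for f
    proof -
      obtain U \<phi> B where fe: "f = ((U, \<phi>), B)" by (metis prod.exhaust)
      have U: "(U, \<phi>) \<in> rs_atlas X" "B \<subseteq> U" "\<phi> ` B \<in> sets borel" using F(3) f unfolding fe by auto
      define w where "w = (\<lambda>z. ennreal ((cmod (ts_form X (U, \<phi>) z))\<^sup>2))"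
      have ca: "A y f \<in> sets borel" "\<phi> ` (B \<inter> V y) \<in> sets borel"
        "(\<integral>\<^sup>+ z \<in> \<phi> ` (B \<inter> V y). w z \<partial>lborel) \<le> K y * emeasure lborel (A y f)" if y: "y \<in> Y" for y
      proof -
        have "y \<in> topspace T" using y Y(2) by blast
        note cca = cone_chart_area[OF c[OF this] U]
        show "A y f \<in> sets borel" using cca(1) unfolding A_def V_def fe by simp
        show "\<phi> ` (B \<inter> V y) \<in> sets borel" using cca(2) unfolding V_def .
        show "(\<integral>\<^sup>+ z \<in> \<phi> ` (B \<inter> V y). w z \<partial>lborel) \<le> K y * emeasure lborel (A y f)"
          using cca(3) unfolding A_def V_def fe K_def w_def by simp
      qed
      have meas: "(\<lambda>z. w z * indicator (\<phi> ` (B \<inter> V y)) z) \<in> borel_measurable lborel" if y: "y \<in> Y" for y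
      proof -
        have "\<phi> ` (B \<inter> V y) \<subseteq> \<phi> ` U" using U(2) by blast
        from holomorphic_indicator_measurable[OF atlas_open_range[OF U(1)] form_holomorphic[OF U(1)] this ca(2)[OF y]]
        show ?thesis unfolding w_def by simp
      qed
      have "(\<integral>\<^sup>+ z \<in> \<phi> ` B. w z \<partial>lborel) \<le> (\<integral>\<^sup>+ z. (\<Sum>y\<in>Y. w z * indicator (\<phi> ` (B \<inter> V y)) z) \<partial>lborel)"
      proof (rule nn_integral_mono)
        fix z show "w z * indicator (\<phi> ` B) z \<le> (\<Sum>y\<in>Y. w z * indicator (\<phi> ` (B \<inter> V y)) z)"
        proof (cases "z \<in> \<phi> ` B")
          case True
          then obtain b where b: "b \<in> B" "z = \<phi> b" by blast
          then have "b \<in> \<Union>\<F>" using U(2) openin_subset[OF atlas_openin[OF U(1)]] \<F>(3) by blast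
          then obtain y where y: "y \<in> Y" "b \<in> V y" unfolding Y(3) by blast
          have "w z * indicator (\<phi> ` B) z = w z * indicator (\<phi> ` (B \<inter> V y)) z" using b y by (auto simp: indicator_def)
          also have "\<dots> \<le> (\<Sum>y\<in>Y. w z * indicator (\<phi> ` (B \<inter> V y)) z)"
            using Y(1) y(1) by (intro member_le_sum) auto
          finally show ?thesis .
        qed simp
      qed
      also have "\<dots> = (\<Sum>y\<in>Y. \<integral>\<^sup>+ z \<in> \<phi> ` (B \<inter> V y). w z \<partial>lborel)"
        by (rule nn_integral_sum) (rule meas)
      also have "\<dots> \<le> (\<Sum>y\<in>Y. K y * emeasure lborel (A y f))" by (rule sum_mono) (rule ca(3))
      finally show ?thesis using ca(1) unfolding fe w_def by simp
    qed
    have 2: "(\<Sum>f\<in>F. emeasure lborel (A y f)) \<le> emeasure lborel (ball (0::complex) (R y))" if y: "y \<in> Y" for y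
    proof -
      have yt: "y \<in> topspace T" using y Y(2) by blast
      note cd = coneD[OF c[OF yt]]
      have "disjoint_family_on (A y) F"
        unfolding disjoint_family_on_def
      proof (intro ballI impI)
        fix f g assume fg: "f \<in> F" "g \<in> F" "f \<noteq> g"
        then have disj: "snd f \<inter> snd g = {}" using F(2) unfolding disjoint_family_on_def by blast
        have inj: "inj_on (inv_into (ball 0 (R y)) (e y)) (V y)" unfolding V_def by (rule inj_on_inv_into) simp
        have "A y f \<inter> A y g = inv_into (ball 0 (R y)) (e y) ` ((snd f \<inter> V y) \<inter> (snd g \<inter> V y))"
          unfolding A_def by (rule inj_on_image_Int[OF inj, symmetric]) auto
        then show "A y f \<inter> A y g = {}" using disj by auto
      qed
      then have "(\<Sum>f\<in>F. emeasure lborel (A y f)) = emeasure lborel (\<Union>f\<in>F. A y f)"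
        using 1 y F(1) by (intro sum_emeasure) auto
      also have "\<dots> \<le> emeasure lborel (ball (0::complex) (R y))"
      proof (rule emeasure_mono)
        show "(\<Union>f\<in>F. A y f) \<subseteq> ball 0 (R y)" unfolding A_def V_def using cd(11) by auto
      qed simp
      finally show ?thesis .
    qed
    have "(\<Sum>(c, B)\<in>F. \<integral>\<^sup>+ z \<in> snd c ` B. ennreal ((cmod (ts_form X c z))\<^sup>2) \<partial>lborel)
        = (\<Sum>f\<in>F. \<integral>\<^sup>+ z \<in> snd (fst f) ` snd f. ennreal ((cmod (ts_form X (fst f) z))\<^sup>2) \<partial>lborel)"
      by (intro sum.cong refl) (auto split: prod.splits)
    also have "\<dots> \<le> (\<Sum>f\<in>F. \<Sum>y\<in>Y. K y * emeasure lborel (A y f))" by (rule sum_mono) (use 1 in blast)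
    also have "\<dots> = (\<Sum>y\<in>Y. \<Sum>f\<in>F. K y * emeasure lborel (A y f))" by (rule sum.swap)
    also have "\<dots> = (\<Sum>y\<in>Y. K y * (\<Sum>f\<in>F. emeasure lborel (A y f)))" by (simp add: sum_distrib_left)
    also have "\<dots> \<le> M" unfolding M_def by (intro sum_mono mult_left_mono 2) auto
    finally show "(\<Sum>(c, B)\<in>F. \<integral>\<^sup>+ z \<in> snd c ` B. ennreal ((cmod (ts_form X c z))\<^sup>2) \<partial>lborel) \<le> M" .
  qed
  then show ?thesis using \<open>M < \<infinity>\<close> by (rule le_less_trans)
qed

text \<open>Up to a translation \<open>G\<close> locally inverts a translation chart, so in an atlas
  chart its derivative is the reciprocal of the coefficient of the form.\<close>

lemma dev_id_chart:
  assumes d: "dev (\<lambda>x. x) D G" and D: "open D" and inj: "inj_on G D"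
    and V: "(V, \<phi>) \<in> rs_atlas X" and sub: "G ` D \<subseteq> V"
  shows "(\<phi> \<circ> G) holomorphic_on D" "inj_on (\<phi> \<circ> G) D"
    "\<And>x. x \<in> D \<Longrightarrow> deriv (\<phi> \<circ> G) x = inverse (ts_form X (V, \<phi>) (\<phi> (G x)))"
    "\<And>x. x \<in> D \<Longrightarrow> ts_form X (V, \<phi>) (\<phi> (G x)) \<noteq> 0"
proof -
  show "inj_on (\<phi> \<circ> G) D"
    by (rule comp_inj_on[OF inj]) (rule inj_on_subset[OF atlas_inj[OF V] sub])
  have der: "((\<phi> \<circ> G) has_field_derivative inverse (ts_form X (V, \<phi>) (\<phi> (G x)))) (at x)" if x: "x \<in> D" for x
  proof -
    obtain U z where U: "translation_chart X U z" "G x \<in> U"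
      "\<forall>\<^sub>F y in at x within D. G y \<in> U \<and> z (G y) - z (G x) = y - x"
      using dev_obtain[OF d x] .
    note tc = translation_chartD[OF U(1)]
    have GV: "G x \<in> V" using sub x by blast
    define h where "h = (\<lambda>y. z (G x) + (y - x))"
    have "((\<phi> \<circ> inv_into U z) has_field_derivative inverse (ts_form X (V, \<phi>) (\<phi> (G x)))) (at (h x))"
      using translation_to_atlas_derivative[OF U(1) V U(2) GV] unfolding h_def by simp
    moreover have "(h has_field_derivative 1) (at x)" unfolding h_def by (auto intro!: derivative_eq_intros)
    ultimately have 1: "((\<phi> \<circ> inv_into U z \<circ> h) has_field_derivative inverse (ts_form X (V, \<phi>) (\<phi> (G x))) * 1) (at x)"
      by (rule DERIV_chain)
    have at: "at x within D = at x" using x D by (rule at_within_open)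
    from U(3)[unfolded at] have ev: "\<forall>\<^sub>F y in at x. (\<phi> \<circ> inv_into U z \<circ> h) y = (\<phi> \<circ> G) y"
    proof eventually_elim
      case (elim y)
      have "h y = z (G x) + (z (G y) - z (G x))" unfolding h_def using elim by simp
      then have "h y = z (G y)" by simp
      then show ?case using elim tc(3) by simp
    qed
    have eqx: "(\<phi> \<circ> inv_into U z \<circ> h) x = (\<phi> \<circ> G) x" unfolding h_def using tc(3) U(2) by simp
    have "\<forall>\<^sub>F y in nhds x. (\<phi> \<circ> inv_into U z \<circ> h) y = (\<phi> \<circ> G) y"
      using ev eqx unfolding eventually_at_filter by (auto elim: eventually_mono)
    then show ?thesis using 1 DERIV_cong_ev[OF refl _ refl] by fastforce
  qed
  show "(\<phi> \<circ> G) holomorphic_on D"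
    unfolding holomorphic_on_def field_differentiable_def using der has_field_derivative_at_within by blast
  show "deriv (\<phi> \<circ> G) x = inverse (ts_form X (V, \<phi>) (\<phi> (G x)))" if "x \<in> D" for x
    by (rule DERIV_imp_deriv[OF der[OF that]])
  show "ts_form X (V, \<phi>) (\<phi> (G x)) \<noteq> 0" if "x \<in> D" for x
    using form_nonzero[OF V] sub dev_in(2)[OF d that] that by blast
qed

text \<open>\<open>G\<close> preserves area: the density of the form is the Jacobian of the inverse
  \<open>k\<close> of \<open>\<phi> \<circ> G\<close>, so change of variables along \<open>k\<close>
  computes the integral.\<close>

lemma dev_id_area:
  assumes d: "dev (\<lambda>x. x) D G" and D: "open D" and inj: "inj_on G D"
    and V: "(V, \<phi>) \<in> rs_atlas X" and sub: "G ` D \<subseteq> V"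
    and S: "S \<subseteq> D" "S \<in> sets borel" "emeasure lborel S < \<infinity>"
  shows "\<phi> ` G ` S \<in> sets borel"
    "(\<integral>\<^sup>+ z \<in> \<phi> ` G ` S. ennreal ((cmod (ts_form X (V, \<phi>) z))\<^sup>2) \<partial>lborel) = emeasure lborel S"
proof -
  define \<psi> where "\<psi> = \<phi> \<circ> G"
  note c = dev_id_chart[OF d D inj V sub, folded \<psi>_def]
  have im: "\<phi> ` G ` S = \<psi> ` S" unfolding \<psi>_def by (simp add: image_comp)
  show b: "\<phi> ` G ` S \<in> sets borel" unfolding im by (rule borel_holomorphic_image[OF D c(1,2) S(1,2)])
  obtain k where k: "k holomorphic_on \<psi> ` D" "\<And>z. z \<in> D \<Longrightarrow> deriv \<psi> z * deriv k (\<psi> z) = 1" "\<And>z. z \<in> D \<Longrightarrow> k (\<psi> z) = z"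
    by (rule holomorphic_has_inverse[OF c(1) D c(2)]) (rule that; simp)
  have o: "open (\<psi> ` D)" by (rule open_mapping_thm3[OF c(1) D c(2)])
  have ik: "inj_on k (\<psi> ` D)" using k(3) by (auto simp: inj_on_def)
  have kS: "k ` \<psi> ` S = S" using k(3) S(1) by (force simp: image_image)
  have "(\<integral>\<^sup>+ z \<in> \<phi> ` G ` S. ennreal ((cmod (ts_form X (V, \<phi>) z))\<^sup>2) \<partial>lborel)
      = (\<integral>\<^sup>+ z \<in> \<psi> ` S. ennreal ((cmod (deriv k z))\<^sup>2) \<partial>lborel)"
    unfolding im
  proof (rule nn_integral_cong)
    fix z show "ennreal ((cmod (ts_form X (V, \<phi>) z))\<^sup>2) * indicator (\<psi> ` S) z
        = ennreal ((cmod (deriv k z))\<^sup>2) * indicator (\<psi> ` S) z"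
    proof (cases "z \<in> \<psi> ` S")
      case True
      then obtain x where x: "x \<in> D" "z = \<psi> x" using S(1) by blast
      have w: "ts_form X (V, \<phi>) (\<psi> x) \<noteq> 0" using c(4)[OF x(1)] unfolding \<psi>_def by simp
      have "deriv \<psi> x = inverse (ts_form X (V, \<phi>) (\<psi> x))" using c(3)[OF x(1)] unfolding \<psi>_def by simp
      then have "inverse (ts_form X (V, \<phi>) (\<psi> x)) * deriv k (\<psi> x) = 1" using k(2)[OF x(1)] by simp
      then have "deriv k z = ts_form X (V, \<phi>) z" using w x(2) by (simp add: field_simps)
      then show ?thesis by simp
    qed simp
  qed
  also have "\<dots> = emeasure lborel (k ` \<psi> ` S)"
  proof (rule nn_integral_holomorphic_image[OF o k(1) ik])
    show "\<psi> ` S \<subseteq> \<psi> ` D" using S(1) by blast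
    show "\<psi> ` S \<in> sets borel" using b unfolding im .
    show "emeasure lborel (k ` \<psi> ` S) < \<infinity>" unfolding kS by (rule S(3))
  qed
  finally show "(\<integral>\<^sup>+ z \<in> \<phi> ` G ` S. ennreal ((cmod (ts_form X (V, \<phi>) z))\<^sup>2) \<partial>lborel) = emeasure lborel S"
    unfolding kS .
qed

text \<open>A piece in \<open>surface_area\<close> has to lie in a single chart. By the Lindelof
  property countably many open sets mapped into charts cover \<open>C\<close>, and making them
  disjoint keeps them Borel.\<close>

lemma dev_id_pieces:
  assumes d: "dev (\<lambda>x. x) C G" and C: "open C"
  obtains D c :: "nat \<Rightarrow> _" where "disjoint_family D" "(\<Union>n. D n) = C" "\<And>n. D n \<in> sets borel"
    "\<And>n. c n \<in> rs_atlas X" "\<And>n. \<exists>O'. open O' \<and> D n \<subseteq> O' \<and> O' \<subseteq> C \<and> G ` O' \<subseteq> fst (c n)"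
proof -
  define \<F> where "\<F> = {B. open B \<and> B \<subseteq> C \<and> (\<exists>c\<in>rs_atlas X. G ` B \<subseteq> fst c)}"
  obtain c0 where c0: "c0 \<in> rs_atlas X" using nonempty chart_at(1) by blast
  have e: "{} \<in> \<F>" unfolding \<F>_def by (intro CollectI conjI bexI[OF _ c0]) simp_all
  have "x \<in> \<Union>\<F>" if x: "x \<in> C" for x
  proof -
    obtain V \<phi> where V: "(V, \<phi>) \<in> rs_atlas X" "G x \<in> V" using atlas_point[OF dev_in(1)[OF d x]] .
    have "openin (top_of_set C) {y \<in> C. G y \<in> V}"
      using dev_continuous_map[OF d] atlas_openin[OF V(1)] unfolding continuous_map_def by auto
    then have "open {y \<in> C. G y \<in> V}" using C by (simp add: openin_open_eq)
    then have "{y \<in> C. G y \<in> V} \<in> \<F>" unfolding \<F>_def using V(1) by (auto intro!: bexI[of _ "(V, \<phi>)"])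
    then show ?thesis using x V(2) by blast
  qed
  then have un: "\<Union>\<F> = C" unfolding \<F>_def by auto
  obtain \<F>' where \<F>': "\<F>' \<subseteq> \<F>" "countable \<F>'" "\<Union>\<F>' = \<Union>\<F>"
    by (rule Lindelof[of \<F>]) (auto simp: \<F>_def)
  \<comment> \<open>Adding the empty set makes the family nonempty, so that it can be listed as a
    sequence.\<close>
  define \<G> where "\<G> = insert {} \<F>'"
  define E where "E = from_nat_into \<G>"
  have rE: "range E = \<G>" unfolding E_def \<G>_def using \<F>'(2) by (intro range_from_nat_into) auto
  have sub: "\<G> \<subseteq> \<F>" unfolding \<G>_def using e \<F>'(1) by simp
  have E: "E n \<in> \<F>" for n using rangeI[of E n] sub unfolding rE by (rule rev_subsetD)
  have "(\<Union>n. E n) = \<Union>\<G>" unfolding rE ..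
  then have UE: "(\<Union>n. E n) = C" unfolding \<G>_def using \<F>'(3) un by simp
  have "\<exists>c\<in>rs_atlas X. G ` E n \<subseteq> fst c" for n using E[of n] unfolding \<F>_def by blast
  then obtain c where c: "\<And>n. c n \<in> rs_atlas X" "\<And>n. G ` E n \<subseteq> fst (c n)" by metis
  have Eo: "open (E n)" "E n \<subseteq> C" for n using E[of n] unfolding \<F>_def by simp_all
  then have "range E \<subseteq> sets borel" by auto
  then have "range (disjointed E) \<subseteq> sets borel" by (rule sets.range_disjointed_sets)
  then have meas: "disjointed E n \<in> sets borel" for n by auto
  show ?thesis
  proof
    show "disjoint_family (disjointed E)" by (rule disjoint_family_disjointed)
    show "(\<Union>n. disjointed E n) = C" unfolding UN_disjointed_eq UE ..
    show "disjointed E n \<in> sets borel" for n by (rule meas)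
    show "c n \<in> rs_atlas X" for n by (rule c)
    show "\<exists>O'. open O' \<and> disjointed E n \<subseteq> O' \<and> O' \<subseteq> C \<and> G ` O' \<subseteq> fst (c n)" for n
      using Eo c(2) disjointed_subset by (intro exI[of _ "E n"] conjI)
  qed
qed

text \<open>The families in \<open>surface_area\<close> are finite, so only the first
  \<open>M\<close> pieces of every sheet are used, and then \<open>M\<close> tends to
  infinity.\<close>

lemma packing_area:
  fixes G :: "'i \<Rightarrow> complex \<Rightarrow> 'a"
  assumes I: "finite I" and C: "open C" "emeasure lborel C < \<infinity>"
    and d: "\<And>i. i \<in> I \<Longrightarrow> dev (\<lambda>x. x) C (G i)"
    and inj: "\<And>i j x y. i \<in> I \<Longrightarrow> j \<in> I \<Longrightarrow> x \<in> C \<Longrightarrow> y \<in> C \<Longrightarrow> G i x = G j y \<Longrightarrow> i = j \<and> x = y"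
  shows "of_nat (card I) * emeasure lborel C \<le> surface_area X"
proof -
  have "\<exists>D c. disjoint_family D \<and> (\<Union>n. D n) = C \<and> (\<forall>n::nat. D n \<in> sets borel) \<and> (\<forall>n. c n \<in> rs_atlas X) \<and>
    (\<forall>n. \<exists>O'. open O' \<and> D n \<subseteq> O' \<and> O' \<subseteq> C \<and> G i ` O' \<subseteq> fst (c n))" if "i \<in> I" for i
    using dev_id_pieces[OF d[OF that] C(1)] by metis
  then obtain D c where Dc: "\<And>i. i \<in> I \<Longrightarrow> disjoint_family (D i)" "\<And>i. i \<in> I \<Longrightarrow> (\<Union>n::nat. D i n) = C"
    "\<And>i n. i \<in> I \<Longrightarrow> D i n \<in> sets borel" "\<And>i n. i \<in> I \<Longrightarrow> c i n \<in> rs_atlas X"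
    "\<And>i n. i \<in> I \<Longrightarrow> \<exists>O'. open O' \<and> D i n \<subseteq> O' \<and> O' \<subseteq> C \<and> G i ` O' \<subseteq> fst (c i n)"
    by metis
  have DC: "D i n \<subseteq> C" if "i \<in> I" for i n using Dc(2)[OF that] by blast
  define B where "B = (\<lambda>i n. G i ` D i n)"
  have piece: "snd (c i n) ` B i n \<in> sets borel \<and> B i n \<subseteq> fst (c i n) \<and>
      (\<integral>\<^sup>+ z \<in> snd (c i n) ` B i n. ennreal ((cmod (ts_form X (c i n) z))\<^sup>2) \<partial>lborel) = emeasure lborel (D i n)"
    if i: "i \<in> I" for i n
  proof -
    obtain O' where O': "open O'" "D i n \<subseteq> O'" "O' \<subseteq> C" "G i ` O' \<subseteq> fst (c i n)" using Dc(5)[OF i] by metis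
    obtain V \<phi> where V: "c i n = (V, \<phi>)" by force
    have Va: "(V, \<phi>) \<in> rs_atlas X" using Dc(4)[OF i, of n] unfolding V .
    have sub: "G i ` O' \<subseteq> V" using O'(4) unfolding V by simp
    have injO: "inj_on (G i) O'" using inj[OF i i] O'(3) by (auto simp: inj_on_def)
    have "emeasure lborel (D i n) \<le> emeasure lborel C" using DC[OF i] C(1) by (intro emeasure_mono) auto
    then have fin: "emeasure lborel (D i n) < \<infinity>" using C(2) by (rule le_less_trans)
    from dev_id_area[OF dev_subset[OF d[OF i] O'(3)] O'(1) injO Va sub O'(2) Dc(3)[OF i] fin]
    show ?thesis unfolding V B_def using O'(2) sub by auto
  qed
  have Bdisj: "B i n \<inter> B j k = {}" if "i \<in> I" "j \<in> I" "(i, n) \<noteq> (j, k)" for i j n k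
  proof (rule ccontr)
    assume "B i n \<inter> B j k \<noteq> {}"
    then obtain x y where xy: "x \<in> D i n" "y \<in> D j k" "G i x = G j y" unfolding B_def by blast
    then have "i = j" "x = y" using inj[OF that(1,2)] DC that(1,2) by blast+
    moreover have "D i n \<inter> D i k = {}" if "n \<noteq> k" using Dc(1)[OF \<open>i \<in> I\<close>] that unfolding disjoint_family_on_def by blast
    ultimately show False using xy \<open>(i, n) \<noteq> (j, k)\<close> by auto
  qed
  have part: "(\<Sum>i\<in>I. \<Sum>n<M. emeasure lborel (D i n)) \<le> surface_area X" for M :: nat
  proof -
    define h where "h = (\<lambda>(i, n). (c i n, B i n))"
    define g where "g = (\<lambda>(c, B). \<integral>\<^sup>+ z \<in> snd c ` B. ennreal ((cmod (ts_form X c z))\<^sup>2) \<partial>lborel)"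
    have "sum g (h ` (I \<times> {..<M})) = sum (g \<circ> h) (I \<times> {..<M})"
    proof (rule sum.reindex_nontrivial)
      \<comment> \<open>Different indices can give the same pair only if the piece is empty, and
        then the integral is 0.\<close>
      fix a b assume ab: "a \<in> I \<times> {..<M}" "b \<in> I \<times> {..<M}" "a \<noteq> b" "h a = h b"
      obtain i n where a: "a = (i, n)" by force
      obtain j k where b: "b = (j, k)" by force
      have "B i n \<inter> B j k = {}" using Bdisj[of i j n k] ab unfolding a b by auto
      moreover have "B i n = B j k" using ab(4) unfolding a b h_def by simp
      ultimately have "B i n = {}" by blast
      then show "g (h a) = 0" unfolding a h_def g_def by simp
    qed (use I in simp)
    also have "\<dots> = (\<Sum>(i, n)\<in>I \<times> {..<M}. emeasure lborel (D i n))"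
      by (rule sum.cong) (use piece in \<open>auto simp: h_def g_def\<close>)
    also have "\<dots> = (\<Sum>i\<in>I. \<Sum>n<M. emeasure lborel (D i n))" by (simp add: sum.cartesian_product)
    finally have eq: "sum g (h ` (I \<times> {..<M})) = (\<Sum>i\<in>I. \<Sum>n<M. emeasure lborel (D i n))" .
    have "sum g (h ` (I \<times> {..<M})) \<le> surface_area X"
      unfolding g_def
    proof (rule surface_area_ge_sum)
      show "finite (h ` (I \<times> {..<M}))" using I by simp
      show "disjoint_family_on snd (h ` (I \<times> {..<M}))"
        unfolding disjoint_family_on_def
      proof (intro ballI impI)
        fix f f' assume f: "f \<in> h ` (I \<times> {..<M})" "f' \<in> h ` (I \<times> {..<M})" "f \<noteq> f'"
        then obtain i n j k where "i \<in> I" "j \<in> I" "f = h (i, n)" "f' = h (j, k)" by auto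
        moreover from this f(3) have "(i, n) \<noteq> (j, k)" by auto
        ultimately show "snd f \<inter> snd f' = {}" using Bdisj unfolding h_def by simp
      qed
      fix U \<phi> A assume "((U, \<phi>), A) \<in> h ` (I \<times> {..<M})"
      then obtain i n where i: "i \<in> I" "c i n = (U, \<phi>)" "A = B i n" unfolding h_def by auto
      show "(U, \<phi>) \<in> rs_atlas X \<and> A \<subseteq> U \<and> \<phi> ` A \<in> sets borel"
        using Dc(4)[OF i(1), of n] piece[OF i(1), of n] unfolding i(2,3) by simp
    qed
    then show ?thesis unfolding eq .
  qed
  have "(\<lambda>M. \<Sum>i\<in>I. \<Sum>n<M. emeasure lborel (D i n)) \<longlonglongrightarrow> (\<Sum>i\<in>I. emeasure lborel C)"
  proof (rule tendsto_sum)
    fix i assume i: "i \<in> I"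
    have "suminf (\<lambda>n. emeasure lborel (D i n)) = emeasure lborel (\<Union>n. D i n)"
      by (rule suminf_emeasure) (use Dc(1,3) i in auto)
    then have "suminf (\<lambda>n. emeasure lborel (D i n)) = emeasure lborel C" unfolding Dc(2)[OF i] .
    then show "(\<lambda>M. \<Sum>n<M. emeasure lborel (D i n)) \<longlonglongrightarrow> emeasure lborel C"
      using summable_LIMSEQ[of "\<lambda>n. emeasure lborel (D i n)"] by simp
  qed
  then have "(\<Sum>i\<in>I. emeasure lborel C) \<le> surface_area X"
    by (rule LIMSEQ_le_const2) (use part in auto)
  then show ?thesis by simp
qed

text \<open>The cone at \<open>p\<close> is cut into \<open>cone_angle p\<close> sheets, the
  branches of the root over the slit ellipse. The geodesics reach them by \<open>short_star\<close>,
  and \<open>expo_inj\<close> makes all sheets embedded and disjoint.\<close>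

lemma packing:
  assumes short: "\<And>v. v \<in> Hol X \<Longrightarrow> s \<le> cmod (stretch t v)" and s: "s > 0"
  shows "ennreal (real (\<Sum>p\<in>Sing. cone_angle p) * (pi * (s / 2)\<^sup>2)) \<le> surface_area X"
proof -
  \<comment> \<open>The roots of unity number the sheets over \<open>p\<close>, since the branches
    of the root differ by these factors.\<close>
  define I where "I = (SIGMA p:Sing. {\<omega>::complex. \<omega> ^ cone_angle p = 1})"
  have fin1: "finite {\<omega>::complex. \<omega> ^ cone_angle p = 1}" "card {\<omega>::complex. \<omega> ^ cone_angle p = 1} = cone_angle p"
    if "p \<in> Sing" for p
    using cone_atD(1)[OF that] card_complex_roots_unity[of "cone_angle p"] finite_roots_unity[of "cone_angle p"] by auto
  have I: "finite I" unfolding I_def using finite_Sing fin1 by (intro finite_SigmaI) auto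
  have card: "card I = (\<Sum>p\<in>Sing. cone_angle p)"
    unfolding I_def using finite_Sing fin1 by (subst card_SigmaI) auto
  define E where "E = {v. cmod (stretch t v) < s / 2}"
  define C where "C = E - \<real>\<^sub>\<le>\<^sub>0"
  have oE: "open E" unfolding E_def by (intro open_Collect_less continuous_intros)
  have oC: "open C" unfolding C_def using oE by (intro open_Diff closed_nonpos_Reals_complex)
  have "emeasure lborel C = emeasure lborel E"
    unfolding C_def
    by (rule emeasure_Diff_null_set) (use oE emeasure_nonpos_Reals in \<open>auto simp: null_sets_def closed_nonpos_Reals_complex\<close>)
  then have eC: "emeasure lborel C = ennreal (pi * (s / 2)\<^sup>2)"
    unfolding E_def using emeasure_stretch_ball[of "s / 2" t] s by (simp only: less_imp_le half_gt_zero)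
  define \<rho> where "\<rho> = (\<lambda>(p, \<omega>) x. \<omega> * exp (Ln x / of_nat (cone_angle p)))"
  define G where "G = (\<lambda>i x. expo (fst i) (\<rho> i x))"
  have \<rho>: "\<rho> i x ^ cone_angle (fst i) = x" "\<rho> i x \<noteq> 0" "cmod (stretch t (\<rho> i x ^ cone_angle (fst i))) < s / 2"
    "\<rho> i x \<in> star (fst i)" "fst i \<in> Sing" if i: "i \<in> I" and x: "x \<in> C" for i x
  proof -
    obtain p \<omega> where i': "i = (p, \<omega>)" "p \<in> Sing" "\<omega> ^ cone_angle p = 1" using i unfolding I_def by auto
    have m: "cone_angle p > 0" using cone_atD(1)[OF i'(2)] .
    have x0: "x \<noteq> 0" using x unfolding C_def by auto
    show pw: "\<rho> i x ^ cone_angle (fst i) = x"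
      unfolding i' \<rho>_def using i'(3) m x0 by (simp add: power_mult_distrib exp_divide_power_eq)
    show n0: "\<rho> i x \<noteq> 0" using pw x0 m unfolding i'(1) by (auto simp: power_0_left)
    show st: "cmod (stretch t (\<rho> i x ^ cone_angle (fst i))) < s / 2"
      unfolding pw using x unfolding C_def E_def by simp
    show "fst i \<in> Sing" using i' by simp
    then show "\<rho> i x \<in> star (fst i)" by (rule short_star[OF _ short n0]) (use st s in auto)
  qed
  have "of_nat (card I) * emeasure lborel C \<le> surface_area X"
  proof (rule packing_area[OF I oC, of G])
    show "emeasure lborel C < \<infinity>" unfolding eC by simp
    show "dev (\<lambda>x. x) C (G i)" if i: "i \<in> I" for i
    proof -
      obtain p \<omega> where i': "i = (p, \<omega>)" "p \<in> Sing" using i unfolding I_def by auto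
      have "continuous_on C (\<rho> i)"
        unfolding i'(1) \<rho>_def prod.case using cone_atD(1)[OF i'(2)]
        by (intro continuous_intros) (auto simp: C_def)
      then have "dev (\<lambda>x. \<rho> i x ^ cone_angle p) C (\<lambda>x. expo p (\<rho> i x))"
        by (rule dev_compose[OF expo_dev[OF i'(2)]]) (use \<rho>(4)[OF i] i'(1) in auto)
      then show ?thesis
        by (rule dev_cong[where c = 0]) (use \<rho>(1)[OF i] i'(1) in \<open>auto simp: G_def\<close>)
    qed
    show "i = j \<and> x = y" if "i \<in> I" "j \<in> I" "x \<in> C" "y \<in> C" "G i x = G j y" for i j x y
    proof -
      note ri = \<rho>[OF that(1,3)] and rj = \<rho>[OF that(2,4)]
      have "fst i = fst j \<and> \<rho> i x = \<rho> j y"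
        using expo_inj[OF ri(5) rj(5) short ri(2,3) rj(2,3)] that(5) unfolding G_def by blast
      then have f: "fst i = fst j" "\<rho> i x = \<rho> j y" by auto
      then have xy: "x = y" using ri(1) rj(1) by metis
      have "snd i = snd j" using f xy by (cases i; cases j) (simp add: \<rho>_def)
      then show ?thesis using f(1) xy by (simp add: prod_eq_iff)
    qed
  qed
  moreover have "of_nat (card I) * emeasure lborel C = ennreal (real (card I) * (pi * (s / 2)\<^sup>2))"
    unfolding eC ennreal_of_nat_eq_real_of_nat by (rule ennreal_mult[symmetric]) auto
  ultimately show ?thesis unfolding card by simp
qed

section \<open>The Lagrange constant\<close>

text \<open>Each singularity contributes its order plus 1, so the orders add up to the sum of
  \<open>ks\<close> and the ones to its length; marked points count as well.\<close>

lemma sum_cone_angle: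
  assumes "X \<in> stratum g ks"
  shows "(\<Sum>p\<in>Sing. cone_angle p) = sum_list ks + length ks"
proof -
  have ms: "image_mset (zero_order X) (mset_set Sing) = image_mset int (mset ks)"
    using assms unfolding stratum_def by simp
  have "(\<Sum>p\<in>Sing. zero_order X p) = sum_mset (image_mset int (mset ks))"
    unfolding ms[symmetric] by (simp add: sum_unfold_sum_mset)
  also have "\<dots> = int (sum_list ks)" by (induction ks) auto
  finally have 1: "(\<Sum>p\<in>Sing. zero_order X p) = int (sum_list ks)" .
  have "size (image_mset (zero_order X) (mset_set Sing)) = length ks" unfolding ms by simp
  then have 2: "card Sing = length ks" by simp
  have "int (\<Sum>p\<in>Sing. cone_angle p) = (\<Sum>p\<in>Sing. zero_order X p + 1)"
    using cone_atD(10) by simp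
  also have "\<dots> = int (sum_list ks + length ks)" using 1 2 by (simp add: sum.distrib)
  finally show ?thesis by linarith
qed

text \<open>Positivity comes from packing at \<open>t = 0\<close>, where the norm is the ordinary
  modulus and \<open>r\<close> bounds all periods from below. The quotient in
  \<open>lagrange_constant\<close> thereby becomes a division of reals.\<close>

lemma surface_area_real:
  assumes "Sing \<noteq> {}"
  obtains a where "a > 0" "surface_area X = ennreal a"
proof -
  obtain r where r: "r > 0" "\<And>v. v \<in> Hol X \<Longrightarrow> r \<le> cmod v" using Hol_bounded_below by metis
  define N where "N = real (\<Sum>p\<in>Sing. cone_angle p) * (pi * (r / 2)\<^sup>2)"
  have "(\<Sum>p\<in>Sing. cone_angle p) > 0" using assms finite_Sing cone_atD(1) by (intro sum_pos) auto
  then have "real (\<Sum>p\<in>Sing. cone_angle p) > 0" by (simp only: of_nat_0_less_iff)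
  moreover have "pi * (r / 2)\<^sup>2 > 0" using r(1) by simp
  ultimately have N: "N > 0" unfolding N_def by (rule mult_pos_pos)
  have "ennreal N \<le> surface_area X"
    unfolding N_def by (rule packing[of r 0]) (use r in \<open>auto simp: stretch_def\<close>)
  moreover obtain a where a: "a \<ge> 0" "surface_area X = ennreal a"
    using surface_area_finite by (cases "surface_area X") auto
  ultimately have "a > 0" using N by simp
  then show ?thesis using a(2) by (rule that)
qed

lemma lagrange_constant_nonneg: "0 \<le> lagrange_constant X"
proof -
  have "0 \<le> ereal (period_area v) / enn2ereal (surface_area X)" for v
    unfolding divide_ereal_def
    by (intro ereal_0_le_mult inverse_ereal_ge0I) (auto simp: period_area_def)
  then show ?thesis unfolding lagrange_constant_def by (auto intro!: Liminf_bounded always_eventually)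
qed

lemma small_periods:
  assumes nv: "\<And>v. v \<in> Hol X \<Longrightarrow> Re v \<noteq> 0" and a: "surface_area X = ennreal a" "a > 0"
    and K: "K > 2 / (pi * real N)" and N: "N = (\<Sum>p\<in>Sing. cone_angle p)" "N > 0"
  obtains v where "v \<in> Hol X" "B \<le> \<bar>Im v\<bar>" "period_area v \<le> K * a"
proof -
  obtain \<epsilon> where \<epsilon>: "\<epsilon> > 0" "\<And>v. v \<in> Hol X \<Longrightarrow> \<bar>Im v\<bar> \<le> B \<Longrightarrow> \<epsilon> \<le> \<bar>Re v\<bar>"
    using Hol_strip[OF nv] by metis
  have pN: "pi * real N > 0" using N(2) by simp
  have K0: "K > 0" using K pN by (meson divide_pos_pos less_trans zero_less_numeral)
  \<comment> \<open>With this choice \<open>s\<^sup>2 / 2 = K * a\<close> bounds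
    \<open>period_area v\<close>, while \<open>N * pi * (s / 2)\<^sup>2 = N * pi * K * a / 2\<close>
    exceeds \<open>a\<close> because \<open>K > 2 / (pi * N)\<close>.\<close>
  define s where "s = sqrt (2 * K * a)"
  have s: "s > 0" "s\<^sup>2 = 2 * K * a" using K0 a(2) unfolding s_def by auto
  \<comment> \<open>Then \<open>exp t * \<bar>Re v\<bar> < s\<close> reads
    \<open>\<bar>Re v\<bar> < \<epsilon>\<close>, which by the choice of \<open>\<epsilon>\<close>
    rules out \<open>\<bar>Im v\<bar> \<le> B\<close>.\<close>
  define t where "t = ln (s / \<epsilon>)"
  have t: "exp t = s / \<epsilon>" unfolding t_def using s(1) \<epsilon>(1) by simp
  \<comment> \<open>If no period were this short, in particular if there were none at all, the
    packing bound would apply to \<open>s\<close>.\<close>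
  have "\<exists>v\<in>Hol X. cmod (stretch t v) < s"
  proof (rule ccontr)
    assume "\<not> ?thesis"
    then have "\<And>v. v \<in> Hol X \<Longrightarrow> s \<le> cmod (stretch t v)" by force
    from packing[OF this s(1)] have "real N * (pi * (s / 2)\<^sup>2) \<le> a"
      using a by (simp add: N(1)[symmetric])
    then have "real N * pi * K * a \<le> 2 * a" using s(2) by (simp add: power_divide field_simps)
    then have "real N * pi * K \<le> 2" using a(2) by simp
    moreover have "2 < K * (pi * real N)" using K pN by (simp add: pos_divide_less_eq)
    ultimately show False by (simp add: mult.commute mult.left_commute)
  qed
  then obtain v where v: "v \<in> Hol X" "cmod (stretch t v) < s" by blast
  have "exp t * \<bar>Re v\<bar> \<le> cmod (stretch t v)"
    using abs_Re_le_cmod[of "stretch t v"] unfolding stretch_def by (simp add: abs_mult)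
  then have "s / \<epsilon> * \<bar>Re v\<bar> < s" using v(2) unfolding t by simp
  then have "\<bar>Re v\<bar> < \<epsilon>" using s(1) \<epsilon>(1) by (simp add: field_simps)
  then have "B \<le> \<bar>Im v\<bar>" using \<epsilon>(2)[OF v(1)] by linarith
  moreover have "(cmod (stretch t v))\<^sup>2 \<le> s\<^sup>2" using v(2) by (intro power_mono) auto
  then have "period_area v \<le> K * a" using period_area_le_stretch[of v t] s(2) by simp
  ultimately show ?thesis by (rule that[OF v(1)])
qed

lemma lagrange_constant_bound:
  assumes N: "N = (\<Sum>p\<in>Sing. cone_angle p)" "N > 0"
  shows "lagrange_constant X \<le> ereal (2 / (pi * real N))"
proof (cases "\<exists>v \<in> Hol X. Re v = 0")
  case True
  then show ?thesis unfolding lagrange_constant_def by simp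
next
  case False
  have "Sing \<noteq> {}" using N by auto
  then obtain a where a: "a > 0" "surface_area X = ennreal a" by (rule surface_area_real)
  let ?F = "inf (filtercomap (\<lambda>v. \<bar>Im v\<bar>) at_top) (principal (Hol X))"
  let ?h = "\<lambda>v. ereal (period_area v) / enn2ereal (surface_area X)"
  have "Liminf ?F ?h \<le> ereal (2 / (pi * real N))"
  proof (rule ccontr)
    assume "\<not> ?thesis"
    then have "ereal (2 / (pi * real N)) < Liminf ?F ?h" by simp
    \<comment> \<open>Room is needed on both sides: \<open>small_periods\<close> asks for
      \<open>K\<close> above the critical value, and \<open>K\<close> below the liminf gives an
      eventual lower bound.\<close>
    then obtain K where K: "2 / (pi * real N) < K" "ereal K < Liminf ?F ?h"
      using ereal_dense2 by (metis less_ereal.simps(1))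
    from less_LiminfD[OF K(2)] obtain B where B: "\<And>v. B \<le> \<bar>Im v\<bar> \<Longrightarrow> v \<in> Hol X \<Longrightarrow> ereal K < ?h v"
      unfolding eventually_inf_principal eventually_filtercomap_at_top_linorder by blast
    obtain v where v: "v \<in> Hol X" "B \<le> \<bar>Im v\<bar>" "period_area v \<le> K * a"
      by (rule small_periods[OF _ a(2,1) K(1) N]) (use False in auto)
    have "?h v = ereal (period_area v / a)" using a by simp
    also have "\<dots> \<le> ereal K" using v(3) a(1) by (simp add: pos_divide_le_eq)
    finally show False using B[OF v(2,1)] by simp
  qed
  then show ?thesis unfolding lagrange_constant_def using False by simp
qed

end

theorem lemma1p3:
  fixes I :: "'a translation_surface set" and g :: nat and k :: "nat list"
  assumes "2 * int g - 2 = int (sum_list k)"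
    and "invariant_locus g k I"
  shows "lagrange_spectrum I \<subseteq> {ereal (pi * ((2 * real g + real (length k) - 2) / 2))..\<infinity>}"
proof
  fix x assume "x \<in> lagrange_spectrum I"
  then obtain X where X: "X \<in> I" "x = 1 / lagrange_constant X" unfolding lagrange_spectrum_def by blast
  have st: "X \<in> stratum g k" using assms(2) X(1) unfolding invariant_locus_def by blast
  then interpret tsurf X by unfold_locales (simp add: stratum_def)
  define N where "N = (\<Sum>p\<in>Sing. cone_angle p)"
  have "N = sum_list k + length k" unfolding N_def by (rule sum_cone_angle[OF st])
  then have "2 * real g + real (length k) - 2 = real N" using assms(1) by linarith
  moreover have "ereal (pi * (real N / 2)) \<le> 1 / lagrange_constant X"
  proof (cases "N = 0")
    \<comment> \<open>This happens only in genus 1 without marked points. The claimed lower bound is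
      then 0, and \<open>lagrange_constant_bound\<close> does not apply.\<close>
    case True
    have "0 \<le> 1 / lagrange_constant X" using lagrange_constant_nonneg by (simp add: divide_ereal_def inverse_ereal_ge0I)
    then show ?thesis using True by (simp add: zero_ereal_def[symmetric])
  next
    case False
    have "lagrange_constant X \<le> ereal (1 / (pi * (real N / 2)))"
      using lagrange_constant_bound[OF N_def] False by simp
    then show ?thesis using lagrange_constant_nonneg False by (intro ereal_le_divide_bound) auto
  qed
  ultimately show "x \<in> {ereal (pi * ((2 * real g + real (length k) - 2) / 2))..\<infinity>}"
    unfolding X(2) by simp
qed

end
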